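(* Let $S$ be one of the following three $*$-semigroups, each with coordinatewise addition as composition: 1. $\mathbb{Z}^2$ with involution $(k,n)^*=(n,k)$; 2. $\mathbb{N}_0\times\mathbb{Z}$ with involution $(k,n)^*=(k,-n)$; 3. $\mathsf{N}_+:=\{(k,n)\in\mathbb{Z}^2: k+n\geq 0\}$ with involution $(k,n)^*=(n,k)$. Then $\Sigma_h\mathbb{C}[S]^2=\mathbb{C}[S]_+$.
   Context: For an abelian $*$-semigroup $S$ with neutral element, $\mathbb{C}[S]$ denotes the semigroup $*$-algebra: the complex vector space with basis $S$, with multiplication the bilinear extension of the composition of $S$ and involution the conjugate-linear extension of the involution of $S$. For a commutative unital complex $*$-algebra $A$, $\Sigma_h A^2$ is the set of finite sums $\sum_j a_j^*a_j$ of hermitean squares with $a_j\in A$. A character of $A$ is a unital $*$-homomorphism $\chi: A\to\mathbb{C}$, and $A_+:=\{a\in A:\chi(a)\geq 0 \text{ for all characters }\chi \text{ of } A\}$ (where $\chi(a)\ge 0$ means $\chi(a)$ is real and non-negative). *)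

theory Defs
  imports Complex_Main
    "HOL-Library.Poly_Mapping"
    "HOL-Library.Product_Plus"
    "HOL-Library.Nonpos_Ints"
begin

text \<open>
  An abelian \<open>*\<close>-semigroup with neutral element is represented as a submonoid \<open>S\<close> of the
  additive monoid of a type, together with its involution \<open>adj\<close>; only the values of \<open>adj\<close>
  on \<open>S\<close> matter. Similarly, a commutative unital complex \<open>*\<close>-algebra is represented as a
  carrier \<open>A\<close> inside a commutative ring type (sharing its unit), with scalar multiplication
  \<open>scale\<close> and involution \<open>star\<close>, both relevant only on \<open>A\<close>.
\<close>

locale abelian_star_semigroup =
  fixes S :: "'s::comm_monoid_add set" and adj :: "'s \<Rightarrow> 's"
  assumes zero_mem: "0 \<in> S"
    and add_mem: "s \<in> S \<Longrightarrow> t \<in> S \<Longrightarrow> s + t \<in> S"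
    and adj_mem: "s \<in> S \<Longrightarrow> adj s \<in> S"
    and adj_add: "s \<in> S \<Longrightarrow> t \<in> S \<Longrightarrow> adj (s + t) = adj t + adj s"
    and adj_adj: "s \<in> S \<Longrightarrow> adj (adj s) = s"

locale complex_star_algebra =
  fixes A :: "'a::comm_ring_1 set" and scale :: "complex \<Rightarrow> 'a \<Rightarrow> 'a" and star :: "'a \<Rightarrow> 'a"
  assumes zero_mem: "0 \<in> A" and one_mem: "1 \<in> A"
    and add_mem: "a \<in> A \<Longrightarrow> b \<in> A \<Longrightarrow> a + b \<in> A"
    and mult_mem: "a \<in> A \<Longrightarrow> b \<in> A \<Longrightarrow> a * b \<in> A"
    and scale_mem: "a \<in> A \<Longrightarrow> scale c a \<in> A"
    and star_mem: "a \<in> A \<Longrightarrow> star a \<in> A"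
    and scale_one: "a \<in> A \<Longrightarrow> scale 1 a = a"
    and scale_scale: "a \<in> A \<Longrightarrow> scale c (scale d a) = scale (c * d) a"
    and scale_add_left: "a \<in> A \<Longrightarrow> scale (c + d) a = scale c a + scale d a"
    and scale_add_right: "a \<in> A \<Longrightarrow> b \<in> A \<Longrightarrow> scale c (a + b) = scale c a + scale c b"
    and scale_mult: "a \<in> A \<Longrightarrow> b \<in> A \<Longrightarrow> scale c (a * b) = scale c a * b"
    and star_add: "a \<in> A \<Longrightarrow> b \<in> A \<Longrightarrow> star (a + b) = star a + star b"
    and star_scale: "a \<in> A \<Longrightarrow> star (scale c a) = scale (cnj c) (star a)"
    and star_mult: "a \<in> A \<Longrightarrow> b \<in> A \<Longrightarrow> star (a * b) = star b * star a"
    and star_star: "a \<in> A \<Longrightarrow> star (star a) = a"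

definition hermitian_square_sums :: "'a::comm_ring_1 set \<Rightarrow> ('a \<Rightarrow> 'a) \<Rightarrow> 'a set" where
  "hermitian_square_sums A star =
     {\<Sum>j<n. star (a j) * a j | (n::nat) a. \<forall>j<n. a j \<in> A}"

definition algebra_characters ::
  "'a::comm_ring_1 set \<Rightarrow> (complex \<Rightarrow> 'a \<Rightarrow> 'a) \<Rightarrow> ('a \<Rightarrow> 'a) \<Rightarrow> ('a \<Rightarrow> complex) set" where
  "algebra_characters A scale star =
     {\<chi>. \<chi> 1 = 1 \<and>
         (\<forall>a\<in>A. \<forall>b\<in>A. \<chi> (a + b) = \<chi> a + \<chi> b) \<and>
         (\<forall>a\<in>A. \<forall>b\<in>A. \<chi> (a * b) = \<chi> a * \<chi> b) \<and>
         (\<forall>c. \<forall>a\<in>A. \<chi> (scale c a) = c * \<chi> a) \<and>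
         (\<forall>a\<in>A. \<chi> (star a) = cnj (\<chi> a))}"

definition character_nonneg ::
  "'a::comm_ring_1 set \<Rightarrow> (complex \<Rightarrow> 'a \<Rightarrow> 'a) \<Rightarrow> ('a \<Rightarrow> 'a) \<Rightarrow> 'a set" where
  "character_nonneg A scale star =
     {a \<in> A. \<forall>\<chi> \<in> algebra_characters A scale star. \<chi> a \<in> \<real>\<^sub>\<ge>\<^sub>0}"

text \<open>
  The semigroup \<open>*\<close>-algebra of \<open>S\<close> consists of the finitely supported functions with support
  in \<open>S\<close>; the basis element of \<open>s\<close> is \<open>Poly_Mapping.single s 1\<close>, and the multiplication of
  finitely supported functions is convolution.
\<close>

definition semigroup_algebra :: "'s::comm_monoid_add set \<Rightarrow> ('s \<Rightarrow>\<^sub>0 complex) set" where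
  "semigroup_algebra S = {f. Poly_Mapping.keys f \<subseteq> S}"

definition semigroup_algebra_scale :: "complex \<Rightarrow> ('s \<Rightarrow>\<^sub>0 complex) \<Rightarrow> ('s \<Rightarrow>\<^sub>0 complex)" where
  "semigroup_algebra_scale c f = Poly_Mapping.map ((*) c) f"

definition semigroup_algebra_star :: "('s \<Rightarrow> 's) \<Rightarrow> ('s \<Rightarrow>\<^sub>0 complex) \<Rightarrow> ('s \<Rightarrow>\<^sub>0 complex)" where
  "semigroup_algebra_star adj f =
     (\<Sum>s\<in>Poly_Mapping.keys f. Poly_Mapping.single (adj s) (cnj (Poly_Mapping.lookup f s)))"

definition semigroup_hermitian_square_sums ::
  "'s::comm_monoid_add set \<Rightarrow> ('s \<Rightarrow> 's) \<Rightarrow> ('s \<Rightarrow>\<^sub>0 complex) set" where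
  "semigroup_hermitian_square_sums S adj =
     hermitian_square_sums (semigroup_algebra S) (semigroup_algebra_star adj)"

definition semigroup_character_nonneg ::
  "'s::comm_monoid_add set \<Rightarrow> ('s \<Rightarrow> 's) \<Rightarrow> ('s \<Rightarrow>\<^sub>0 complex) set" where
  "semigroup_character_nonneg S adj =
     character_nonneg (semigroup_algebra S) semigroup_algebra_scale (semigroup_algebra_star adj)"

definition swap_adj :: "int \<times> int \<Rightarrow> int \<times> int" where
  "swap_adj = (\<lambda>(k, n). (n, k))"

definition neg_snd_adj :: "nat \<times> int \<Rightarrow> nat \<times> int" where
  "neg_snd_adj = (\<lambda>(k, n). (k, - n))"

definition N_plus :: "(int \<times> int) set" where
  "N_plus = {(k, n). k + n \<ge> 0}"


lemma abelian_star_semigroup_int_int: "abelian_star_semigroup UNIV swap_adj"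
  by unfold_locales (auto simp: swap_adj_def)

lemma abelian_star_semigroup_nat_int: "abelian_star_semigroup UNIV neg_snd_adj"
  by unfold_locales (auto simp: neg_snd_adj_def)

lemma abelian_star_semigroup_N_plus: "abelian_star_semigroup N_plus swap_adj"
  by unfold_locales (auto simp: swap_adj_def N_plus_def zero_prod_def)

lemma lookup_semigroup_algebra_scale:
  "Poly_Mapping.lookup (semigroup_algebra_scale c f) s = c * Poly_Mapping.lookup f s"
  by (simp add: semigroup_algebra_scale_def Poly_Mapping.map.rep_eq when_def)

lemma semigroup_algebra_scale_eq:
  fixes f :: "'s::comm_monoid_add \<Rightarrow>\<^sub>0 complex"
  shows "semigroup_algebra_scale c f = Poly_Mapping.single 0 c * f"
  by (simp add: semigroup_algebra_scale_def mult_map_scale_conv_mult)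

lemma semigroup_algebra_scale_single:
  "semigroup_algebra_scale c (Poly_Mapping.single s d) = Poly_Mapping.single s (c * d)"
  by (rule poly_mapping_eqI)
    (simp add: lookup_semigroup_algebra_scale lookup_single when_def)

lemma semigroup_algebra_star_superset:
  assumes "finite K" "Poly_Mapping.keys f \<subseteq> K"
  shows "semigroup_algebra_star adj f =
    (\<Sum>s\<in>K. Poly_Mapping.single (adj s) (cnj (Poly_Mapping.lookup f s)))"
  unfolding semigroup_algebra_star_def
  by (rule sum.mono_neutral_left) (use assms in \<open>auto simp: in_keys_iff\<close>)

lemma semigroup_algebra_star_zero: "semigroup_algebra_star adj 0 = 0"
  by (simp add: semigroup_algebra_star_def)

lemma semigroup_algebra_star_single:
  "semigroup_algebra_star adj (Poly_Mapping.single s c) = Poly_Mapping.single (adj s) (cnj c)"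
  by (simp add: semigroup_algebra_star_def)

lemma semigroup_algebra_star_add:
  "semigroup_algebra_star adj (f + g) =
     semigroup_algebra_star adj f + semigroup_algebra_star adj g"
proof -
  let ?K = "Poly_Mapping.keys f \<union> Poly_Mapping.keys g"
  have K: "finite ?K" "Poly_Mapping.keys (f + g) \<subseteq> ?K"
    using keys_add[of f g] by auto
  show ?thesis
    using K by (simp add: semigroup_algebra_star_superset[of ?K] lookup_add single_add
      sum.distrib)
qed

lemma semigroup_algebra_star_sum:
  "semigroup_algebra_star adj (\<Sum>i\<in>I. f i) = (\<Sum>i\<in>I. semigroup_algebra_star adj (f i))"
  by (induction I rule: infinite_finite_induct)
    (simp_all add: semigroup_algebra_star_zero semigroup_algebra_star_add)

lemma semigroup_algebra_expansion:
  fixes f :: "'s \<Rightarrow>\<^sub>0 complex"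
  shows "f = (\<Sum>s\<in>Poly_Mapping.keys f. Poly_Mapping.single s (Poly_Mapping.lookup f s))"
  by (rule poly_mapping_eqI) (simp add: lookup_sum lookup_single when_def in_keys_iff)

context abelian_star_semigroup
begin

lemma semigroup_algebra_star_scale:
  "semigroup_algebra_star adj (semigroup_algebra_scale c f) =
     semigroup_algebra_scale (cnj c) (semigroup_algebra_star adj f)"
proof -
  have keys: "Poly_Mapping.keys (semigroup_algebra_scale c f) \<subseteq> Poly_Mapping.keys f"
    by (auto simp: in_keys_iff lookup_semigroup_algebra_scale)
  have "semigroup_algebra_star adj (semigroup_algebra_scale c f) =
    (\<Sum>s\<in>Poly_Mapping.keys f.
       Poly_Mapping.single (adj s) (cnj c * cnj (Poly_Mapping.lookup f s)))"
    using keys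
    by (simp add: semigroup_algebra_star_superset[of "Poly_Mapping.keys f"]
      lookup_semigroup_algebra_scale)
  also have "\<dots> = semigroup_algebra_scale (cnj c) (semigroup_algebra_star adj f)"
    by (simp add: semigroup_algebra_star_def semigroup_algebra_scale_eq sum_distrib_left
      mult_single)
  finally show ?thesis .
qed

lemma semigroup_algebra_star_mult:
  assumes "f \<in> semigroup_algebra S" "g \<in> semigroup_algebra S"
  shows "semigroup_algebra_star adj (f * g) =
     semigroup_algebra_star adj g * semigroup_algebra_star adj f"
proof -
  let ?f = "Poly_Mapping.lookup f" and ?g = "Poly_Mapping.lookup g"
  have "f * g = (\<Sum>s\<in>Poly_Mapping.keys f. Poly_Mapping.single s (?f s)) *
      (\<Sum>t\<in>Poly_Mapping.keys g. Poly_Mapping.single t (?g t))"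
    using semigroup_algebra_expansion[of f] semigroup_algebra_expansion[of g] by metis
  then have "f * g = (\<Sum>s\<in>Poly_Mapping.keys f. \<Sum>t\<in>Poly_Mapping.keys g.
      Poly_Mapping.single (s + t) (?f s * ?g t))"
    by (simp add: sum_product mult_single)
  then have "semigroup_algebra_star adj (f * g) =
    (\<Sum>s\<in>Poly_Mapping.keys f. \<Sum>t\<in>Poly_Mapping.keys g.
      Poly_Mapping.single (adj (s + t)) (cnj (?f s) * cnj (?g t)))"
    by (simp add: semigroup_algebra_star_sum semigroup_algebra_star_single)
  also have "\<dots> = (\<Sum>s\<in>Poly_Mapping.keys f. \<Sum>t\<in>Poly_Mapping.keys g.
      Poly_Mapping.single (adj s) (cnj (?f s)) * Poly_Mapping.single (adj t) (cnj (?g t)))"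
    using assms
    by (intro sum.cong refl)
      (auto simp: semigroup_algebra_def mult_single adj_add subset_iff add.commute)
  also have "\<dots> = semigroup_algebra_star adj f * semigroup_algebra_star adj g"
    by (simp add: semigroup_algebra_star_def sum_product)
  finally show ?thesis by (simp add: mult.commute)
qed

lemma semigroup_algebra_star_star:
  assumes "f \<in> semigroup_algebra S"
  shows "semigroup_algebra_star adj (semigroup_algebra_star adj f) = f"
proof -
  have "semigroup_algebra_star adj (semigroup_algebra_star adj f) =
    (\<Sum>s\<in>Poly_Mapping.keys f. Poly_Mapping.single (adj (adj s)) (Poly_Mapping.lookup f s))"
    by (simp add: semigroup_algebra_star_def[of adj f] semigroup_algebra_star_sum
      semigroup_algebra_star_single)
  also have "\<dots> = (\<Sum>s\<in>Poly_Mapping.keys f. Poly_Mapping.single s (Poly_Mapping.lookup f s))"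
    using assms
    by (intro sum.cong refl) (auto simp: semigroup_algebra_def adj_adj subset_iff)
  also have "\<dots> = f" by (rule semigroup_algebra_expansion[symmetric])
  finally show ?thesis .
qed

lemma semigroup_algebra_star_mem:
  assumes "f \<in> semigroup_algebra S"
  shows "semigroup_algebra_star adj f \<in> semigroup_algebra S"
proof -
  have "Poly_Mapping.keys (semigroup_algebra_star adj f) \<subseteq> adj ` Poly_Mapping.keys f"
    unfolding semigroup_algebra_star_def
    by (rule order.trans[OF keys_sum]) auto
  then show ?thesis
    using assms adj_mem by (fastforce simp: semigroup_algebra_def)
qed

theorem complex_star_algebra_semigroup_algebra:
  "complex_star_algebra (semigroup_algebra S) semigroup_algebra_scale
     (semigroup_algebra_star adj)"
proof
  fix f g :: "'s \<Rightarrow>\<^sub>0 complex" and c d :: complex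
  assume f: "f \<in> semigroup_algebra S"
  show "semigroup_algebra_scale c f \<in> semigroup_algebra S"
    using f by (auto simp: semigroup_algebra_def in_keys_iff lookup_semigroup_algebra_scale)
  show "semigroup_algebra_scale 1 f = f"
    by (simp add: semigroup_algebra_scale_eq)
  show "semigroup_algebra_scale c (semigroup_algebra_scale d f) =
      semigroup_algebra_scale (c * d) f"
    by (rule poly_mapping_eqI) (simp add: lookup_semigroup_algebra_scale)
  show "semigroup_algebra_scale (c + d) f =
      semigroup_algebra_scale c f + semigroup_algebra_scale d f"
    by (simp add: semigroup_algebra_scale_eq single_add distrib_right)
  assume g: "g \<in> semigroup_algebra S"
  show "f + g \<in> semigroup_algebra S"
    using f g keys_add[of f g] by (auto simp: semigroup_algebra_def)
  show "f * g \<in> semigroup_algebra S"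
    using f g keys_mult[of f g] add_mem by (fastforce simp: semigroup_algebra_def)
  show "semigroup_algebra_scale c (f + g) =
      semigroup_algebra_scale c f + semigroup_algebra_scale c g"
    by (simp add: semigroup_algebra_scale_eq distrib_left)
  show "semigroup_algebra_scale c (f * g) = semigroup_algebra_scale c f * g"
    by (simp add: semigroup_algebra_scale_eq mult.assoc)
  show "semigroup_algebra_star adj (f + g) =
      semigroup_algebra_star adj f + semigroup_algebra_star adj g"
    by (rule semigroup_algebra_star_add)
  show "semigroup_algebra_star adj (f * g) =
      semigroup_algebra_star adj g * semigroup_algebra_star adj f"
    using f g by (rule semigroup_algebra_star_mult)
next
  show "0 \<in> semigroup_algebra S" "1 \<in> semigroup_algebra S"
    by (simp_all add: semigroup_algebra_def zero_mem)
qed (simp_all add: semigroup_algebra_star_mem semigroup_algebra_star_scale semigroup_algebra_star_star)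

end

end

theory Submission
  imports Defs "HOL-Computational_Algebra.Computational_Algebra" "HOL-Computational_Algebra.Field_as_Ring"
begin


section \<open>Formal power series with complex coefficients\<close>

text \<open>Characters send hermitean squares to squared moduli, which gives the easy inclusion
  (\<open>hermitian_square_sums_nonneg\<close>). For the converse, a point (x, u) with x real and
  |u| = 1 acts on N_0 x Z by (k, n) -> x^k u^n, and on \<open>N_plus\<close> by (k, n) -> z^k
  cnj(z)^n with z = x u, that is by x^(k+n) u^(k-n). These points separate the elements of the
  algebras, so everything reduces to functions: a nonnegative polynomial p in x with Laurent
  polynomials in u as coefficients is a finite sum of squared moduli of such functions
  (\<open>nonneg_laurent_imp_sos\<close>).

  This is an induction on the degree in x. Let F be a polynomial with p = F / u^n on the circle. If
  F and dF/dx share a prime factor of positive degree in x, a squared modulus can be divided out of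
  p (\<open>split_off_norm\<close>). Otherwise A F + B dF/dx = r(u) with r nonzero. At a minimum in
  x the derivative vanishes, and this bounds p below by a constant times (1 + x^2)^d and a power of
  the distances of u to finitely many points of the circle (\<open>separable_lower_bound\<close>).
  So p degenerates, also for x at infinity, only over a finite set U.

  If the bound is uniform in u, averaging against a sampled Fejer kernel writes p as a combination,
  with squared moduli as weights, of nonnegative polynomials in x alone, and those are squared
  moduli (\<open>strictly_positive_imp_sos\<close>). Near a point of U, a Cayley parameter t turns p
  into a polynomial in x and t bounded below by a multiple of |t|^m. Over the power series in t,
  Puiseux's theorem splits it into linear factors. The lower bound excludes real branches, so
  selecting one of each pair of conjugate branches exhibits the polynomial as f times its conjugate
  (\<open>positive_imp_fps_norm\<close>). Truncating f approximates p by a squared modulus to any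
  order at that point.

  The Chinese remainder theorem combines the local f into one F whose squared modulus agrees with p
  to high order at all points of U (\<open>simultaneous_norm_approximation\<close>). With b a
  squared modulus that vanishes exactly on U, and after a small correction of p, one gets p = (1 -
  b)^k |F|^2 + b q, where q is uniformly positive for large even k
  (\<open>sos_of_lower_bound\<close>).

  On N_0 x Z this lifts back directly. For \<open>N_plus\<close> the squares are first split by
  parity, and Z^2 is reduced to \<open>N_plus\<close> by an invertible factor.\<close>

locale comm_ring_hom_map =
  fixes h :: "'a::comm_ring_1 \<Rightarrow> 'b::comm_ring_1"
  assumes map_zero: "h 0 = 0" and map_one: "h 1 = 1"
    and map_add: "h (a + b) = h a + h b" and map_mult: "h (a * b) = h a * h b"
begin

lemma map_uminus: "h (- a) = - h a"
  using map_add[of a "- a"] map_zero by (simp add: eq_neg_iff_add_eq_0 add.commute)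

lemma map_power: "h (a ^ n) = h a ^ n"
  by (induction n) (simp_all add: map_one map_mult)

lemma map_sum: "h (sum f I) = (\<Sum>i\<in>I. h (f i))"
  by (induction I rule: infinite_finite_induct) (simp_all add: map_zero map_add)

lemma coeff_map_hom: "coeff (map_poly h p) i = h (coeff p i)"
  by (simp add: coeff_map_poly map_zero)

lemma map_poly_hom: "comm_ring_hom_map (map_poly h)"
proof
  show "map_poly h 0 = 0" by simp
  show "map_poly h 1 = 1" by (simp add: map_poly_1 map_one)
  fix p q
  show "map_poly h (p + q) = map_poly h p + map_poly h q"
    by (rule poly_eqI) (simp add: coeff_map_hom map_add)
  show "map_poly h (p * q) = map_poly h p * map_poly h q"
    by (rule poly_eqI) (simp add: coeff_map_hom coeff_mult map_sum map_mult)
qed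

lemma map_poly_lin: "map_poly h [:a, b:] = [:h a, h b:]"
  by (rule poly_eqI) (simp add: coeff_map_hom coeff_pCons map_zero split: nat.splits)

lemma poly_map_hom: "poly (map_poly h p) (h x) = h (poly p x)"
  by (induction p) (simp_all add: map_zero map_poly_pCons map_add map_mult)

lemma map_prod_mset: "h (prod_mset M) = prod_mset (image_mset h M)"
  by (induction M) (simp_all add: map_one map_mult)

lemma map_poly_prod_mset_lin:
  "map_poly h (\<Prod>x\<in>#M. [:- x, 1:]) = (\<Prod>x\<in>#image_mset h M. [:- x, 1:])"
proof -
  interpret P: comm_ring_hom_map "map_poly h" by (rule map_poly_hom)
  show ?thesis
    by (simp add: P.map_prod_mset multiset.map_comp o_def map_poly_lin map_uminus map_one)
qed

end

section \<open>Conjugation, rotation t -> z t and ramification t -> t^k of power series\<close>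

definition fps_bar :: "complex fps \<Rightarrow> complex fps" where
  "fps_bar f = Abs_fps (\<lambda>n. cnj (fps_nth f n))"

definition fps_rot :: "complex \<Rightarrow> complex fps \<Rightarrow> complex fps" where
  "fps_rot z f = Abs_fps (\<lambda>n. z ^ n * fps_nth f n)"

text \<open>Substituting t^k for t replaces the adjunction of a k-th root of t, so Puiseux series
  never have to be constructed.\<close>

definition fps_expand :: "nat \<Rightarrow> complex fps \<Rightarrow> complex fps" where
  "fps_expand k f = Abs_fps (\<lambda>n. if k dvd n then fps_nth f (n div k) else 0)"

lemma fps_bar_nth [simp]: "fps_nth (fps_bar f) n = cnj (fps_nth f n)"
  by (simp add: fps_bar_def)

lemma fps_rot_nth [simp]: "fps_nth (fps_rot z f) n = z ^ n * fps_nth f n"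
  by (simp add: fps_rot_def)

lemma fps_expand_nth [simp]:
  "fps_nth (fps_expand k f) n = (if k dvd n then fps_nth f (n div k) else 0)"
  by (simp add: fps_expand_def)

interpretation bar: comm_ring_hom_map fps_bar
  by unfold_locales (auto intro!: fps_ext simp: fps_mult_nth)

interpretation rot: comm_ring_hom_map "fps_rot z" for z
proof
  fix f g
  show "fps_rot z (f * g) = fps_rot z f * fps_rot z g"
  proof (rule fps_ext)
    fix n
    have "z ^ n * (fps_nth f i * fps_nth g (n - i)) = z ^ i * fps_nth f i * (z ^ (n - i) * fps_nth g (n - i))"
      if "i \<in> {0..n}" for i
      using that power_add[of z i "n - i"] by simp
    then show "fps_nth (fps_rot z (f * g)) n = fps_nth (fps_rot z f * fps_rot z g) n"
      by (auto simp: fps_mult_nth sum_distrib_left simp del: mult_cancel_left mult_cancel_right intro!: sum.cong)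
  qed
qed (auto intro!: fps_ext simp: algebra_simps)

lemma fps_expand_conv_compose: "k > 0 \<Longrightarrow> fps_expand k f = f oo fps_X ^ k"
proof (rule fps_ext)
  fix n assume k: "k > 0"
  have "fps_nth (f oo fps_X ^ k) n = (\<Sum>i=0..n. fps_nth f i * (if n = k * i then 1 else 0))"
    unfolding fps_compose_nth by (intro sum.cong) (simp_all add: power_mult[symmetric] fps_X_power_nth)
  also have "\<dots> = (\<Sum>i=0..n. if i = n div k \<and> k dvd n then fps_nth f i else 0)"
    using k by (intro sum.cong) (auto)
  also have "\<dots> = fps_nth (fps_expand k f) n"
    by (cases "k dvd n") (simp_all add: div_le_dividend)
  finally show "fps_nth (fps_expand k f) n = fps_nth (f oo fps_X ^ k) n" by simp
qed

lemma comm_ring_hom_map_expand: "k > 0 \<Longrightarrow> comm_ring_hom_map (fps_expand k)"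
  by unfold_locales (simp_all add: fps_expand_conv_compose fps_compose_add_distrib fps_compose_mult_distrib)

lemma fps_expand_expand: "fps_expand k (fps_expand l f) = fps_expand (k * l) f"
proof (rule fps_ext)
  fix n show "fps_nth (fps_expand k (fps_expand l f)) n = fps_nth (fps_expand (k * l) f) n"
  proof (cases "k = 0")
    case False
    then show ?thesis
      by (auto simp: div_mult2_eq dvd_div_iff_mult mult.commute elim: dvd_mult_left)
  qed auto
qed

lemma fps_expand_inj: "k > 0 \<Longrightarrow> fps_expand k f = fps_expand k g \<Longrightarrow> f = g"
proof (rule fps_ext)
  fix n assume k: "k > 0" and eq: "fps_expand k f = fps_expand k g"
  have "fps_nth (fps_expand k f) (k * n) = fps_nth (fps_expand k g) (k * n)" using eq by simp
  then show "fps_nth f n = fps_nth g n" using k by simp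
qed

lemma fps_rot_rot: "fps_rot z (fps_rot w f) = fps_rot (z * w) f"
  by (rule fps_ext) (simp add: power_mult_distrib)

lemma fps_bar_bar [simp]: "fps_bar (fps_bar f) = f"
  by (rule fps_ext) simp

lemma fps_bar_rot: "fps_bar (fps_rot z f) = fps_rot (cnj z) (fps_bar f)"
  by (rule fps_ext) simp

lemma fps_rot_one [simp]: "fps_rot 1 f = f"
  by (rule fps_ext) simp

lemma fps_bar_expand: "fps_bar (fps_expand k f) = fps_expand k (fps_bar f)"
  by (rule fps_ext) simp

lemma fps_rot_expand: "z ^ k = 1 \<Longrightarrow> fps_rot z (fps_expand k f) = fps_expand k f"
  by (rule fps_ext) (auto simp: power_mult elim!: dvdE)

text \<open>A primitive k-th root of unity z suffices: z^n differs from 1 unless k divides n, so all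
  other coefficients vanish.\<close>

lemma fps_rot_invariant_imp_expand:
  assumes "k > 0" "\<And>z. z ^ k = 1 \<Longrightarrow> fps_rot z f = f"
  shows "\<exists>g. f = fps_expand k g"
proof
  define z where "z = cis (2 * pi / real k)"
  have zk: "z ^ k = 1" using assms(1) by (simp add: z_def DeMoivre)
  show "f = fps_expand k (Abs_fps (\<lambda>n. fps_nth f (k * n)))"
  proof (rule fps_ext)
    fix n
    show "fps_nth f n = fps_nth (fps_expand k (Abs_fps (\<lambda>n. fps_nth f (k * n)))) n"
    proof (cases "k dvd n")
      case False
      have "z ^ n \<noteq> 1"
      proof
        assume "z ^ n = 1"
        then have "cis (2 * pi * real n / real k) = 1" by (simp add: z_def DeMoivre mult.commute)
        then have "cos (2 * pi * real n / real k) = 1" by (simp add: complex_eq_iff)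
        then obtain m :: int where "2 * pi * real n / real k = of_int m * 2 * pi"
          using cos_one_2pi_int by auto
        then have "real n = of_int m * real k" using assms(1) by (simp add: field_simps)
        then have "int n = m * int k" by (metis of_int_eq_iff of_int_mult of_int_of_nat_eq)
        then have "int k dvd int n" by simp
        with False show False by simp
      qed
      moreover have "z ^ n * fps_nth f n = fps_nth f n"
        using assms(2)[OF zk] by (metis fps_rot_nth)
      ultimately show ?thesis using False by simp
    qed auto
  qed
qed


section \<open>Hensel's lemma and Puiseux's theorem\<close>

definition layer :: "nat \<Rightarrow> complex fps poly \<Rightarrow> complex poly" where
  "layer k p = map_poly (\<lambda>f. fps_nth f k) p"

lemma coeff_layer [simp]: "coeff (layer k p) i = fps_nth (coeff p i) k"
  by (simp add: layer_def coeff_map_poly)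

lemma layer_mult: "layer k (p * q) = (\<Sum>i\<le>k. layer i p * layer (k - i) q)"
proof (rule poly_eqI)
  fix n
  have "coeff (layer k (p * q)) n =
      (\<Sum>j\<le>n. \<Sum>i\<le>k. fps_nth (coeff p j) i * fps_nth (coeff q (n - j)) (k - i))"
    by (simp add: coeff_mult fps_sum_nth fps_mult_nth atMost_atLeast0)
  also have "\<dots> = coeff (\<Sum>i\<le>k. layer i p * layer (k - i) q) n"
    by (subst sum.swap) (simp add: coeff_sum coeff_mult)
  finally show "coeff (layer k (p * q)) n = coeff (\<Sum>i\<le>k. layer i p * layer (k - i) q) n" .
qed

lemma layer_eqI: "(\<And>k. layer k p = layer k q) \<Longrightarrow> p = q"
  by (rule poly_eqI, rule fps_ext) (metis coeff_layer)

interpretation layer0: comm_ring_hom_map "layer 0"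
  unfolding layer_def
  by (rule comm_ring_hom_map.map_poly_hom) (unfold_locales; simp)

lemma poly_of_layers:
  assumes "\<And>k. degree (g k) \<le> m"
  obtains p where "\<And>k. layer k p = g k" "degree p \<le> m"
proof
  let ?p = "\<Sum>i\<le>m. monom (Abs_fps (\<lambda>k. coeff (g k) i)) i"
  have c: "coeff ?p i = Abs_fps (\<lambda>k. coeff (g k) i)" for i
    using assms by (auto simp: coeff_sum coeff_monom intro!: fps_ext)
      (metis coeff_eq_0 le_less_trans not_le)
  show "layer k ?p = g k" for k by (rule poly_eqI) (simp add: c)
  show "degree ?p \<le> m" by (intro degree_sum_le) (auto intro: order.trans[OF degree_monom_le])
qed

text \<open>Reduce a Bezout solution modulo \<open>g\<close>; the degree of \<open>e\<close> then
  forces the bound on the other cofactor.\<close>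

lemma coprime_poly_bezout_degree:
  fixes g h e :: "complex poly"
  assumes "coprime g h" "g \<noteq> 0" "h \<noteq> 0" "degree e < degree g + degree h" "degree h > 0" "degree g > 0"
  shows "\<exists>a b. a * h + b * g = e \<and> degree a < degree g \<and> degree b < degree h"
proof -
  obtain r s where rs: "r * g + s * h = 1"
    using bezout_coefficients_fst_snd[of g h] assms(1)
    by (metis coprime_imp_gcd_eq_1)
  define a where "a = (e * s) mod g"
  define b where "b = e * r + (e * s) div g * h"
  have "a * h + b * g = e * (r * g + s * h)"
    unfolding a_def b_def by (simp add: algebra_simps minus_mod_eq_mult_div[symmetric])
      (metis (no_types, lifting) distrib_left div_mult_mod_eq mult.assoc mult.commute add.commute)
  then have eq: "a * h + b * g = e" by (simp add: rs)
  have da: "degree a < degree g"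
    using degree_mod_less'[of g "e * s"] assms unfolding a_def by (cases "(e * s) mod g = 0") auto
  have "degree (a * h) < degree g + degree h"
    using degree_mult_le[of a h] da by linarith
  then have "degree (b * g) < degree g + degree h"
    using eq assms(4) by (metis add_diff_cancel_left' degree_diff_less)
  then have "degree b < degree h"
    using assms by (cases "b = 0") (auto simp: degree_mult_eq)
  then show ?thesis using eq da by blast
qed

text \<open>The t^k coefficients of the two lifted factors. \<open>sol\<close> is a solver for the
  linear equation a h + b g = e, where e is what the lower layers leave of the k-th layer of the
  product.\<close>

function hensel_layers ::
  "(complex poly \<Rightarrow> complex poly \<times> complex poly) \<Rightarrow> (nat \<Rightarrow> complex poly) \<Rightarrow>
     complex poly \<times> complex poly \<Rightarrow> nat \<Rightarrow> complex poly \<times> complex poly" where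
  "hensel_layers sol q gh k = (if k = 0 then gh else
     sol (q k - (\<Sum>i\<in>{1..<k}. fst (hensel_layers sol q gh i) * snd (hensel_layers sol q gh (k - i)))))"
  by auto
termination by (relation "measure (\<lambda>(sol, q, gh, k). k)") auto

declare hensel_layers.simps [simp del]

text \<open>Comparing coefficients of t^k leaves G_k h + H_k g = e with e already known. It is
  solvable because g and h are coprime, and the corrections have degrees below those of g and h, so
  both lifts stay monic.\<close>

lemma hensel_monic:
  fixes Q :: "complex fps poly"
  assumes Q: "lead_coeff Q = 1" and fac: "layer 0 Q = g * h" and cop: "coprime g h"
    and monic: "lead_coeff g = 1" "lead_coeff h = 1" and pos: "degree g > 0" "degree h > 0"
  obtains G H where "Q = G * H" "lead_coeff G = 1" "lead_coeff H = 1"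
    "degree G = degree g" "degree H = degree h"
proof -
  have nz: "g \<noteq> 0" "h \<noteq> 0" using monic by auto
  have degQ: "degree Q = degree g + degree h"
  proof -
    have "coeff (layer 0 Q) (degree Q) = 1" using Q by simp
    moreover have "degree (layer 0 Q) \<le> degree Q" by (auto intro!: degree_le simp: coeff_eq_0)
    ultimately have "degree (layer 0 Q) = degree Q"
      by (metis le_degree zero_neq_one antisym)
    then show ?thesis using fac nz by (simp add: degree_mult_eq)
  qed
  have "\<forall>e. \<exists>ab. degree e < degree g + degree h \<longrightarrow>
      fst ab * h + snd ab * g = e \<and> degree (fst ab) < degree g \<and> degree (snd ab) < degree h"
    using coprime_poly_bezout_degree[OF cop nz] pos by auto
  then obtain sol where sol: "\<And>e. degree e < degree g + degree h \<Longrightarrow>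
      fst (sol e) * h + snd (sol e) * g = e \<and> degree (fst (sol e)) < degree g \<and> degree (snd (sol e)) < degree h"
    by metis
  define L where "L = hensel_layers sol (\<lambda>k. layer k Q) (g, h)"
  define G where "G k = fst (L k)" for k
  define H where "H k = snd (L k)" for k
  have L0: "G 0 = g" "H 0 = h" by (simp_all add: G_def H_def L_def hensel_layers.simps)
  have Lk: "L k = sol (layer k Q - (\<Sum>i\<in>{1..<k}. G i * H (k - i)))" if "k > 0" for k
    using that unfolding G_def H_def L_def by (subst hensel_layers.simps) simp
  have step: "degree (G k) < degree g \<and> degree (H k) < degree h \<and>
      (\<Sum>i\<le>k. G i * H (k - i)) = layer k Q" if "k > 0" for k
    using that
  proof (induction k rule: less_induct)
    case (less k)
    define e where "e = layer k Q - (\<Sum>i\<in>{1..<k}. G i * H (k - i))"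
    \<comment> \<open>The leading coefficient of \<open>Q\<close> is the constant series 1, so only
      layer 0 has full degree.\<close>
    have "degree (layer k Q) < degree g + degree h"
    proof (rule degree_lessI)
      show "layer k Q \<noteq> 0 \<or> degree g + degree h > 0" using pos by simp
      show "\<forall>i\<ge>degree g + degree h. coeff (layer k Q) i = 0"
      proof (intro allI impI)
        fix i assume "i \<ge> degree g + degree h"
        then consider "i = degree Q" | "i > degree Q" using degQ by linarith
        then show "coeff (layer k Q) i = 0" using Q less.prems by cases (auto simp: coeff_eq_0)
      qed
    qed
    moreover have "degree (\<Sum>i\<in>{1..<k}. G i * H (k - i)) < degree g + degree h"
    proof (rule degree_sum_less)
      fix i assume "i \<in> {1..<k}"
      then have "degree (G i) < degree g" "degree (H (k - i)) < degree h"
        using less.IH[of i] less.IH[of "k - i"] by auto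
      then show "degree (G i * H (k - i)) < degree g + degree h"
        using degree_mult_le[of "G i" "H (k - i)"] by linarith
    qed (use pos in simp)
    ultimately have "degree e < degree g + degree h"
      unfolding e_def by (rule degree_diff_less)
    note s = sol[OF this]
    have Gk: "G k = fst (sol e)" "H k = snd (sol e)"
      using Lk[OF less.prems] by (simp_all add: G_def H_def e_def)
    have "{..k} = insert 0 (insert k {1..<k})" using less.prems by auto
    then have "(\<Sum>i\<le>k. G i * H (k - i)) = G 0 * H k + (G k * H 0 + (\<Sum>i\<in>{1..<k}. G i * H (k - i)))"
      using less.prems by simp
    also have "\<dots> = e + (\<Sum>i\<in>{1..<k}. G i * H (k - i))"
      using s unfolding L0 Gk by (simp add: algebra_simps)
    also have "\<dots> = layer k Q" by (simp add: e_def)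
    finally show ?case using s Gk by simp
  qed
  have deg: "degree (G k) \<le> degree g" "degree (H k) \<le> degree h" for k
    using step[of k] L0 by (cases "k = 0"; simp)+
  obtain GG where GG: "\<And>k. layer k GG = G k" "degree GG \<le> degree g"
    using poly_of_layers[of G "degree g"] deg by auto
  obtain HH where HH: "\<And>k. layer k HH = H k" "degree HH \<le> degree h"
    using poly_of_layers[of H "degree h"] deg by auto
  have "Q = GG * HH"
  proof (rule layer_eqI)
    fix k show "layer k Q = layer k (GG * HH)"
      using step[of k] by (cases "k = 0") (simp_all add: layer_mult GG HH L0 fac)
  qed
  moreover have "coeff GG (degree g) = 1"
  proof (rule fps_ext)
    fix k show "fps_nth (coeff GG (degree g)) k = fps_nth 1 k"
      using GG(1)[of k] step[of k] monic L0
      by (cases "k = 0") (auto simp flip: coeff_layer simp: coeff_eq_0)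
  qed
  moreover have "coeff HH (degree h) = 1"
  proof (rule fps_ext)
    fix k show "fps_nth (coeff HH (degree h)) k = fps_nth 1 k"
      using HH(1)[of k] step[of k] monic L0
      by (cases "k = 0") (auto simp flip: coeff_layer simp: coeff_eq_0)
  qed
  moreover have "degree GG = degree g" "degree HH = degree h"
    using GG(2) HH(2) calculation le_degree[of GG "degree g"] le_degree[of HH "degree h"] by auto
  ultimately show ?thesis using that by metis
qed


section \<open>Puiseux's theorem\<close>

lemma degree_prod_mset_monic_linear [simp]:
  "degree (\<Prod>x\<in>#M. [:- x, 1 :: 'a::idom:]) = size M"
  "lead_coeff (\<Prod>x\<in>#M. [:- x, 1 :: 'a::idom:]) = 1"
proof -
  have "degree (\<Prod>x\<in>#M. [:- x, 1 :: 'a::idom:]) = size M \<and> (\<Prod>x\<in>#M. [:- x, 1 :: 'a:]) \<noteq> 0"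
    by (induction M) (auto simp: degree_mult_eq simp del: mult_pCons_left)
  moreover have "lead_coeff (\<Prod>x\<in>#M. [:- x, 1 :: 'a::idom:]) = 1"
    by (induction M) (auto simp: lead_coeff_mult simp del: mult_pCons_left)
  ultimately show "degree (\<Prod>x\<in>#M. [:- x, 1 :: 'a::idom:]) = size M"
    "lead_coeff (\<Prod>x\<in>#M. [:- x, 1 :: 'a::idom:]) = 1" by auto
qed

text \<open>The two top terms of the binomial expansion. This serves both to translate the
  subleading coefficient away and to read off the root of a pure power of a linear factor.\<close>

lemma coeff_pcompose_translate:
  fixes p :: "'a::idom poly"
  assumes "degree p \<le> Suc n"
  shows "coeff (pcompose p [:b, 1:]) n = coeff p n + of_nat (Suc n) * b * coeff p (Suc n)"
  using assms
proof (induction p arbitrary: n)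
  case (pCons c p)
  define q where "q = pcompose p [:b, 1:]"
  show ?case
  proof (cases n)
    case 0
    then have "degree p = 0" using pCons by (cases "p = 0") auto
    then obtain d where "p = [:d:]" by (rule degree_eq_zeroE)
    then show ?thesis using 0 by (simp add: pcompose_pCons)
  next
    case (Suc m)
    have dp: "degree p \<le> Suc m" using pCons.prems Suc by (cases "p = 0") auto
    have dq: "degree q = degree p" by (simp add: q_def degree_pcompose)
    have "coeff q (Suc m) = coeff p (Suc m)"
    proof (cases "degree p = Suc m")
      case True
      then show ?thesis
        using lead_coeff_comp[of "[:b, 1:]" p] dq by (simp add: q_def)
    next
      case False
      then show ?thesis using dp dq by (simp add: coeff_eq_0)
    qed
    moreover have "coeff q m = coeff p m + of_nat (Suc m) * b * coeff p (Suc m)"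
      unfolding q_def using pCons.IH dp by blast
    ultimately show ?thesis
      using Suc by (simp add: pcompose_pCons q_def[symmetric] coeff_pCons algebra_simps)
  qed
qed simp

lemma map_poly_expand_expand:
  assumes "k > 0" "l > 0"
  shows "map_poly (fps_expand k) (map_poly (fps_expand l) p) = map_poly (fps_expand (k * l)) p"
proof -
  interpret k: comm_ring_hom_map "fps_expand k" using assms by (intro comm_ring_hom_map_expand)
  interpret l: comm_ring_hom_map "fps_expand l" using assms by (intro comm_ring_hom_map_expand)
  interpret kl: comm_ring_hom_map "fps_expand (k * l)" using assms by (intro comm_ring_hom_map_expand) auto
  show ?thesis
    by (rule poly_eqI) (simp add: k.coeff_map_hom l.coeff_map_hom kl.coeff_map_hom fps_expand_expand)
qed

lemma fps_expand_fps_X_power [simp]: "k > 0 \<Longrightarrow> fps_expand k (fps_X ^ n) = fps_X ^ (k * n)"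
  by (rule fps_ext) (auto simp: fps_X_power_nth)

lemma map_poly_expand_1 [simp]: "map_poly (fps_expand (Suc 0)) p = p"
proof -
  have "fps_expand (Suc 0) = id" by (auto intro!: fps_ext)
  then show ?thesis by (simp add: map_poly_id)
qed

lemma fps_expand_eq_0_iff: "k > 0 \<Longrightarrow> fps_expand k f = 0 \<longleftrightarrow> f = 0"
  using fps_expand_inj[of k f 0] comm_ring_hom_map.map_zero[OF comm_ring_hom_map_expand] by auto

lemma subdegree_expand: "k > 0 \<Longrightarrow> subdegree (fps_expand k f) = k * subdegree f"
proof (cases "f = 0")
  case False
  assume k: "k > 0"
  show ?thesis
  proof (rule subdegreeI)
    show "fps_nth (fps_expand k f) (k * subdegree f) \<noteq> 0" using k False by simp
    fix i assume "i < k * subdegree f"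
    then show "fps_nth (fps_expand k f) i = 0" using k by (cases "k dvd i") (auto elim!: dvdE)
  qed
qed (simp add: fps_expand_eq_0_iff[THEN iffD2])

lemma pcompose_monom_one: "pcompose (monom 1 n) q = q ^ n"
  by (induction n) (simp_all add: monom_Suc pcompose_pCons pcompose_1 monom_0 flip: one_pCons)

lemma pcompose_prod_mset_linear:
  "pcompose (\<Prod>x\<in>#M. [:- x, 1:]) [:b, c:] = (\<Prod>x\<in>#M. [:b - x, c :: 'a::idom:])"
proof (induction M)
  case (add x M)
  have "pcompose [:- x, 1:] [:b, c:] = [:b - x, c:]" by (simp add: pcompose_pCons)
  then show ?case
    by (simp only: image_mset_add_mset prod_mset.add_mset pcompose_mult add.IH)
qed (simp add: pcompose_1)

lemma smult_power_prod_mset_linear: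
  "smult (a ^ size M) (\<Prod>x\<in>#M. [:- x, 1:]) = (\<Prod>x\<in>#M. [:- (a * x), a :: 'a::idom:])"
proof (induction M)
  case (add x M)
  have "smult (a ^ Suc (size M)) ([:- x, 1:] * (\<Prod>x\<in>#M. [:- x, 1:])) =
      smult a [:- x, 1:] * smult (a ^ size M) (\<Prod>x\<in>#M. [:- x, 1:])"
    by (simp only: mult_smult_left mult_smult_right smult_smult power_Suc mult.commute[of "a ^ size M" a])
  moreover have "smult a [:- x, 1:] = [:- (a * x), a:]" by simp
  ultimately show ?case
    by (simp only: image_mset_add_mset prod_mset.add_mset size_add_mset add.IH)
qed simp

text \<open>With a single root r the polynomial would be (x - r)^m, whose subleading coefficient -m
  r vanishes only for r = 0. So there are two distinct roots, and the roots can be distributed to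
  coprime factors.\<close>

lemma monic_complex_poly_splits_coprime:
  fixes p :: "complex poly"
  assumes "degree p = Suc (Suc n)" "lead_coeff p = 1" "coeff p (Suc n) = 0" "p \<noteq> monom 1 (Suc (Suc n))"
  obtains g h where "p = g * h" "coprime g h" "lead_coeff g = 1" "lead_coeff h = 1"
    "degree g > 0" "degree h > 0"
proof -
  have "\<exists>x y. x \<noteq> y \<and> poly p x = 0 \<and> poly p y = 0"
  proof (rule ccontr)
    assume no: "\<not> ?thesis"
    obtain x where x: "poly p x = 0"
      using alg_closed_imp_poly_has_root[of p] assms(1) by auto
    have nz: "p \<noteq> 0" using assms by auto
    have "set_mset (proots p) \<subseteq> {x}" using no x nz by auto
    then have "proots p = replicate_mset (size (proots p)) x"
      by (metis empty_not_insert set_mset_subset_singletonD)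
    then have "proots p = replicate_mset (Suc (Suc n)) x"
      using assms(1) by (simp add: size_proots_complex)
    then have "p = [:- x, 1:] ^ Suc (Suc n)"
      using complex_poly_decompose_multiset[of p] assms(2)
      by (simp del: replicate_mset_Suc power_Suc add: image_replicate_mset)
    then have p: "p = pcompose (monom 1 (Suc (Suc n))) [:- x, 1:]"
      by (simp only: pcompose_monom_one)
    then have "of_nat (Suc (Suc n)) * (- x) = 0"
      using coeff_pcompose_translate[of "monom 1 (Suc (Suc n))" "Suc n" "- x"] assms(3)
      by (simp add: degree_monom_eq coeff_monom)
    then have "x = 0" by (metis mult_eq_0_iff neg_equal_0_iff_equal of_nat_eq_0_iff nat.distinct(1))
    then show False using p assms(4) by simp
  qed
  then obtain r s where rs: "degree r > 0" "degree s > 0" "coprime r s" "p = r * s"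
    using alg_closed_imp_poly_splits_coprime[of p] assms(1)
    by (metis Suc_less_eq zero_less_Suc One_nat_def)
  define a b where "a = lead_coeff r" and "b = lead_coeff s"
  have ab: "a * b = 1" using assms(2) rs by (simp add: lead_coeff_mult a_def b_def)
  then have nz: "a \<noteq> 0" "b \<noteq> 0" by auto
  show ?thesis
  proof
    show "p = smult b r * smult a s" using rs(4) ab by (simp add: mult.commute)
    show "coprime (smult b r) (smult a s)"
    proof (rule coprimeI)
      fix c assume "c dvd smult b r" "c dvd smult a s"
      then have "c dvd r" "c dvd s" using nz by (metis dvd_smult_cancel)+
      then show "is_unit c" using rs(3) by (meson coprime_common_divisor)
    qed
    show "lead_coeff (smult b r) = 1" "lead_coeff (smult a s) = 1"
      using ab by (simp_all only: a_def b_def lead_coeff_smult mult.commute)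
    show "degree (smult b r) > 0" "degree (smult a s) > 0" using rs nz by simp_all
  qed
qed

text \<open>Induction on the degree. After a translation kills the subleading coefficient, scaling x
  by t to the least slope of the Newton polygon gives a polynomial whose value at t = 0 is not x^m
  but still lacks the subleading term. It splits coprimely there, Hensel lifts the splitting, and
  both factors have smaller degree.\<close>

theorem puiseux:
  fixes Q :: "complex fps poly"
  assumes "lead_coeff Q = 1"
  shows "\<exists>k>0. \<exists>M. map_poly (fps_expand k) Q = (\<Prod>x\<in>#M. [:- x, 1:])"
  using assms
proof (induction "degree Q" arbitrary: Q rule: less_induct)
  case less
  note monic = \<open>lead_coeff Q = 1\<close>
  consider "degree Q = 0" | "degree Q = 1" | n where "degree Q = Suc (Suc n)"
    by (metis One_nat_def not0_implies_Suc)
  then show ?case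
  proof cases
    case 1
    then have "Q = 1" using monic by (metis degree_eq_zeroE coeff_pCons_0 one_pCons degree_0 lead_coeff_pCons(2))
    then show ?thesis by (intro exI[of _ 1] conjI exI[of _ "{#}"])
auto
  next
    case 2
    have "Q = [:coeff Q 0, 1:]"
      by (rule poly_eqI) (use 2 monic in \<open>auto simp: coeff_pCons coeff_eq_0 split: nat.splits\<close>)
    then show ?thesis by (intro exI[of _ 1] conjI exI[of _ "{#- coeff Q 0#}"]) auto
  next
    case (3 n)
    define m where "m = Suc (Suc n)"
    have Qm: "coeff Q m = 1" "degree Q = m" using monic 3 by (simp_all add: m_def)
    \<comment> \<open>The translation by the mean of the roots.\<close>
    define b where "b = fps_const (1 / of_nat m) * coeff Q (Suc n)"
    have b: "of_nat m * b = coeff Q (Suc n)"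
      by (simp add: b_def m_def mult.assoc[symmetric] fps_of_nat[symmetric] del: of_nat_Suc)
    define Q1 where "Q1 = pcompose Q [:- b, 1:]"
    have Q1: "degree Q1 = m" "coeff Q1 m = 1"
      using lead_coeff_comp[of "[:- b, 1:]" Q] Qm by (simp_all add: Q1_def degree_pcompose)
    have Q1n: "coeff Q1 (Suc n) = 0"
      unfolding Q1_def using coeff_pcompose_translate[of Q "Suc n" "- b"] Qm b
      by (simp add: m_def del: of_nat_Suc)
    have QQ1: "Q = pcompose Q1 [:b, 1:]"
      by (simp add: Q1_def pcompose_assoc[symmetric] pcompose_pCons)
    have "\<exists>k>0. \<exists>M. map_poly (fps_expand k) Q1 = (\<Prod>x\<in>#M. [:- x, 1:])"
    proof (cases "Q1 = monom 1 m")
      case True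
      then have "map_poly (fps_expand 1) Q1 = (\<Prod>x\<in>#replicate_mset m 0. [:- x, 1:])"
        by (simp add: map_poly_expand_1 monom_altdef)
      then show ?thesis by (intro exI[of _ 1] conjI exI[of _ "replicate_mset m 0"]) auto
    next
      case False
      \<comment> \<open>Ramifying by m! makes every valuation divisible by all m - i with i < m, so
        that the slopes are integers.\<close>
      define N where "N = (fact m :: nat)"
      have N: "N > 0" by (simp add: N_def)
      interpret N: comm_ring_hom_map "fps_expand N" by (intro comm_ring_hom_map_expand N)
      define r where "r i = fps_expand N (coeff Q1 i)" for i
      define I where "I = {i. i < m \<and> r i \<noteq> 0}"
      have "I \<noteq> {}"
      proof
        assume "I = {}"
        then have "coeff Q1 i = 0" if "i < m" for i
          using that N by (auto simp: I_def r_def fps_expand_eq_0_iff)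
        then have "Q1 = monom 1 m"
          using Q1 by (intro poly_eqI) (metis coeff_monom linorder_neqE_nat coeff_eq_0)
        with False show False by simp
      qed
      moreover have "finite I" by (simp add: I_def)
      \<comment> \<open>The least slope; it is the largest power of t by which x can be scaled with
        all coefficients remaining power series.\<close>
      define L where "L = Min ((\<lambda>i. subdegree (r i) div (m - i)) ` I)"
      have dvd: "m - i dvd subdegree (r i)" if "i < m" for i
      proof -
        have "m - i dvd N" unfolding N_def by (rule dvd_fact) (use that in auto)
        then show ?thesis using N by (simp add: r_def subdegree_expand)
      qed
      have L_le: "L * (m - i) \<le> subdegree (r i)" if "i \<in> I" for i
      proof -
        have "L \<le> subdegree (r i) div (m - i)"
          unfolding L_def using that \<open>finite I\<close> by (intro Min_le) auto
        then show ?thesis using that by (simp add: I_def less_eq_div_iff_mult_less_eq)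
      qed
      obtain i0 where i0: "i0 \<in> I" "subdegree (r i0) div (m - i0) = L"
        using Min_in[of "(\<lambda>i. subdegree (r i) div (m - i)) ` I"] \<open>finite I\<close> \<open>I \<noteq> {}\<close>
        unfolding L_def by fastforce
      have i0': "subdegree (r i0) = L * (m - i0)" "i0 < m"
        using i0 dvd[of i0] by (auto simp: I_def)
      define q where "q i = fps_shift (L * (m - i)) (r i)" for i
      have rq: "r i = fps_X ^ (L * (m - i)) * q i" for i
      proof (cases "i \<in> I")
        case True
        then show ?thesis using fps_shift_times_fps_X_power[OF L_le] by (simp add: q_def mult.commute)
      next
        case False
        then have "r i = 0 \<or> m - i = 0" by (auto simp: I_def)
        then show ?thesis by (auto simp: q_def)
      qed
      define Q2 where "Q2 = (\<Sum>i\<le>m. monom (q i) i)"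
      have cQ2: "coeff Q2 i = (if i \<le> m then q i else 0)" for i
        by (simp add: Q2_def coeff_sum coeff_monom)
      have qm: "q m = 1" using Q1 by (simp add: q_def r_def N.map_one)
      have degQ2: "degree Q2 = m" "lead_coeff Q2 = 1"
      proof -
        have "degree Q2 \<le> m" by (rule degree_le) (simp add: cQ2)
        moreover have "coeff Q2 m \<noteq> 0" by (simp add: cQ2 qm)
        ultimately show "degree Q2 = m" by (simp add: le_antisym le_degree)
        then show "lead_coeff Q2 = 1" by (simp add: cQ2 qm)
      qed
      have rel: "pcompose (map_poly (fps_expand N) Q1) [:0, fps_X ^ L:] = smult (fps_X ^ (L * m)) Q2"
      proof (rule poly_eqI)
        fix i show "coeff (pcompose (map_poly (fps_expand N) Q1) [:0, fps_X ^ L:]) i =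
            coeff (smult (fps_X ^ (L * m)) Q2) i"
        proof (cases "i \<le> m")
          case True
          then have "L * m = L * i + L * (m - i)" by (metis add_mult_distrib2 le_add_diff_inverse)
          then show ?thesis using True rq[of i]
            by (simp add: coeff_pcompose_linear N.coeff_map_hom cQ2 r_def[symmetric] power_add
              power_mult[symmetric] mult_ac)
        next
          case False
          then have "coeff Q1 i = 0" using Q1 by (simp add: coeff_eq_0)
          then show ?thesis using False
            by (simp add: coeff_pcompose_linear N.coeff_map_hom cQ2 N.map_zero)
        qed
      qed
      have p0: "degree (layer 0 Q2) = m" "coeff (layer 0 Q2) m = 1"
      proof -
        have "degree (layer 0 Q2) \<le> m" by (rule degree_le) (simp add: cQ2)
        moreover show "coeff (layer 0 Q2) m = 1" by (simp add: cQ2 qm)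
        ultimately show "degree (layer 0 Q2) = m" by (metis le_antisym le_degree zero_neq_one)
      qed
      \<comment> \<open>An index attaining the least slope contributes a nonzero lower coefficient
        at t = 0.\<close>
      have "fps_nth (q i0) 0 \<noteq> 0"
        using i0 i0' by (auto simp: q_def I_def simp del: nth_subdegree_zero_iff)
          (metis i0'(1) nth_subdegree_zero_iff)
      then have "layer 0 Q2 \<noteq> monom 1 (Suc (Suc n))"
        using i0'(2) by (auto simp: poly_eq_iff coeff_monom cQ2 m_def intro!: exI[of _ i0])
      moreover have "coeff (layer 0 Q2) (Suc n) = 0"
        using Q1n by (simp add: cQ2 m_def q_def r_def N.map_zero)
      ultimately obtain g h where gh: "layer 0 Q2 = g * h" "coprime g h" "lead_coeff g = 1"
        "lead_coeff h = 1" "degree g > 0" "degree h > 0"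
        using monic_complex_poly_splits_coprime[of "layer 0 Q2" n] p0 by (auto simp: m_def)
      obtain G H where GH: "Q2 = G * H" "lead_coeff G = 1" "lead_coeff H = 1"
        "degree G = degree g" "degree H = degree h"
        using hensel_monic[OF degQ2(2) gh] by metis
      have "degree g + degree h = m"
        using gh p0(1) by (metis degree_mult_eq leading_coeff_0_iff zero_neq_one)
      then have less': "degree G < degree Q" "degree H < degree Q"
        using gh GH Qm by auto
      obtain k1 M1 where k1: "k1 > 0" "map_poly (fps_expand k1) G = (\<Prod>x\<in>#M1. [:- x, 1:])"
        using less.hyps[OF less'(1) GH(2)] by auto
      obtain k2 M2 where k2: "k2 > 0" "map_poly (fps_expand k2) H = (\<Prod>x\<in>#M2. [:- x, 1:])"
        using less.hyps[OF less'(2) GH(3)] by auto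
      \<comment> \<open>A common ramification for both factors: the roots of each are ramified
        further by the index of the other.\<close>
      define k where "k = k1 * k2"
      have k: "k > 0" using k1 k2 by (simp add: k_def)
      interpret k: comm_ring_hom_map "fps_expand k" by (intro comm_ring_hom_map_expand k)
      interpret kp: comm_ring_hom_map "map_poly (fps_expand k)" by (rule k.map_poly_hom)
      interpret k1: comm_ring_hom_map "fps_expand k1" by (intro comm_ring_hom_map_expand k1)
      interpret k2: comm_ring_hom_map "fps_expand k2" by (intro comm_ring_hom_map_expand k2)
      define M where "M = image_mset (fps_expand k2) M1 + image_mset (fps_expand k1) M2"
      have "map_poly (fps_expand k) Q2 = (\<Prod>x\<in>#M. [:- x, 1:])"
      proof -
        have "map_poly (fps_expand k) G = map_poly (fps_expand k2) (map_poly (fps_expand k1) G)"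
          "map_poly (fps_expand k) H = map_poly (fps_expand k1) (map_poly (fps_expand k2) H)"
          by (simp_all only: map_poly_expand_expand[OF k2(1) k1(1)] map_poly_expand_expand[OF k1(1) k2(1)]
            k_def mult.commute[of k1])
        then show ?thesis
          by (simp add: GH(1) kp.map_mult k1 k2 k1.map_poly_prod_mset_lin k2.map_poly_prod_mset_lin M_def)
      qed
      note MQ2 = this
      have sizeM: "size M = m"
      proof -
        have "degree (map_poly (fps_expand k) Q2) = m"
          using degQ2 k by (subst degree_map_poly) (auto simp: fps_expand_eq_0_iff)
        then show ?thesis by (simp add: MQ2)
      qed
      define X where "X = (fps_X :: complex fps) ^ (k * L)"
      have "pcompose (map_poly (fps_expand (k * N)) Q1) [:0, X:] = smult (X ^ m) (map_poly (fps_expand k) Q2)"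
      proof -
        have "map_poly (fps_expand k) (pcompose (map_poly (fps_expand N) Q1) [:0, fps_X ^ L:]) =
            pcompose (map_poly (fps_expand (k * N)) Q1) [:0, X:]"
          using N k by (intro poly_eqI)
            (simp add: coeff_pcompose_linear k.coeff_map_hom k.map_mult
              map_poly_expand_expand[symmetric] X_def power_mult[symmetric] mult.assoc)
        moreover have "map_poly (fps_expand k) (smult (fps_X ^ (L * m)) Q2) =
            smult (X ^ m) (map_poly (fps_expand k) Q2)"
          using k by (intro poly_eqI) (simp add: k.coeff_map_hom k.map_mult X_def power_mult[symmetric] mult.assoc)
        ultimately show ?thesis using rel by simp
      qed
      also have "\<dots> = (\<Prod>x\<in>#M. [:- (X * x), X:])"
        unfolding MQ2 sizeM[symmetric] by (rule smult_power_prod_mset_linear)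
      also have "\<dots> = pcompose (\<Prod>x\<in>#image_mset ((*) X) M. [:- x, 1:]) [:0, X:]"
        using pcompose_prod_mset_linear[of "image_mset ((*) X) M" 0 X]
        by (simp add: multiset.map_comp o_def)
      finally have eq: "coeff (pcompose (map_poly (fps_expand (k * N)) Q1) [:0, X:]) i =
          coeff (pcompose (\<Prod>x\<in>#image_mset ((*) X) M. [:- x, 1:]) [:0, X:]) i" for i by simp
      have "map_poly (fps_expand (k * N)) Q1 = (\<Prod>x\<in>#image_mset ((*) X) M. [:- x, 1:])"
        by (rule poly_eqI) (use eq in \<open>simp add: coeff_pcompose_linear X_def\<close>)
      then show ?thesis using k N by (intro exI[of _ "k * N"] conjI exI) auto
    qed
    then obtain k M where k: "k > 0" and M: "map_poly (fps_expand k) Q1 = (\<Prod>x\<in>#M. [:- x, 1:])"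
      by blast
    interpret k: comm_ring_hom_map "fps_expand k" by (intro comm_ring_hom_map_expand k)
    interpret kp: comm_ring_hom_map "map_poly (fps_expand k)" by (rule k.map_poly_hom)
    have "map_poly (fps_expand k) (pcompose p [:b, 1:]) = pcompose (map_poly (fps_expand k) p) [:fps_expand k b, 1:]" for p
      by (induction p)
        (simp_all add: pcompose_pCons kp.map_add kp.map_mult k.map_poly_lin k.map_one map_poly_pCons k.map_zero
          del: mult_pCons_left mult_pCons_right)
    then have "map_poly (fps_expand k) Q = pcompose (\<Prod>x\<in>#M. [:- x, 1:]) [:fps_expand k b, 1:]"
      by (subst QQ1) (simp add: M)
    also have "\<dots> = (\<Prod>x\<in>#image_mset (\<lambda>x. x - fps_expand k b) M. [:- x, 1:])"
      using pcompose_prod_mset_linear[of M "fps_expand k b" 1] by (simp add: multiset.map_comp o_def)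
    finally show ?thesis using k by (intro exI[of _ k] conjI exI) auto
  qed
qed


section \<open>Positive polynomials over power series\<close>

lemma proots_prod_mset_linear: "proots (\<Prod>x\<in>#M. [:- x, 1 :: 'a::idom:]) = M"
proof (induction M)
  case (add x M)
  have "(\<Prod>x\<in>#M. [:- x, 1 :: 'a:]) \<noteq> 0"
    using degree_prod_mset_monic_linear(2)[of M] by (metis leading_coeff_0_iff zero_neq_one)
  then show ?case using add by (simp add: proots_mult del: mult_pCons_left)
qed simp

text \<open>
  The roots in the ramified variable are permuted by the rotations (the monodromy) and by
  conjugation. An orbit of the rotations that is invariant under conjugation would contain a real
  series, after passing to \<open>-t\<close> if necessary. Hence one can select a system of orbits
  containing exactly one of each pair of conjugate orbits; it gives the factor.
\<close>

lemma monic_no_real_branch_imp_norm: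
  fixes Q :: "complex fps poly"
  assumes monic: "lead_coeff Q = 1" and real: "map_poly fps_bar Q = Q"
    and no_branch: "\<And>k e y. k > 0 \<Longrightarrow> e \<in> {1, -1} \<Longrightarrow> fps_bar y = y \<Longrightarrow>
       poly (map_poly (fps_expand k) (map_poly (fps_rot e) Q)) y \<noteq> 0"
  shows "\<exists>f. Q = f * map_poly fps_bar f"
proof -
  obtain k M where k: "k > 0" and M: "map_poly (fps_expand k) Q = (\<Prod>x\<in>#M. [:- x, 1:])"
    using puiseux[OF monic] by blast
  interpret k: comm_ring_hom_map "fps_expand k" by (intro comm_ring_hom_map_expand k)
  interpret kp: comm_ring_hom_map "map_poly (fps_expand k)" by (rule k.map_poly_hom)
  define S where "S = set_mset M"
  have rotM: "image_mset (fps_rot z) M = M" if "z ^ k = 1" for z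
  proof -
    have "map_poly (fps_rot z) (map_poly (fps_expand k) Q) = map_poly (fps_expand k) Q"
      by (rule poly_eqI) (simp add: rot.coeff_map_hom k.coeff_map_hom fps_rot_expand that)
    then show ?thesis
      unfolding M rot.map_poly_prod_mset_lin by (metis proots_prod_mset_linear)
  qed
  have barM: "image_mset fps_bar M = M"
  proof -
    have "map_poly fps_bar (map_poly (fps_expand k) Q) = map_poly (fps_expand k) (map_poly fps_bar Q)"
      by (rule poly_eqI) (simp add: bar.coeff_map_hom k.coeff_map_hom fps_bar_expand)
    then show ?thesis
      unfolding real M bar.map_poly_prod_mset_lin by (metis proots_prod_mset_linear)
  qed
  have rotS: "fps_rot z x \<in> S" if "z ^ k = 1" "x \<in> S" for z x
    using rotM[OF that(1)] that(2) unfolding S_def by (metis image_eqI set_image_mset)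
  have no_conj: False if x: "x \<in> S" and z: "z ^ k = 1" and eq: "fps_bar x = fps_rot z x" for x z
  proof -
    \<comment> \<open>Half of the rotation \<open>z\<close> turns \<open>x\<close> into a series
      fixed by conjugation, as cnj w * w^2 = w. From w^(2k) = 1 it follows that w^k is 1 or -1,
      which is the sign \<open>e\<close> in the hypothesis.\<close>
    define w where "w = csqrt z"
    have wz: "w * w = z" unfolding w_def by (metis power2_csqrt power2_eq_square)
    have "norm z = 1" using z k by (metis norm_power norm_one power_eq_1_iff norm_ge_zero
      not_gr_zero abs_norm_cancel power_eq_imp_eq_base one_power2 power_one zero_le_one)
    then have "norm w = 1" using wz by (metis norm_mult abs_norm_cancel real_sqrt_abs2 real_sqrt_one)
    then have cw: "cnj w * w = 1" by (metis complex_norm_square mult.commute of_real_1 one_power2)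
    define y where "y = fps_rot w x"
    have "fps_bar y = fps_rot (cnj w * z) x" by (simp add: y_def fps_bar_rot eq fps_rot_rot)
    also have "cnj w * z = w" using wz cw by (metis mult.assoc mult.left_neutral)
    finally have y: "fps_bar y = y" by (simp add: y_def)
    have "poly (map_poly (fps_expand k) Q) x = 0"
    proof -
      obtain M' where "M = add_mset x M'" using x unfolding S_def by (metis mset_add)
      then show ?thesis unfolding M by simp
    qed
    then have "poly (map_poly (fps_rot w) (map_poly (fps_expand k) Q)) y = 0"
      by (simp add: y_def rot.poly_map_hom rot.map_zero)
    moreover have "map_poly (fps_rot w) (map_poly (fps_expand k) Q)
        = map_poly (fps_expand k) (map_poly (fps_rot (w ^ k)) Q)"
      by (rule poly_eqI, rule fps_ext)
        (auto simp: rot.coeff_map_hom k.coeff_map_hom power_mult elim!: dvdE)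
    moreover have "w ^ k \<in> {1, -1}"
    proof -
      have "w ^ k * w ^ k = 1" using wz z by (metis power_mult_distrib)
      then show ?thesis using square_eq_1_iff by auto
    qed
    ultimately show False using no_branch[OF k _ y] by metis
  qed
  \<comment> \<open>Partial selections: unions of orbits that meet none of their conjugates. A
    maximal one must contain x or its conjugate for every root x.\<close>
  define F where "F = {T. T \<subseteq> S \<and> (\<forall>z x. z ^ k = 1 \<longrightarrow> x \<in> T \<longrightarrow> fps_rot z x \<in> T) \<and> T \<inter> fps_bar ` T = {}}"
  have finF: "finite F" unfolding F_def S_def by (rule finite_subset[of _ "Pow (set_mset M)"]) auto
  have "{} \<in> F" by (simp add: F_def)
  then obtain T where T: "T \<in> F" "\<And>T'. T' \<in> F \<Longrightarrow> T \<subseteq> T' \<Longrightarrow> T = T'"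
    using finite_has_maximal[OF finF] by (metis empty_iff)
  have TS: "T \<subseteq> S" and Trot: "\<And>z x. z ^ k = 1 \<Longrightarrow> x \<in> T \<Longrightarrow> fps_rot z x \<in> T"
    and Tbar: "T \<inter> fps_bar ` T = {}"
    using T(1) by (auto simp: F_def)
  have inv1: "inverse z ^ k = 1" if "z ^ k = 1" for z :: complex
    using that by (simp add: power_inverse)
  have rot_inv: "fps_rot (inverse z) (fps_rot z x) = x" if "z ^ k = 1" for z x
    using that k by (cases "z = 0") (simp_all add: fps_rot_rot power_0_left)
  have cnj1: "cnj z ^ k = 1" if "z ^ k = 1" for z
    using that by (metis complex_cnj_one complex_cnj_power)
  have cover: "x \<in> T \<or> fps_bar x \<in> T" if x: "x \<in> S" for x
  proof (rule ccontr)
    assume no: "\<not> ?thesis"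
    define Ob where "Ob = {fps_rot z x | z. z ^ k = 1}"
    have xO: "x \<in> Ob" unfolding Ob_def by (auto intro!: exI[of _ 1])
    have "T \<union> Ob \<in> F" unfolding F_def
    proof (intro CollectI conjI allI impI)
      show "T \<union> Ob \<subseteq> S" using TS rotS x by (auto simp: Ob_def)
      fix z :: complex and y assume z: "z ^ k = 1" and y: "y \<in> T \<union> Ob"
      show "fps_rot z y \<in> T \<union> Ob"
      proof (cases "y \<in> T")
        case False
        then obtain w where "w ^ k = 1" "y = fps_rot w x" using y by (auto simp: Ob_def)
        then show ?thesis using z
          by (auto simp: Ob_def fps_rot_rot power_mult_distrib intro!: exI[of _ "z * w"])
      qed (use Trot z in auto)
    next
      have ob_bar: "False" if "z ^ k = 1" "fps_bar (fps_rot z x) \<in> T" for z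
      proof -
        have "fps_rot (inverse (cnj z)) (fps_rot (cnj z) (fps_bar x)) \<in> T"
          using Trot[OF inv1[OF cnj1[OF that(1)]]] that(2) by (simp add: fps_bar_rot)
        then show False using no rot_inv[OF cnj1[OF that(1)]] by auto
      qed
      have ob_bar2: "False" if "y \<in> T" "fps_bar y = fps_rot z x" "z ^ k = 1" for y z
        using ob_bar[OF that(3)] that by (metis fps_bar_bar)
      have ob_ob: "False" if "z ^ k = 1" "w ^ k = 1" "fps_bar (fps_rot z x) = fps_rot w x" for z w
      proof -
        have "fps_rot (inverse (cnj z)) (fps_rot (cnj z) (fps_bar x)) = fps_rot (inverse (cnj z)) (fps_rot w x)"
          using that(3) by (simp add: fps_bar_rot)
        then have "fps_bar x = fps_rot (inverse (cnj z) * w) x"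
          using rot_inv[OF cnj1[OF that(1)]] by (simp add: fps_rot_rot)
        then show False
          using no_conj[OF x, of "inverse (cnj z) * w"] inv1[OF cnj1[OF that(1)]] that(2)
          by (simp add: power_mult_distrib)
      qed
      show "(T \<union> Ob) \<inter> fps_bar ` (T \<union> Ob) = {}"
        using Tbar ob_bar ob_bar2 ob_ob by (fastforce simp: Ob_def)
    qed
    then have "T = T \<union> Ob" using T(2) by blast
    then show False using xO no by blast
  qed
  define M1 where "M1 = filter_mset (\<lambda>x. x \<in> T) M"
  have M1_rot: "image_mset (fps_rot z) M1 = M1" if z: "z ^ k = 1" for z
  proof -
    have "x \<in> T \<longleftrightarrow> fps_rot z x \<in> T" for x
      using Trot[OF z] Trot[OF inv1[OF z]] rot_inv[OF z] by metis
    then have "M1 = filter_mset (\<lambda>x. fps_rot z x \<in> T) M" by (simp add: M1_def)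
    then have "image_mset (fps_rot z) M1 = filter_mset (\<lambda>x. x \<in> T) (image_mset (fps_rot z) M)"
      by (simp add: filter_mset_image_mset o_def)
    then show ?thesis using rotM[OF z] by (simp add: M1_def)
  qed
  have "M = M1 + image_mset fps_bar M1"
  proof -
    have "filter_mset (\<lambda>x. x \<notin> T) M = filter_mset (\<lambda>x. fps_bar x \<in> T) M"
    proof (rule filter_mset_cong[OF refl])
      fix x assume "x \<in># M"
      then have "x \<in> T \<or> fps_bar x \<in> T" using cover by (simp add: S_def)
      moreover have "\<not> (x \<in> T \<and> fps_bar x \<in> T)" using Tbar by (metis disjoint_iff fps_bar_bar image_eqI)
      ultimately show "x \<notin> T \<longleftrightarrow> fps_bar x \<in> T" by blast
    qed
    also have "\<dots> = filter_mset (\<lambda>x. fps_bar x \<in> T) (image_mset fps_bar M)" by (simp add: barM)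
    also have "\<dots> = image_mset fps_bar M1" by (simp add: filter_mset_image_mset o_def M1_def)
    finally show ?thesis using multiset_partition[of M "\<lambda>x. x \<in> T"] by (simp add: M1_def)
  qed
  define f1 where "f1 = (\<Prod>x\<in>#M1. [:- x, 1:])"
  have f1: "map_poly (fps_expand k) Q = f1 * map_poly fps_bar f1"
    unfolding M f1_def bar.map_poly_prod_mset_lin
    by (subst \<open>M = _\<close>) simp
  \<comment> \<open>The selected roots are permuted by all rotations, so the coefficients of their
    product are series in t^k and descend to the original variable.\<close>
  have "fps_rot z (coeff f1 i) = coeff f1 i" if "z ^ k = 1" for z i
  proof -
    have "map_poly (fps_rot z) f1 = f1" by (simp add: f1_def rot.map_poly_prod_mset_lin M1_rot that)
    then show ?thesis by (metis rot.coeff_map_hom)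
  qed
  then have "\<exists>g. coeff f1 i = fps_expand k g" for i
    using fps_rot_invariant_imp_expand[OF k] by blast
  then obtain g where g: "\<And>i. coeff f1 i = fps_expand k (g i)" by metis
  define f where "f = (\<Sum>i\<le>degree f1. monom (g i) i)"
  have f1_expand: "f1 = map_poly (fps_expand k) f"
  proof (rule poly_eqI)
    fix i
    have "g i = 0" if "i > degree f1"
      using g[of i] coeff_eq_0[OF that] fps_expand_eq_0_iff[OF k, of "g i"] by metis
    then show "coeff f1 i = coeff (map_poly (fps_expand k) f) i"
      using g[of i] by (cases "i \<le> degree f1") (simp_all add: k.coeff_map_hom f_def coeff_sum coeff_monom k.map_zero)
  qed
  then have "map_poly (fps_expand k) Q = map_poly (fps_expand k) (f * map_poly fps_bar f)"
  proof -
    have "map_poly fps_bar (map_poly (fps_expand k) f) = map_poly (fps_expand k) (map_poly fps_bar f)"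
      by (rule poly_eqI) (simp add: bar.coeff_map_hom k.coeff_map_hom fps_bar_expand)
    then show ?thesis using f1 f1_expand by (simp add: kp.map_mult)
  qed
  then have "Q = f * map_poly fps_bar f"
    by (intro poly_eqI) (metis fps_expand_inj[OF k] k.coeff_map_hom)
  then show ?thesis by blast
qed


section \<open>Positive polynomials in x and t as norms over power series in t\<close>

text \<open>The outer variable of a \<^typ>\<open>complex poly poly\<close> is always the real variable \<open>x\<close>.\<close>

definition eval2 :: "complex poly poly \<Rightarrow> complex \<Rightarrow> complex \<Rightarrow> complex" where
  "eval2 F x t = poly (poly F [:x:]) t"

lemma eval2_simps [simp]:
  "eval2 0 x t = 0" "eval2 1 x t = 1" "eval2 (F + G) x t = eval2 F x t + eval2 G x t"
  "eval2 (F - G) x t = eval2 F x t - eval2 G x t" "eval2 (- F) x t = - eval2 F x t"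
  "eval2 (F * G) x t = eval2 F x t * eval2 G x t"
  "eval2 (F ^ n) x t = eval2 F x t ^ n" "eval2 (smult c F) x t = poly c t * eval2 F x t"
  "eval2 (monom c n) x t = poly c t * x ^ n" "eval2 [:c:] x t = poly c t"
  by (simp_all add: eval2_def poly_monom)

lemma eval2_sum: "eval2 (sum f I) x t = (\<Sum>i\<in>I. eval2 (f i) x t)"
  by (induction I rule: infinite_finite_induct) simp_all

lemma eval2_altdef: "eval2 F x t = (\<Sum>i\<le>degree F. poly (coeff F i) t * x ^ i)"
proof -
  have "eval2 F x t = eval2 (\<Sum>i\<le>degree F. monom (coeff F i) i) x t"
    by (simp add: poly_as_sum_of_monoms)
  then show ?thesis by (simp add: eval2_sum)
qed

lemma eval2_altdef':
  assumes "degree F \<le> n"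
  shows "eval2 F x t = (\<Sum>i\<le>n. poly (coeff F i) t * x ^ i)"
  unfolding eval2_altdef
  by (rule sum.mono_neutral_left) (use assms in \<open>auto simp: coeff_eq_0\<close>)

lemma eval2_pcompose_inner: "eval2 (map_poly (\<lambda>c. pcompose c q) F) x t = eval2 F x (poly q t)"
  by (induction F) (simp_all add: eval2_def map_poly_pCons poly_pcompose)

interpretation cnj: comm_ring_hom_map cnj
  by unfold_locales simp_all

interpretation cnjp: comm_ring_hom_map "map_poly cnj"
  by (rule cnj.map_poly_hom)

interpretation fpsp: comm_ring_hom_map "fps_of_poly :: complex poly \<Rightarrow> complex fps"
  by unfold_locales (simp_all add: fps_of_poly_add fps_of_poly_mult)

interpretation fpspp: comm_ring_hom_map "map_poly (fps_of_poly :: complex poly \<Rightarrow> complex fps)"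
  by (rule fpsp.map_poly_hom)

definition cnj2 :: "complex poly poly \<Rightarrow> complex poly poly" where
  "cnj2 F = map_poly (map_poly cnj) F"

interpretation cnj2: comm_ring_hom_map cnj2
  unfolding cnj2_def by (rule cnjp.map_poly_hom)

lemma coeff_cnj2 [simp]: "coeff (coeff (cnj2 F) i) j = cnj (coeff (coeff F i) j)"
  by (simp add: cnj2_def cnjp.coeff_map_hom cnj.coeff_map_hom)

lemma eval2_cnj2: "eval2 (cnj2 F) (cnj x) (cnj t) = cnj (eval2 F x t)"
proof -
  have "eval2 (cnj2 F) (cnj x) (cnj t) = poly (map_poly cnj (poly F [:x:])) (cnj t)"
    using cnjp.poly_map_hom[of F "[:x:]"] by (simp add: eval2_def cnj2_def map_poly_pCons)
  then show ?thesis by (simp add: cnj.poly_map_hom eval2_def)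
qed

lemma eval2_cnj2_real: "eval2 (cnj2 F) (of_real x) (of_real t) = cnj (eval2 F (of_real x) (of_real t))"
  using eval2_cnj2[of F "of_real x" "of_real t"] by simp

lemma poly_lower_bound_near_0:
  fixes q :: "complex poly"
  assumes "q \<noteq> 0"
  obtains c d e where "c > 0" "d > 0" "\<And>t. norm t < d \<Longrightarrow> norm (poly q t) \<ge> c * norm t ^ e"
proof -
  obtain r where r: "q = [:- 0, 1:] ^ order 0 q * r" "\<not> [:- 0, 1:] dvd r"
    using order_decomp[OF assms, of 0] by blast
  have r0: "poly r 0 \<noteq> 0" using r(2) by (simp add: poly_eq_0_iff_dvd)
  have "(\<lambda>t. poly r t) \<midarrow>0\<rightarrow> poly r 0" using isCont_def poly_isCont by blast
  then obtain d where d: "d > 0"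
      "\<And>t. t \<noteq> 0 \<Longrightarrow> norm t < d \<Longrightarrow> norm (poly r t - poly r 0) < norm (poly r 0) / 2"
    using LIM_D[of "poly r" "poly r 0" 0 "norm (poly r 0) / 2"] r0 by auto
  show ?thesis
  proof
    show "norm (poly r 0) / 2 > 0" using r0 by simp
    show "d > 0" by (rule d)
    fix t :: complex assume "norm t < d"
    then have "norm (poly r t - poly r 0) < norm (poly r 0) / 2" using d(2)[of t] r0 by (cases "t = 0") simp_all
    then have "norm (poly r t) \<ge> norm (poly r 0) / 2"
      using norm_triangle_ineq2[of "poly r 0" "poly r t"] by (simp add: norm_minus_commute)
    moreover have "poly q t = t ^ order 0 q * poly r t" by (subst r(1)) simp
    ultimately show "norm (poly q t) \<ge> norm (poly r 0) / 2 * norm t ^ order 0 q"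
      using mult_right_mono[of "norm (poly r 0) / 2" "norm (poly r t)" "norm t ^ order 0 q"]
      by (simp add: norm_mult norm_power mult.commute)
  qed
qed

lemma poly_bounded_on_ball:
  fixes q :: "complex poly"
  obtains C where "C > 0" "\<And>t. norm t \<le> R \<Longrightarrow> norm (poly q t) \<le> C"
proof
  define C where "C = 1 + (\<Sum>i\<le>degree q. norm (coeff q i) * \<bar>R\<bar> ^ i)"
  show "C > 0" unfolding C_def by (intro add_pos_nonneg sum_nonneg) auto
  fix t :: complex assume t: "norm t \<le> R"
  have "norm (poly q t) \<le> (\<Sum>i\<le>degree q. norm (coeff q i * t ^ i))"
    unfolding poly_altdef by (rule norm_sum)
  also have "\<dots> \<le> (\<Sum>i\<le>degree q. norm (coeff q i) * \<bar>R\<bar> ^ i)"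
    using t by (intro sum_mono) (auto simp: norm_mult norm_power intro!: mult_left_mono power_mono)
  finally show "norm (poly q t) \<le> C" by (simp add: C_def)
qed

text \<open>A truncation of a real branch at high order violates the lower bound near \<open>t = 0\<close>.\<close>

lemma no_real_branch:
  fixes Q :: "complex poly poly"
  assumes lower: "c > 0" "d > 0"
    "\<And>x t :: real. \<bar>t\<bar> < d \<Longrightarrow> norm (eval2 Q (of_real x) (of_real t)) \<ge> c * \<bar>t\<bar> ^ m"
    and k: "k > 0" and e: "e \<in> {1, -1}" and y: "fps_bar y = y"
  shows "poly (map_poly (fps_expand k) (map_poly (fps_rot e) (map_poly fps_of_poly Q))) y \<noteq> 0"
proof
  assume root: "poly (map_poly (fps_expand k) (map_poly (fps_rot e) (map_poly fps_of_poly Q))) y = 0"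
  interpret k: comm_ring_hom_map "fps_expand k" by (intro comm_ring_hom_map_expand k)
  \<comment> \<open>At t = e s^k the lower bound is c s^(k m), so vanishing to one order more is
    contradictory for small s.\<close>
  define N where "N = k * m + 1"
  define Y where "Y = (\<Sum>j<N. monom (fps_nth y j) j)"
  have cY: "coeff Y j = (if j < N then fps_nth y j else 0)" for j
    by (simp add: Y_def coeff_sum coeff_monom)
  define R where "R = map_poly (\<lambda>c. pcompose c (monom e k)) Q"
  have sub: "fps_of_poly (pcompose c (monom e k)) = fps_expand k (fps_rot e (fps_of_poly c))" for c
  proof (induction c)
    case (pCons a p)
    have 1: "fps_expand k (fps_rot e (fps_const a)) = fps_const a" for a
      using k by (intro fps_ext) (auto simp: fps_nth_fps_const elim!: dvdE)
    have 2: "fps_expand k (fps_rot e fps_X) = fps_of_poly (monom e k)"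
      using k by (intro fps_ext) (auto simp: coeff_monom fps_X_nth elim!: dvdE)
    show ?case
      by (simp only: pcompose_pCons fps_of_poly_add fps_of_poly_mult fps_of_poly_pCons pCons.IH
        k.map_add k.map_mult rot.map_add rot.map_mult 1 2 fps_of_poly_const mult.commute fps_of_poly_0 mult_zero_right add_0_right)
  qed (simp add: rot.map_zero k.map_zero)
  have R': "map_poly fps_of_poly R = map_poly (fps_expand k) (map_poly (fps_rot e) (map_poly fps_of_poly Q))"
    by (rule poly_eqI) (simp add: R_def fpsp.coeff_map_hom k.coeff_map_hom rot.coeff_map_hom
      coeff_map_poly sub)
  \<comment> \<open>The truncation \<open>Y\<close> agrees with the root \<open>y\<close> modulo
    t^N, hence G is divisible by t^N. Unlike \<open>y\<close>, the polynomial \<open>Y\<close> can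
    be evaluated at real s.\<close>
  define G where "G = poly R Y"
  have "fps_of_poly G = poly (map_poly fps_of_poly R) (fps_of_poly Y) - poly (map_poly fps_of_poly R) y"
    using fpsp.poly_map_hom[of R Y] by (simp add: G_def R' root)
  moreover have "fps_of_poly Y - y dvd poly p (fps_of_poly Y) - poly p y" for p
  proof (induction p)
    case (pCons a p)
    have "poly (pCons a p) (fps_of_poly Y) - poly (pCons a p) y =
        (fps_of_poly Y - y) * poly p (fps_of_poly Y) + y * (poly p (fps_of_poly Y) - poly p y)"
      by (simp add: algebra_simps)
    then show ?case using pCons.IH by simp
  qed simp
  moreover have "fps_X ^ N dvd fps_of_poly Y - y"
    by (rule dvdI[of _ _ "fps_shift N (fps_of_poly Y - y)"]) (auto intro!: fps_ext simp: fps_X_power_mult_nth cY)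
  ultimately obtain h where h: "fps_of_poly G = fps_X ^ N * h" by (metis dvd_trans dvdE)
  have "monom 1 N dvd G"
    unfolding monom_1_dvd_iff'
  proof (intro allI impI)
    fix j assume "j < N"
    then have "fps_nth (fps_of_poly G) j = 0" unfolding h by (simp add: fps_X_power_mult_nth)
    then show "coeff G j = 0" by simp
  qed
  then obtain G' where G': "G = monom 1 N * G'" by (elim dvdE)
  obtain C where C: "C > 0" "\<And>s. norm s \<le> 1 \<Longrightarrow> norm (poly G' s) \<le> C"
    using poly_bounded_on_ball[of 1 G'] by auto
  have key: "c \<le> C * s" if s: "0 < s" "s < 1" "s < d" for s :: real
  proof -
    have e': "e = of_real (Re e)" "\<bar>Re e\<bar> = 1" using e by auto
    have "poly Y (of_real s) = of_real (Re (poly Y (of_real s)))"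
    proof -
      have "cnj (fps_nth y j) = fps_nth y j" for j using y by (metis fps_bar_nth)
      then have "cnj (poly Y (of_real s)) = poly Y (of_real s)"
        by (simp add: Y_def poly_sum poly_monom)
      then show ?thesis by (simp add: complex_eq_iff)
    qed
    then obtain x where x: "poly Y (of_real s) = of_real x" by blast
    have "eval2 R (poly Y s) s = eval2 Q (poly Y s) (poly (monom e k) s)"
      unfolding R_def by (rule eval2_pcompose_inner)
    also have "\<dots> = eval2 Q (of_real x) (of_real (Re e * s ^ k))"
      using e' by (simp add: x poly_monom)
    finally have *: "eval2 R (poly Y s) s = eval2 Q (of_real x) (of_real (Re e * s ^ k))" .
    have "poly G s = eval2 R (poly Y s) s"
      unfolding G_def eval2_def by (induction R) simp_all
    then have G_eq: "poly G s = eval2 Q (of_real x) (of_real (Re e * s ^ k))" using * by simp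
    have abs: "\<bar>Re e * s ^ k\<bar> = s ^ k" using s e'(2) by (simp add: abs_mult)
    have "s ^ k \<le> s" using s k power_decreasing[of 1 k s] by simp
    then have "c * (s ^ k) ^ m \<le> norm (poly G s)"
      unfolding G_eq using lower(3)[of "Re e * s ^ k" x] s abs by simp
    also have "\<dots> = s ^ N * norm (poly G' s)"
      using s by (simp add: G' poly_monom norm_mult norm_power)
    also have "\<dots> \<le> s ^ N * C" using C(2)[of s] s by (intro mult_left_mono) auto
    finally have "c * s ^ (k * m) \<le> (C * s) * s ^ (k * m)" by (simp add: N_def power_mult[symmetric] mult_ac)
    then show ?thesis using s by (simp add: mult_le_cancel_right)
  qed
  define s where "s = min (1/2) (min (d / 2) (c / (2 * C)))"
  have "0 < s" "s < 1" "s < d" "s \<le> c / (2 * C)" using lower C by (auto simp: s_def)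
  moreover have "C * s < c"
  proof -
    have "C * s \<le> C * (c / (2 * C))" using \<open>s \<le> _\<close> C by (intro mult_left_mono) auto
    also have "\<dots> = c / 2" using C by simp
    finally show ?thesis using lower by simp
  qed
  ultimately show False using key by fastforce
qed


lemma layer_bar: "layer k (map_poly fps_bar g) = map_poly cnj (layer k g)"
  by (rule poly_eqI) (simp add: bar.coeff_map_hom cnj.coeff_map_hom)

lemma poly_mult_cnj_eq_0:
  assumes "p * map_poly cnj p = 0"
  shows "p = 0"
  using assms by (auto simp: map_poly_eq_0_iff)

lemma degree_map_bar [simp]: "degree (map_poly fps_bar f) = degree f"
  by (rule degree_map_poly) (metis fps_bar_bar bar.map_zero)

text \<open>A factor \<open>t\<close> of \<open>f * bar f\<close> divides \<open>f\<close>, since then \<open>\<bar>f(x, 0)\<bar>\<^sup>2 = 0\<close> for real \<open>x\<close>.\<close>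

lemma norm_form_cancel_fps_X:
  "smult (fps_X ^ (2 * l)) R = g * map_poly fps_bar g \<Longrightarrow> \<exists>f. R = f * map_poly fps_bar f"
proof (induction l arbitrary: g)
  case (Suc l)
  have "layer 0 g * map_poly cnj (layer 0 g) = layer 0 (smult (fps_X ^ (2 * Suc l)) R)"
    by (simp only: Suc.prems layer0.map_mult layer_bar)
  also have "\<dots> = 0" by (rule poly_eqI) simp
  finally have "layer 0 g = 0" by (rule poly_mult_cnj_eq_0)
  then have z: "fps_nth (coeff g i) 0 = 0" for i by (metis coeff_0 coeff_layer)
  define g1 where "g1 = map_poly (fps_shift 1) g"
  have g: "g = smult fps_X g1"
  proof (rule poly_eqI)
    fix i
    show "coeff g i = coeff (smult fps_X g1) i"
      using z[of i] by (intro fps_ext) (simp add: g1_def coeff_map_poly fps_X_mult_nth)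
  qed
  have bX: "fps_bar fps_X = fps_X" by (rule fps_ext) (simp add: fps_X_nth)
  have "map_poly fps_bar g = smult fps_X (map_poly fps_bar g1)"
    unfolding g by (rule poly_eqI) (simp add: bar.coeff_map_hom bar.map_mult bX)
  then have "smult (fps_X ^ 2) (smult (fps_X ^ (2 * l)) R) = smult (fps_X ^ 2) (g1 * map_poly fps_bar g1)"
    using Suc.prems by (subst (asm) (1) g) (simp add: power2_eq_square mult.assoc)
  then have "smult (fps_X ^ (2 * l)) R = g1 * map_poly fps_bar g1"
    by (metis smult_cancel power_not_zero fps_X_neq_zero)
  then show ?case by (rule Suc.IH)
qed auto

lemma poly_poly_eval2: "poly (poly Q q) t = eval2 Q (poly q t) t"
  by (induction Q) (simp_all add: eval2_def)

lemma eval2_conv_poly: "eval2 P x t = poly (map_poly (\<lambda>c. poly c t) P) x"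
  by (induction P) (simp_all add: eval2_def map_poly_pCons)

text \<open>Divide by the top power of x and let x tend to plus infinity.\<close>

lemma lead_coeff_nonneg:
  assumes nonneg: "\<And>x :: real. 0 \<le> Re (eval2 P (of_real x) (of_real t))"
    and real: "poly (lead_coeff P) (of_real t) \<in> \<real>"
  shows "0 \<le> Re (poly (lead_coeff P) (of_real t))"
proof (cases "poly (lead_coeff P) (of_real t) = 0")
  case False
  define p where "p = map_poly (\<lambda>c. poly c (of_real t)) P"
  have c: "coeff p i = poly (coeff P i) (of_real t)" for i by (simp add: p_def coeff_map_poly)
  have deg: "degree p = degree P"
    unfolding p_def by (rule map_poly_degree_eq) (use False in simp)
  have "filterlim (complex_of_real) at_infinity at_top"
    by (rule filterlim_of_real_at_infinity)
  from filterlim_compose[OF poly_divide_tendsto_aux this]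
  have "((\<lambda>x. poly p (of_real x) / of_real x ^ degree p) \<longlongrightarrow> lead_coeff p) at_top" .
  then have "((\<lambda>x. Re (poly p (of_real x) / of_real x ^ degree p)) \<longlongrightarrow> Re (lead_coeff p)) at_top"
    by (rule tendsto_Re)
  then have "0 \<le> Re (lead_coeff p)"
  proof (rule tendsto_lowerbound)
    show "\<forall>\<^sub>F x in at_top. 0 \<le> Re (poly p (of_real x) / of_real x ^ degree p)"
    proof (rule eventually_at_top_linorderI[of 1])
      fix x :: real assume "x \<ge> 1"
      moreover have "Re (poly p (of_real x) / of_real x ^ degree p) = Re (poly p (of_real x)) / x ^ degree p"
        by (metis Re_divide_of_real of_real_power)
      ultimately show "0 \<le> Re (poly p (of_real x) / of_real x ^ degree p)"
        using nonneg[of x] by (simp add: eval2_conv_poly p_def)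
    qed
  qed simp
  then show ?thesis by (simp add: c deg)
qed simp

lemma fps_bar_of_poly: "fps_bar (fps_of_poly p) = fps_of_poly (map_poly cnj p)"
  by (rule fps_ext) (simp add: cnj.coeff_map_hom)

text \<open>Take the square root whose constant term is positive. Its conjugate is a square root
  too, hence equal to it up to sign, and the constant terms exclude the minus sign.\<close>

lemma positive_fps_norm:
  fixes r :: "complex fps"
  assumes "fps_bar r = r" "Re (fps_nth r 0) > 0"
  shows "\<exists>w. r = w * fps_bar w"
proof -
  define w where "w = fps_radical (\<lambda>_. csqrt) (Suc 1) r"
  have r0: "fps_nth r 0 \<noteq> 0" "Im (fps_nth r 0) = 0"
  proof -
    have "cnj (fps_nth r 0) = fps_nth r 0" by (metis assms(1) fps_bar_nth)
    then show "Im (fps_nth r 0) = 0" by (simp add: complex_eq_iff)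
  qed (use assms(2) in auto)
  have "csqrt (fps_nth r 0) ^ Suc 1 = fps_nth r 0"
    using power2_csqrt[of "fps_nth r 0"] by (simp only: Suc_1)
  then have w: "w ^ Suc 1 = r"
    unfolding w_def using power_radical[OF r0(1), of "\<lambda>_. csqrt" 1] by blast
  have w0: "fps_nth w 0 = csqrt (fps_nth r 0)" by (simp add: w_def)
  have "fps_bar w ^ Suc 1 = w ^ Suc 1" by (metis assms(1) w bar.map_power)
  then have "(fps_bar w - w) * (fps_bar w + w) = 0" by (simp add: algebra_simps)
  moreover have "fps_nth (fps_bar w + w) 0 \<noteq> 0"
  proof -
    have "fps_nth w 0 = of_real (sqrt (Re (fps_nth r 0)))"
      unfolding w0 using csqrt_of_real_nonneg[of "fps_nth r 0"] r0(2) assms(2) by simp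
    then show ?thesis using assms(2) by (simp add: complex_eq_iff)
  qed
  ultimately have "fps_bar w = w" by (metis eq_iff_diff_eq_0 fps_zero_nth mult_eq_0_iff)
  then show ?thesis using w by (intro exI[of _ w]) simp
qed


text \<open>Split off t^n with n the order at 0. Nonnegativity at a small h > 0 makes the cofactor
  positive near 0, and then an odd n would give a negative value at -h.\<close>

lemma real_poly_nonneg_factor:
  fixes a :: "complex poly"
  assumes a: "a \<noteq> 0" "map_poly cnj a = a" and d: "d > 0"
    and nonneg: "\<And>t :: real. \<bar>t\<bar> < d \<Longrightarrow> 0 \<le> Re (poly a (of_real t))"
  obtains e r where "a = monom 1 (2 * e) * r" "map_poly cnj r = r" "Re (coeff r 0) > 0"
proof -
  define n where "n = order 0 a"
  obtain r where r: "a = [:- 0, 1:] ^ n * r" "\<not> [:- 0, 1:] dvd r"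
    using order_decomp[OF a(1), of 0] unfolding n_def by blast
  then have ar: "a = monom 1 n * r" by (simp add: monom_altdef)
  have r0: "poly r 0 \<noteq> 0" using r(2) by (simp add: poly_eq_0_iff_dvd)
  have "monom 1 n * map_poly cnj r = monom 1 n * r"
  proof -
    have "map_poly cnj (monom 1 n :: complex poly) = monom 1 n"
      by (rule poly_eqI) (simp add: cnj.coeff_map_hom coeff_monom)
    then show ?thesis using a(2) unfolding ar by (simp add: cnjp.map_mult)
  qed
  then have r_real: "map_poly cnj r = r" by (simp add: monom_eq_0_iff)
  have "cnj (poly r 0) = poly r 0" using cnj.poly_map_hom[of r 0] r_real by simp
  then have "Im (poly r 0) = 0" by (simp add: complex_eq_iff)
  then have re: "Re (poly r 0) \<noteq> 0" using r0 by (simp add: complex_eq_iff)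
  have "(\<lambda>t. poly r t) \<midarrow>0\<rightarrow> poly r 0" using isCont_def poly_isCont by blast
  then obtain s where s: "s > 0"
      "\<And>t. t \<noteq> 0 \<Longrightarrow> norm t < s \<Longrightarrow> norm (poly r t - poly r 0) < \<bar>Re (poly r 0)\<bar>"
    using LIM_D[of "poly r" "poly r 0" 0 "\<bar>Re (poly r 0)\<bar>"] re by auto
  define h where "h = min (d / 2) (s / 2)"
  have h: "h > 0" "h < d" "h < s" using d s by (auto simp: h_def)
  have near: "\<bar>Re (poly r t) - Re (poly r 0)\<bar> < \<bar>Re (poly r 0)\<bar>" if "t \<noteq> 0" "norm t < s" for t
    using s(2)[OF that] abs_Re_le_cmod[of "poly r t - poly r 0"] by simp
  have p1: "0 \<le> Re (poly r (of_real h))"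
  proof -
    have "0 \<le> h ^ n * Re (poly r (of_real h))"
      using nonneg[of h] h by (simp add: ar poly_monom flip: of_real_power)
    then show ?thesis using zero_less_power[OF h(1), of n] by (auto simp: zero_le_mult_iff)
  qed
  have pos: "Re (poly r 0) > 0"
    using near[of "of_real h"] p1 h by (auto simp: abs_if split: if_splits)
  have "Re (poly r (of_real (- h))) > 0"
    using near[of "of_real (- h)"] pos h by (auto simp: abs_if split: if_splits)
  have "even n"
  proof (rule ccontr)
    assume "odd n"
    have "poly a (of_real (- h)) = of_real ((- h) ^ n) * poly r (of_real (- h))"
      by (simp add: ar poly_monom)
    then have "Re (poly a (of_real (- h))) = (- h) ^ n * Re (poly r (of_real (- h)))" by simp
    moreover have "(- h) ^ n < 0" using h \<open>odd n\<close> by (simp add: power_minus_odd)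
    ultimately have "Re (poly a (of_real (- h))) < 0"
      using \<open>Re (poly r (of_real (- h))) > 0\<close> by (simp add: mult_neg_pos)
    then show False using nonneg[of "- h"] h by simp
  qed
  then obtain e where "n = 2 * e" by (elim evenE)
  then show ?thesis using that[of e r] ar r_real pos by (simp add: poly_0_coeff_0)
qed

text \<open>With a the leading coefficient, a^D P(x) = a Q(a x) for a monic Q, which inherits a
  lower bound and is therefore a norm. Since a is t^(2e) times a norm, so is P up to an even power
  of t, and that power cancels.\<close>

lemma positive_imp_fps_norm:
  fixes P :: "complex poly poly"
  assumes real: "cnj2 P = P" and cd: "c > 0" "d > 0"
    and pos: "\<And>x t :: real. \<bar>t\<bar> < d \<Longrightarrow> c * \<bar>t\<bar> ^ m \<le> Re (eval2 P (of_real x) (of_real t))"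
  shows "\<exists>f. map_poly fps_of_poly P = f * map_poly fps_bar f"
proof -
  define a where "a = lead_coeff P"
  define D where "D = degree P"
  have "P \<noteq> 0"
  proof
    assume "P = 0"
    then have "c * \<bar>d / 2\<bar> ^ m \<le> 0" using pos[of "d / 2" 0] cd by simp
    moreover have "c * \<bar>d / 2\<bar> ^ m > 0" using cd by (intro mult_pos_pos zero_less_power) auto
    ultimately show False by simp
  qed
  then have a0: "a \<noteq> 0" by (simp add: a_def)
  have coeff_real: "map_poly cnj (coeff P i) = coeff P i" for i
    using real by (metis cnj2_def cnjp.coeff_map_hom)
  have a_real: "map_poly cnj a = a" by (simp add: a_def coeff_real)
  have real_on_real: "poly q (of_real t) \<in> \<real>" if "map_poly cnj q = q" for q and t :: real
    using cnj.poly_map_hom[of q "of_real t"] that by (simp add: Reals_cnj_iff)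
  have a_nonneg: "0 \<le> Re (poly a (of_real t))" if "\<bar>t\<bar> < d" for t :: real
    unfolding a_def
  proof (rule lead_coeff_nonneg)
    show "0 \<le> Re (eval2 P (of_real x) (of_real t))" for x :: real
      using pos[OF that, of x] cd(1) by (smt (verit) mult_nonneg_nonneg zero_le_power abs_ge_zero)
  qed (rule real_on_real, rule coeff_real)
  define Q where "Q = monom 1 D + (\<Sum>i<D. monom (coeff P i * a ^ (D - 1 - i)) i)"
  have cQ: "coeff Q i = (if i = D then 1 else if i < D then coeff P i * a ^ (D - 1 - i) else 0)" for i
    by (auto simp: Q_def coeff_sum coeff_monom)
  have rel: "smult (a ^ D) P = smult a (pcompose Q [:0, a:])"
  proof (rule poly_eqI)
    fix i
    consider "i = D" | "i < D" | "i > D" by linarith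
    then show "coeff (smult (a ^ D) P) i = coeff (smult a (pcompose Q [:0, a:])) i"
    proof cases
      case 2
      then have "D = Suc (D - 1 - i + i)" by simp
      then have "a ^ D = a * (a ^ (D - 1 - i) * a ^ i)" by (metis power_Suc power_add)
      then show ?thesis using 2 by (simp add: coeff_pcompose_linear cQ mult_ac)
    qed (simp_all add: coeff_pcompose_linear cQ a_def D_def coeff_eq_0 mult.commute)
  qed
  have rel_eval: "poly a t ^ D * eval2 P x t = poly a t * eval2 Q (poly a t * x) t" for x t
  proof -
    have "eval2 (smult (a ^ D) P) x t = eval2 (smult a (pcompose Q [:0, a:])) x t" by (simp only: rel)
    moreover have "eval2 (pcompose Q [:0, a:]) x t = eval2 Q (poly a t * x) t"
    proof -
      have "poly (pcompose Q [:0, a:]) [:x:] = poly Q (poly [:0, a:] [:x:])" by (rule poly_pcompose)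
      moreover have "poly (poly [:0, a:] [:x:]) t = poly a t * x" by (simp add: mult.commute)
      ultimately show ?thesis by (simp only: eval2_def[of "pcompose Q [:0, a:]"] poly_poly_eval2)
    qed
    ultimately show ?thesis by (simp only: eval2_simps poly_power)
  qed
  obtain c' d' e' where low: "c' > 0" "d' > 0" "\<And>t. norm t < d' \<Longrightarrow> norm (poly a t) \<ge> c' * norm t ^ e'"
    using poly_lower_bound_near_0[OF a0] by metis
  obtain C where C: "C > 0" "\<And>t. norm t \<le> 1 \<Longrightarrow> norm (poly a t) \<le> C"
    using poly_bounded_on_ball[of 1 a] by auto
  \<comment> \<open>The exponent e' * D + m comes from the orders of \<open>a\<close> and of the
    bound on \<open>P\<close>; the added 1 makes the bound trivial at t = 0.\<close>
  define M where "M = e' * D + m + 1"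
  define c'' where "c'' = c' ^ D * c / C"
  define d'' where "d'' = min 1 (min d d')"
  have c'': "c'' > 0" "d'' > 0" using cd low C by (auto simp: c''_def d''_def)
  have Qlow: "norm (eval2 Q (of_real y) (of_real t)) \<ge> c'' * \<bar>t\<bar> ^ M" if t: "\<bar>t\<bar> < d''" for y t :: real
  proof (cases "t = 0")
    case False
    have t': "\<bar>t\<bar> < 1" "\<bar>t\<bar> < d" "\<bar>t\<bar> < d'" using t by (auto simp: d''_def)
    have at: "norm (poly a (of_real t)) \<ge> c' * \<bar>t\<bar> ^ e'" using low(3)[of "of_real t"] t' by simp
    have "c' * \<bar>t\<bar> ^ e' > 0" using low False by simp
    then have at0: "poly a (of_real t) \<noteq> 0" using at by auto
    obtain \<alpha> where \<alpha>: "poly a (of_real t) = of_real \<alpha>"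
      using real_on_real[OF a_real] by (metis Reals_cases)
    define x where "x = y / \<alpha>"
    have x: "poly a (of_real t) * of_real x = of_real y" using at0 by (simp add: \<alpha> x_def)
    have "(c' * \<bar>t\<bar> ^ e') ^ D * (c * \<bar>t\<bar> ^ m) \<le> norm (poly a (of_real t)) ^ D * norm (eval2 P (of_real x) (of_real t))"
    proof (intro mult_mono power_mono at)
      show "c * \<bar>t\<bar> ^ m \<le> norm (eval2 P (of_real x) (of_real t))"
        using pos[OF t'(2), of x] complex_Re_le_cmod order.trans by blast
    qed (use low cd in auto)
    also have "\<dots> = norm (poly a (of_real t)) * norm (eval2 Q (of_real y) (of_real t))"
      using rel_eval[of "of_real t" "of_real x"] unfolding x by (metis norm_mult norm_power)
    also have "\<dots> \<le> C * norm (eval2 Q (of_real y) (of_real t))"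
      using C(2)[of "of_real t"] t' by (intro mult_right_mono) auto
    finally have "c'' * \<bar>t\<bar> ^ (e' * D + m) \<le> norm (eval2 Q (of_real y) (of_real t))"
    proof -
      assume *: "(c' * \<bar>t\<bar> ^ e') ^ D * (c * \<bar>t\<bar> ^ m) \<le> C * norm (eval2 Q (of_real y) (of_real t))"
      have "\<bar>t\<bar> ^ (e' * D + m) = (\<bar>t\<bar> ^ e') ^ D * \<bar>t\<bar> ^ m" by (simp only: power_add power_mult)
      then show ?thesis using * C(1) by (simp add: c''_def power_mult_distrib field_simps)
    qed
    moreover have "\<bar>t\<bar> ^ M \<le> \<bar>t\<bar> ^ (e' * D + m)"
      unfolding M_def by (rule power_decreasing) (use t' in auto)
    ultimately show ?thesis using c''(1) by (meson mult_left_mono less_imp_le order.trans)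
  qed (simp add: M_def)
  define Q' where "Q' = map_poly fps_of_poly Q"
  have degQ: "degree Q = D" "lead_coeff Q = 1"
  proof -
    have "degree Q \<le> D" by (rule degree_le) (simp add: cQ)
    moreover have "coeff Q D \<noteq> 0" using cQ[of D] by simp
    ultimately show "degree Q = D" by (simp add: le_antisym le_degree)
    then show "lead_coeff Q = 1" by (simp add: cQ)
  qed
  have degQ': "degree Q' = D" "lead_coeff Q' = 1"
  proof -
    show *: "degree Q' = D" unfolding Q'_def degQ(1)[symmetric]
      by (rule map_poly_degree_eq) (simp add: degQ cQ)
    show "lead_coeff Q' = 1" unfolding * by (simp add: Q'_def fpsp.coeff_map_hom cQ)
  qed
  have "map_poly fps_bar Q' = Q'"
  proof (rule poly_eqI)
    fix i
    have "map_poly cnj (coeff Q i) = coeff Q i"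
      by (auto simp: cQ cnjp.map_one cnjp.map_mult cnjp.map_power coeff_real a_real)
    then show "coeff (map_poly fps_bar Q') i = coeff Q' i"
      by (simp add: Q'_def bar.coeff_map_hom fpsp.coeff_map_hom fps_bar_of_poly)
  qed
  then obtain f0 where f0: "Q' = f0 * map_poly fps_bar f0"
    using monic_no_real_branch_imp_norm[OF degQ'(2)] no_real_branch[OF c'' Qlow] unfolding Q'_def by blast
  have D: "D = 2 * degree f0"
  proof -
    have "f0 \<noteq> 0" using f0 degQ'(2) by auto
    moreover have "map_poly fps_bar f0 \<noteq> 0" using f0 degQ'(2) by auto
    ultimately show ?thesis using f0 degQ'(1) by (simp add: degree_mult_eq)
  qed
  obtain e r where er: "a = monom 1 (2 * e) * r" "map_poly cnj r = r" "Re (coeff r 0) > 0"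
    using real_poly_nonneg_factor[OF a0 a_real cd(2) a_nonneg] by blast
  define r' where "r' = fps_of_poly r"
  define a' where "a' = fps_of_poly a"
  have r': "fps_bar r' = r'" "Re (fps_nth r' 0) > 0" using er by (simp_all add: r'_def fps_bar_of_poly)
  have r'0: "fps_nth r' 0 \<noteq> 0" using r'(2) by auto
  have a': "a' = fps_X ^ (2 * e) * r'"
    by (simp add: a'_def er(1) fps_of_poly_mult r'_def fps_of_poly_monom)
  have a'_bar: "fps_bar a' = a'" by (simp add: a'_def fps_bar_of_poly a_real)
  obtain w where w: "r' = w * fps_bar w" using positive_fps_norm[OF r'] by blast
  define v where "v = inverse r'"
  have v: "v * r' = 1" unfolding v_def by (rule inverse_mult_eq_1[OF r'0])
  have v_bar: "fps_bar v = v"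
  proof -
    have "fps_bar v * r' = fps_bar (v * r')" by (simp only: bar.map_mult r'(1))
    then have "fps_bar v * r' = v * r'" by (simp only: v bar.map_one)
    then show ?thesis using r'0 by auto
  qed
  define n where "n = degree f0"
  define f1 where "f1 = pcompose f0 [:0, a':]"
  define P' where "P' = map_poly fps_of_poly P"
  have f1_bar: "map_poly fps_bar f1 = pcompose (map_poly fps_bar f0) [:0, a':]"
    by (rule poly_eqI) (simp add: f1_def bar.coeff_map_hom coeff_pcompose_linear bar.map_mult bar.map_power a'_bar)
  have P': "smult (a' ^ D) P' = smult a' (f1 * map_poly fps_bar f1)"
  proof -
    have 1: "map_poly fps_of_poly (smult (a ^ D) P) = smult (a' ^ D) P'"
      by (rule poly_eqI) (simp add: P'_def fpsp.coeff_map_hom fpsp.map_mult fpsp.map_power a'_def)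
    have 2: "map_poly fps_of_poly (smult a (pcompose Q [:0, a:])) = smult a' (pcompose Q' [:0, a':])"
      by (rule poly_eqI) (simp add: Q'_def fpsp.coeff_map_hom fpsp.map_mult fpsp.map_power a'_def coeff_pcompose_linear)
    show ?thesis using 1 2 by (simp add: rel f0 pcompose_mult f1_def f1_bar[unfolded f1_def])
  qed
  \<comment> \<open>Chosen with \<beta> * bar \<beta> = v^D a', where v inverts the unit part of a'.
    Scaling f1 by it turns the identity \<open>P'\<close> into g * bar g = t^(2eD) P'.\<close>
  define \<beta> where "\<beta> = fps_X ^ e * w * v ^ n"
  define g where "g = smult \<beta> f1"
  have bX: "fps_bar fps_X = fps_X" by (rule fps_ext) (simp add: fps_X_nth)
  have g_bar: "map_poly fps_bar g = smult (fps_bar \<beta>) (map_poly fps_bar f1)"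
    by (rule poly_eqI) (simp add: g_def bar.coeff_map_hom bar.map_mult)
  have bb: "\<beta> * fps_bar \<beta> = v ^ D * a'"
  proof -
    have "\<beta> * fps_bar \<beta> = fps_X ^ e * fps_X ^ e * (w * fps_bar w) * (v ^ n * v ^ n)"
      by (simp add: \<beta>_def bar.map_mult bar.map_power bX v_bar mult_ac)
    then show ?thesis by (simp add: w[symmetric] a' D n_def mult_2 mult_2_right power_add mult_ac)
  qed
  have "g * map_poly fps_bar g = smult (\<beta> * fps_bar \<beta>) (f1 * map_poly fps_bar f1)"
    unfolding g_bar by (simp add: g_def mult.commute)
  also have "\<dots> = smult (v ^ D) (smult (a' ^ D) P')" unfolding bb P' by simp
  also have "\<dots> = smult ((v * a') ^ D) P'" by (simp add: power_mult_distrib)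
  also have "v * a' = fps_X ^ (2 * e)" using v by (simp add: a' mult.left_commute)
  also have "(fps_X ^ (2 * e)) ^ D = (fps_X :: complex fps) ^ (2 * (e * D))" by (simp add: power_mult[symmetric] mult.assoc)
  finally have "smult (fps_X ^ (2 * (e * D))) P' = g * map_poly fps_bar g" by simp
  then show ?thesis unfolding P'_def[symmetric] by (rule norm_form_cancel_fps_X)
qed

text \<open>Coefficients of t^k with k < N in a product involve only such coefficients of the
  factors, so cutting the power series factor off at t^N keeps the identity modulo t^N.\<close>

theorem positive_imp_norm_truncated:
  fixes P :: "complex poly poly"
  assumes real: "cnj2 P = P" and cd: "c > 0" "d > 0"
    and pos: "\<And>x t :: real. \<bar>t\<bar> < d \<Longrightarrow> c * \<bar>t\<bar> ^ m \<le> Re (eval2 P (of_real x) (of_real t))"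
  shows "\<exists>f. 2 * degree f \<le> degree P \<and> (\<forall>i. degree (coeff f i) \<le> N) \<and>
    (\<forall>x. monom 1 N dvd poly (P - f * cnj2 f) [:x:])"
proof -
  obtain g where g: "map_poly fps_of_poly P = g * map_poly fps_bar g"
    using positive_imp_fps_norm[OF assms] by blast
  define tr where "tr c = (\<Sum>j<N. monom (fps_nth c j) j)" for c :: "complex fps"
  have c_tr: "coeff (tr c) j = (if j < N then fps_nth c j else 0)" for c j
    by (simp add: tr_def coeff_sum coeff_monom)
  have tr0: "tr 0 = 0" by (simp add: tr_def)
  define f where "f = map_poly tr g"
  have cf: "coeff f i = tr (coeff g i)" for i by (simp add: f_def coeff_map_poly tr0)
  have deg_P: "degree (map_poly fps_of_poly P) = degree P"
    by (rule degree_map_poly) (metis fps_of_poly_0 fps_of_poly_eq_iff)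
  have "degree f \<le> degree g" by (rule degree_le) (simp add: cf coeff_eq_0 tr0)
  moreover have "2 * degree g \<le> degree P"
  proof (cases "g = 0")
    case False
    then have "map_poly fps_bar g \<noteq> 0" by (metis degree_map_bar bar.coeff_map_hom coeff_0 fps_bar_bar leading_coeff_0_iff bar.map_zero)
    then show ?thesis using g deg_P False by (metis degree_map_bar degree_mult_eq mult_2 order_refl)
  qed simp
  moreover have "degree (coeff f i) \<le> N" for i
    by (rule degree_le) (simp add: cf c_tr)
  moreover have "monom 1 N dvd poly (P - f * cnj2 f) [:x:]" for x
  proof -
    have lf: "layer k (map_poly fps_of_poly f) = layer k g" if "k < N" for k
      by (rule poly_eqI) (simp add: fpsp.coeff_map_hom cf c_tr that)
    have lc: "layer k (map_poly fps_of_poly (cnj2 f)) = layer k (map_poly fps_bar g)" if "k < N" for k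
      by (rule poly_eqI) (simp add: fpsp.coeff_map_hom bar.coeff_map_hom cf c_tr that)
    have zero: "coeff (coeff (P - f * cnj2 f) i) k = 0" if "k < N" for i k
    proof -
      have "layer k (map_poly fps_of_poly (f * cnj2 f)) = layer k (map_poly fps_of_poly P)"
        unfolding g fpspp.map_mult layer_mult
        by (intro sum.cong refl) (use that in \<open>simp add: lf lc\<close>)
      then have "coeff (layer k (map_poly fps_of_poly (f * cnj2 f))) i = coeff (layer k (map_poly fps_of_poly P)) i"
        by simp
      then show ?thesis by (simp add: fpsp.coeff_map_hom)
    qed
    have "monom 1 N dvd coeff (P - f * cnj2 f) i" for i
      unfolding monom_1_dvd_iff' using zero by blast
    then show ?thesis unfolding poly_altdef by (intro dvd_sum) (simp add: dvd_mult2)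
  qed
  ultimately show ?thesis by (intro exI[of _ f]) auto
qed


section \<open>Laurent polynomials on the product of the line and the circle\<close>

text \<open>A property of functions on the product of line and circle: the power of u in the
  denominator accounts for negative exponents, and \<open>m\<close> bounds the degree in x only.
  Speaking of functions makes conjugates and real parts directly available.\<close>

definition laurent :: "nat \<Rightarrow> (real \<Rightarrow> complex \<Rightarrow> complex) \<Rightarrow> bool" where
  "laurent m g \<longleftrightarrow> (\<exists>E n. degree E \<le> m \<and>
     (\<forall>x u. norm u = 1 \<longrightarrow> g x u = eval2 E (of_real x) u / u ^ n))"

lemma laurent_cong:
  "laurent m f \<Longrightarrow> (\<And>x u. norm u = 1 \<Longrightarrow> f x u = g x u) \<Longrightarrow> laurent m g"
  unfolding laurent_def by metis

lemma laurent_mono: "laurent m f \<Longrightarrow> m \<le> k \<Longrightarrow> laurent k f"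
  unfolding laurent_def by (meson order.trans)

lemma laurent_eval2: "degree E \<le> m \<Longrightarrow> laurent m (\<lambda>x u. eval2 E (of_real x) u)"
  unfolding laurent_def by (intro exI[of _ E] exI[of _ 0]) simp

lemma laurent_poly: "laurent 0 (\<lambda>x u. poly q u)"
  using laurent_eval2[of "[:q:]" 0] by simp

lemma laurent_const: "laurent 0 (\<lambda>x u. c)"
  using laurent_poly[of "[:c:]"] by simp

lemma laurent_x: "laurent 1 (\<lambda>x u. of_real x)"
  using laurent_eval2[of "monom 1 1" 1] by (simp add: degree_monom_eq)

lemma laurent_inverse: "laurent 0 (\<lambda>x u. 1 / u)"
  unfolding laurent_def by (intro exI[of _ 1]) simp

lemma laurent_add:
  assumes "laurent m f" "laurent m g"
  shows "laurent m (\<lambda>x u. f x u + g x u)"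
proof -
  obtain E1 n1 where 1: "degree E1 \<le> m" "\<And>x u. norm u = 1 \<Longrightarrow> f x u = eval2 E1 (of_real x) u / u ^ n1"
    using assms(1) unfolding laurent_def by auto
  obtain E2 n2 where 2: "degree E2 \<le> m" "\<And>x u. norm u = 1 \<Longrightarrow> g x u = eval2 E2 (of_real x) u / u ^ n2"
    using assms(2) unfolding laurent_def by auto
  show ?thesis unfolding laurent_def
  proof (intro exI conjI allI impI)
    show "degree (smult (monom 1 n2) E1 + smult (monom 1 n1) E2) \<le> m"
      by (intro degree_add_le order.trans[OF degree_smult_le] 1 2)
    fix x and u :: complex assume u: "norm u = 1"
    then have "u \<noteq> 0" by auto
    then show "f x u + g x u = eval2 (smult (monom 1 n2) E1 + smult (monom 1 n1) E2) (of_real x) u / u ^ (n1 + n2)"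
      using 1(2)[OF u] 2(2)[OF u] by (simp add: poly_monom power_add field_simps)
  qed
qed

lemma laurent_mult:
  assumes "laurent m f" "laurent k g"
  shows "laurent (m + k) (\<lambda>x u. f x u * g x u)"
proof -
  obtain E1 n1 where 1: "degree E1 \<le> m" "\<And>x u. norm u = 1 \<Longrightarrow> f x u = eval2 E1 (of_real x) u / u ^ n1"
    using assms(1) unfolding laurent_def by auto
  obtain E2 n2 where 2: "degree E2 \<le> k" "\<And>x u. norm u = 1 \<Longrightarrow> g x u = eval2 E2 (of_real x) u / u ^ n2"
    using assms(2) unfolding laurent_def by auto
  show ?thesis unfolding laurent_def
  proof (intro exI conjI allI impI)
    show "degree (E1 * E2) \<le> m + k"
      using degree_mult_le[of E1 E2] 1(1) 2(1) by linarith
    fix x and u :: complex assume u: "norm u = 1"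
    show "f x u * g x u = eval2 (E1 * E2) (of_real x) u / u ^ (n1 + n2)"
      using 1(2)[OF u] 2(2)[OF u] by (simp add: power_add)
  qed
qed

lemma laurent_cmult: "laurent m f \<Longrightarrow> laurent m (\<lambda>x u. c * f x u)"
  using laurent_mult[OF laurent_const] by simp

lemma laurent_diff: "laurent m f \<Longrightarrow> laurent m g \<Longrightarrow> laurent m (\<lambda>x u. f x u - g x u)"
  using laurent_add[of m f "\<lambda>x u. - 1 * g x u"] laurent_cmult[of m g "- 1"] by simp

lemma laurent_power: "laurent m f \<Longrightarrow> laurent (m * n) (\<lambda>x u. f x u ^ n)"
proof (induction n)
  case (Suc n)
  then show ?case using laurent_mult[of m f "m * n" "\<lambda>x u. f x u ^ n"] by simp
qed (use laurent_const[of 1] in simp)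

lemma laurent_sum: "(\<And>i. i \<in> I \<Longrightarrow> laurent m (f i)) \<Longrightarrow> laurent m (\<lambda>x u. \<Sum>i\<in>I. f i x u)"
  using laurent_mono[OF laurent_const[of 0]]
  by (induction I rule: infinite_finite_induct) (auto intro!: laurent_add)

text \<open>On the circle cnj u = 1 / u, and x is real.\<close>

lemma laurent_cnj:
  assumes "laurent m f"
  shows "laurent m (\<lambda>x u. cnj (f x u))"
proof -
  obtain E n where E: "degree E \<le> m" "\<And>x u. norm u = 1 \<Longrightarrow> f x u = eval2 E (of_real x) u / u ^ n"
    using assms unfolding laurent_def by auto
  have cnj_unit: "cnj u = 1 / u" if "norm u = 1" for u
    using that by (metis complex_norm_square divide_eq_eq norm_zero of_real_1 one_power2 zero_neq_one mult.commute)
  have poly: "laurent 0 (\<lambda>x u. cnj (poly q u))" for q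
  proof (induction q)
    case (pCons a q)
    have "laurent 0 (\<lambda>x u. cnj a + 1 / u * cnj (poly q u))"
      using laurent_add[OF laurent_const laurent_mult[OF laurent_inverse pCons.IH, simplified]] by simp
    then show ?case by (rule laurent_cong) (simp add: cnj_unit)
  qed (use laurent_const[of 0] in simp)
  have "laurent m (\<lambda>x u. \<Sum>i\<le>m. cnj (poly (coeff E i) u) * of_real x ^ i)"
  proof (rule laurent_sum)
    fix i assume "i \<in> {..m}"
    then show "laurent m (\<lambda>x u. cnj (poly (coeff E i) u) * of_real x ^ i)"
      using laurent_mult[OF poly laurent_power[OF laurent_x]] by (auto intro: laurent_mono)
  qed
  then have "laurent m (\<lambda>x u. (\<Sum>i\<le>m. cnj (poly (coeff E i) u) * of_real x ^ i) * u ^ n)"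
    using laurent_mult[OF _ laurent_poly[of "monom 1 n"]] by (auto simp: poly_monom)
  then show ?thesis
  proof (rule laurent_cong)
    fix x and u :: complex assume u: "norm u = 1"
    then have "u \<noteq> 0" by auto
    then show "(\<Sum>i\<le>m. cnj (poly (coeff E i) u) * of_real x ^ i) * u ^ n = cnj (f x u)"
      using u by (simp add: E(2) eval2_altdef'[OF E(1)] cnj_unit power_divide divide_simps)
  qed
qed

lemma laurent_norm_square:
  assumes "laurent m f"
  shows "laurent (2 * m) (\<lambda>x u. of_real ((norm (f x u))\<^sup>2))"
  using laurent_mult[OF assms laurent_cnj[OF assms]]
  by (simp only: complex_norm_square mult_2)

lemma power_abs_le_one_plus_square_power:
  fixes x :: real
  assumes "i \<le> 2 * d"
  shows "\<bar>x\<bar> ^ i \<le> (1 + x\<^sup>2) ^ d"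
proof (cases "\<bar>x\<bar> \<le> 1")
  case True
  then have "\<bar>x\<bar> ^ i \<le> 1" by (simp add: power_le_one)
  also have "1 \<le> (1 + x\<^sup>2) ^ d" by (simp add: one_le_power)
  finally show ?thesis .
next
  case False
  then have "\<bar>x\<bar> ^ i \<le> \<bar>x\<bar> ^ (2 * d)" using assms by (intro power_increasing) auto
  also have "\<dots> = (x\<^sup>2) ^ d" by (simp add: power_mult)
  also have "\<dots> \<le> (1 + x\<^sup>2) ^ d" by (intro power_mono) auto
  finally show ?thesis .
qed

lemma poly_growth_bound:
  fixes q :: "complex poly"
  assumes "degree q \<le> 2 * d"
  obtains C where "C > 0" "\<And>x :: real. norm (poly q (of_real x)) \<le> C * (1 + x\<^sup>2) ^ d"
proof
  define C where "C = 1 + (\<Sum>i\<le>degree q. norm (coeff q i))"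
  show "C > 0" unfolding C_def by (intro add_pos_nonneg sum_nonneg) auto
  fix x :: real
  have "norm (poly q (of_real x)) \<le> (\<Sum>i\<le>degree q. norm (coeff q i * of_real x ^ i))"
    unfolding poly_altdef by (rule norm_sum)
  also have "\<dots> \<le> (\<Sum>i\<le>degree q. norm (coeff q i) * (1 + x\<^sup>2) ^ d)"
    using assms by (intro sum_mono)
      (auto simp: norm_mult norm_power intro!: mult_left_mono power_abs_le_one_plus_square_power)
  also have "\<dots> \<le> C * (1 + x\<^sup>2) ^ d"
    by (simp add: C_def sum_distrib_right distrib_right)
  finally show "norm (poly q (of_real x)) \<le> C * (1 + x\<^sup>2) ^ d" .
qed

lemma laurent_bound:
  assumes "laurent (2 * d) f"
  obtains C where "C > 0" "\<And>x u. norm u = 1 \<Longrightarrow> norm (f x u) \<le> C * (1 + x\<^sup>2) ^ d"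
proof -
  obtain E n where E: "degree E \<le> 2 * d" "\<And>x u. norm u = 1 \<Longrightarrow> f x u = eval2 E (of_real x) u / u ^ n"
    using assms unfolding laurent_def by auto
  have "\<exists>C>0. \<forall>u. norm u \<le> 1 \<longrightarrow> norm (poly (coeff E i) u) \<le> C" for i
    using poly_bounded_on_ball[of 1 "coeff E i"] by metis
  then obtain C where C: "\<And>i. C i > 0" "\<And>i u. norm u \<le> 1 \<Longrightarrow> norm (poly (coeff E i) u) \<le> C i"
    by metis
  show ?thesis
  proof
    show "(\<Sum>i\<le>2 * d. C i) > 0" using C(1) by (intro sum_pos) auto
    fix x and u :: complex assume u: "norm u = 1"
    have "norm (f x u) = norm (eval2 E (of_real x) u)"
      using E(2)[OF u] u by (simp add: norm_divide norm_power)
    also have "\<dots> \<le> (\<Sum>i\<le>2 * d. norm (poly (coeff E i) u * of_real x ^ i))"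
      unfolding eval2_altdef'[OF E(1)] by (rule norm_sum)
    also have "\<dots> \<le> (\<Sum>i\<le>2 * d. C i * (1 + x\<^sup>2) ^ d)"
      using C u by (intro sum_mono)
        (auto simp: norm_mult norm_power less_imp_le intro!: mult_mono power_abs_le_one_plus_square_power)
    finally show "norm (f x u) \<le> (\<Sum>i\<le>2 * d. C i) * (1 + x\<^sup>2) ^ d"
      by (simp add: sum_distrib_right)
  qed
qed

text \<open>Ordinary polynomials suffice as summands, because the denominator u^n of a Laurent
  polynomial has modulus 1 on the circle.\<close>

definition sos :: "(real \<Rightarrow> complex \<Rightarrow> real) \<Rightarrow> bool" where
  "sos p \<longleftrightarrow> (\<exists>Qs. \<forall>x u. norm u = 1 \<longrightarrow> p x u = (\<Sum>Q\<leftarrow>Qs. (norm (eval2 Q (of_real x) u))\<^sup>2))"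

lemma sos_cong: "sos p \<Longrightarrow> (\<And>x u. norm u = 1 \<Longrightarrow> p x u = q x u) \<Longrightarrow> sos q"
  unfolding sos_def by metis

lemma sos_0: "sos (\<lambda>x u. 0)"
  unfolding sos_def by (intro exI[of _ "[]"]) simp

lemma sos_add: "sos p \<Longrightarrow> sos q \<Longrightarrow> sos (\<lambda>x u. p x u + q x u)"
  unfolding sos_def
proof (elim exE)
  fix Ps Qs
  assume "\<forall>x u. norm u = 1 \<longrightarrow> p x u = (\<Sum>Q\<leftarrow>Ps. (norm (eval2 Q (of_real x) u))\<^sup>2)"
    "\<forall>x u. norm u = 1 \<longrightarrow> q x u = (\<Sum>Q\<leftarrow>Qs. (norm (eval2 Q (of_real x) u))\<^sup>2)"
  then show "\<exists>Qs. \<forall>x u. norm u = 1 \<longrightarrow> p x u + q x u = (\<Sum>Q\<leftarrow>Qs. (norm (eval2 Q (of_real x) u))\<^sup>2)"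
    by (intro exI[of _ "Ps @ Qs"]) simp
qed

lemma sos_sum: "(\<And>i. i \<in> I \<Longrightarrow> sos (p i)) \<Longrightarrow> sos (\<lambda>x u. \<Sum>i\<in>I. p i x u)"
  by (induction I rule: infinite_finite_induct) (auto intro: sos_0 sos_add)

lemma sos_mult_norm_square:
  assumes "laurent m g" "sos p"
  shows "sos (\<lambda>x u. (norm (g x u))\<^sup>2 * p x u)"
proof -
  obtain E n where E: "\<And>x u. norm u = 1 \<Longrightarrow> g x u = eval2 E (of_real x) u / u ^ n"
    using assms unfolding laurent_def by auto
  obtain Qs where Qs: "\<And>x u. norm u = 1 \<Longrightarrow> p x u = (\<Sum>Q\<leftarrow>Qs. (norm (eval2 Q (of_real x) u))\<^sup>2)"
    using assms unfolding sos_def by auto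
  show ?thesis unfolding sos_def
  proof (intro exI[of _ "map ((*) E) Qs"] allI impI)
    fix x and u :: complex assume u: "norm u = 1"
    have "norm (g x u) = norm (eval2 E (of_real x) u)"
      using E[OF u] u by (simp add: norm_divide norm_power)
    then show "(norm (g x u))\<^sup>2 * p x u = (\<Sum>Q\<leftarrow>map ((*) E) Qs. (norm (eval2 Q (of_real x) u))\<^sup>2)"
      by (simp add: Qs[OF u] sum_list_const_mult[symmetric] o_def norm_mult power_mult_distrib)
  qed
qed

lemma sos_norm_square: "laurent m g \<Longrightarrow> sos (\<lambda>x u. (norm (g x u))\<^sup>2)"
proof -
  assume g: "laurent m g"
  have "sos (\<lambda>x u. 1)" unfolding sos_def by (intro exI[of _ "[1]"]) simp
  from sos_mult_norm_square[OF g this] show ?thesis by simp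
qed

lemma sos_cmult: "c \<ge> 0 \<Longrightarrow> sos p \<Longrightarrow> sos (\<lambda>x u. c * p x u)"
  using sos_mult_norm_square[OF laurent_const[of "of_real (sqrt c)"], of p] by simp

subsection \<open>Nonnegative polynomials in one real variable\<close>

lemma real_valued_imp_cnj_invariant:
  assumes "\<And>x :: real. poly p (of_real x) \<in> \<real>"
  shows "map_poly cnj p = p"
proof (rule ccontr)
  assume "map_poly cnj p \<noteq> p"
  then have "finite {z. poly (map_poly cnj p - p) z = 0}" by (intro poly_roots_finite) simp
  moreover have "range complex_of_real \<subseteq> {z. poly (map_poly cnj p - p) z = 0}"
  proof safe
    fix x :: real
    have "poly (map_poly cnj p) (of_real x) = cnj (poly p (of_real x))"
      using cnj.poly_map_hom[of p "of_real x"] by simp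
    then show "poly (map_poly cnj p - p) (of_real x) = 0" using assms[of x] by (simp add: Reals_cnj_iff)
  qed
  ultimately have "finite (range complex_of_real)" by (rule finite_subset[rotated])
  then have "finite (UNIV :: real set)" by (rule finite_imageD) (simp add: inj_on_def)
  then show False using infinite_UNIV_char_0 by blast
qed

lemma tendsto_Re_poly: "((\<lambda>x :: real. Re (poly p (of_real x))) \<longlongrightarrow> Re (poly p (of_real a))) (at a)"
proof -
  have "isCont (\<lambda>x :: real. poly p (of_real x)) a"
    by (rule isCont_o2[of _ _ "poly p"]) simp_all
  then show ?thesis unfolding isCont_def by (rule tendsto_Re)
qed

lemma Re_poly_nonneg_limit:
  assumes "\<And>x :: real. x \<noteq> a \<Longrightarrow> 0 \<le> Re (poly p (of_real x))"
  shows "0 \<le> Re (poly p (of_real a))"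
  by (rule tendsto_lowerbound[OF tendsto_Re_poly])
    (use assms in \<open>auto simp: eventually_at intro!: exI[of _ 1]\<close>)

text \<open>Strip off (x - z)(x - cnj z) for a root z and induct on the degree; for real z this uses
  that its multiplicity is even.\<close>

lemma nonneg_real_poly_norm_square:
  assumes "map_poly cnj p = p" "\<And>x :: real. 0 \<le> Re (poly p (of_real x))"
  shows "\<exists>f. p = f * map_poly cnj f"
  using assms
proof (induction "degree p" arbitrary: p rule: less_induct)
  case less
  note real = \<open>map_poly cnj p = p\<close> and nonneg = less.prems(2)
  show ?case
  proof (cases "degree p = 0")
    case True
    then obtain a where a: "p = [:a:]" by (rule degree_eq_zeroE)
    have "cnj a = a" using real a by (simp add: map_poly_pCons)
    then have "a = of_real (sqrt (Re a)) * of_real (sqrt (Re a))"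
      using nonneg[of 0] a by (simp add: complex_eq_iff)
    then show ?thesis using a by (intro exI[of _ "[:of_real (sqrt (Re a)):]"]) (simp add: map_poly_pCons)
  next
    case False
    then obtain z where z: "poly p z = 0" using alg_closed_imp_poly_has_root[of p] by blast
    have p0: "p \<noteq> 0" using False by auto
    obtain q where q: "p = [:- z, 1:] * q" using z by (metis poly_eq_0_iff_dvd dvdE)
    have "poly q (cnj z) = 0"
    proof (cases "z = cnj z")
      case False
      have "poly p (cnj z) = 0" using cnj.poly_map_hom[of p z] real z by simp
      then show ?thesis using False q by simp
    next
      case True
      then have zr: "z = of_real (Re z)" by (simp add: complex_eq_iff)
      have "map_poly cnj q = q"
      proof -
        have "[:- z, 1:] * map_poly cnj q = [:- z, 1:] * q"
          using real True unfolding q by (simp add: cnjp.map_mult cnj.map_poly_lin del: mult_pCons_left)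
        then show ?thesis by (subst (asm) mult_cancel_left) simp
      qed
      then have im: "Im (poly q z) = 0"
        using cnj.poly_map_hom[of q z] True by (simp add: complex_eq_iff)
      \<comment> \<open>At a real root z the quotient q is nonpositive on the left and nonnegative
        on the right, so q vanishes at z by continuity.\<close>
      have pq: "Re (poly p (of_real x)) = (x - Re z) * Re (poly q (of_real x))" for x :: real
        unfolding q by (subst zr) (simp add: left_diff_distrib flip: of_real_diff of_real_minus of_real_add)
      have lim: "((\<lambda>x :: real. Re (poly q (of_real x))) \<longlongrightarrow> Re (poly q z)) (at (Re z))"
        using tendsto_Re_poly[of q "Re z"] zr by simp
      have right: "0 \<le> Re (poly q (of_real x))" if "x > Re z" for x
        using nonneg[of x] that unfolding pq by (simp add: zero_le_mult_iff)
      have left: "Re (poly q (of_real x)) \<le> 0" if "x < Re z" for x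
        using nonneg[of x] that unfolding pq by (simp add: zero_le_mult_iff)
      have "Re (poly q z) \<ge> 0"
      proof (rule tendsto_lowerbound[OF tendsto_mono[OF _ lim]])
        show "\<forall>\<^sub>F x in at_right (Re z). 0 \<le> Re (poly q (of_real x))"
          unfolding eventually_at_right_field
          by (intro exI[of _ "Re z + 1"]) (use right in auto)
      qed (auto intro: at_le)
      moreover have "Re (poly q z) \<le> 0"
      proof (rule tendsto_upperbound[OF tendsto_mono[OF _ lim]])
        show "\<forall>\<^sub>F x in at_left (Re z). Re (poly q (of_real x)) \<le> 0"
          unfolding eventually_at_left_field
          by (intro exI[of _ "Re z - 1"]) (use left in auto)
      qed (auto intro: at_le)
      ultimately have "poly q z = 0" using im by (simp add: complex_eq_iff)
      then show ?thesis using True by simp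
    qed
    then obtain r where "q = [:- cnj z, 1:] * r" by (metis poly_eq_0_iff_dvd dvdE)
    then have r: "p = [:- z, 1:] * [:- cnj z, 1:] * r" using q by (simp only: mult.assoc)
    have nz: "[:- z, 1:] * [:- cnj z, 1:] \<noteq> 0" by (simp del: mult_pCons_left mult_pCons_right)
    have "map_poly cnj ([:- z, 1:] * [:- cnj z, 1:]) = [:- z, 1:] * [:- cnj z, 1:]"
      by (simp add: cnjp.map_mult cnj.map_poly_lin mult.commute del: mult_pCons_left mult_pCons_right)
    then have "[:- z, 1:] * [:- cnj z, 1:] * map_poly cnj r = [:- z, 1:] * [:- cnj z, 1:] * r"
      using real unfolding r by (metis cnjp.map_mult)
    then have r_real: "map_poly cnj r = r" using nz by (metis mult_left_cancel)
    have pr: "Re (poly p (of_real x)) = (norm (of_real x - z))\<^sup>2 * Re (poly r (of_real x))" for x :: real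
    proof -
      have "poly p (of_real x) = ((of_real x - z) * cnj (of_real x - z)) * poly r (of_real x)"
        unfolding r by (simp add: algebra_simps)
      then show ?thesis unfolding complex_norm_square[symmetric] by simp
    qed
    have pos: "0 \<le> Re (poly r (of_real x))" if "of_real x \<noteq> z" for x :: real
    proof -
      have "(norm (of_real x - z))\<^sup>2 > 0" using that by simp
      then show ?thesis using nonneg[of x] unfolding pr by (metis zero_le_mult_iff not_less)
    qed
    have "0 \<le> Re (poly r (of_real x))" for x :: real
    proof (cases "of_real x = z")
      case True
      show ?thesis by (rule Re_poly_nonneg_limit) (use pos True in auto)
    qed (use pos in auto)
    moreover have "degree r < degree p"
    proof -
      have "r \<noteq> 0" using r p0 by auto
      then have "degree p = degree ([:- z, 1:] * [:- cnj z, 1:]) + degree r"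
        unfolding r using nz by (rule degree_mult_eq[rotated])
      then show ?thesis by (simp add: degree_mult_eq del: mult_pCons_left mult_pCons_right)
    qed
    ultimately obtain f where f: "r = f * map_poly cnj f"
      using less.hyps[of r] r_real by blast
    have "p = ([:- z, 1:] * f) * map_poly cnj ([:- z, 1:] * f)"
      unfolding r f by (simp add: cnjp.map_mult cnj.map_poly_lin mult_ac del: mult_pCons_left mult_pCons_right)
    then show ?thesis by blast
  qed
qed


subsection \<open>Strictly positive Laurent polynomials\<close>

lemma poly_altdef':
  fixes p :: "complex poly"
  assumes "degree p \<le> n"
  shows "poly p x = (\<Sum>i\<le>n. coeff p i * x ^ i)"
  unfolding poly_altdef
  by (rule sum.mono_neutral_left) (use assms in \<open>auto simp: coeff_eq_0\<close>)

lemma sum_root_of_unity_powers: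
  fixes R :: nat
  assumes R: "R > 0" and ab: "\<bar>int a - int b\<bar> < int R"
  defines "w \<equiv> \<lambda>s::nat. cis (2 * pi * real s / real R)"
  shows "(\<Sum>s<R. w s ^ a * cnj (w s) ^ b) = (if a = b then of_nat R else 0)"
proof -
  define z where "z = cis (2 * pi * (real a - real b) / real R)"
  have w: "w s ^ a * cnj (w s) ^ b = z ^ s" for s
  proof -
    have "w s ^ a * cnj (w s) ^ b = cis (real a * (2 * pi * real s / real R)) * cis (real b * (- (2 * pi * real s / real R)))"
      by (simp only: w_def cis_cnj DeMoivre)
    also have "\<dots> = cis (real s * (2 * pi * (real a - real b) / real R))"
      by (simp add: cis_mult) (simp add: algebra_simps diff_divide_distrib)
    finally show ?thesis by (simp add: z_def DeMoivre)
  qed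
  show ?thesis
  proof (cases "a = b")
    case True
    then show ?thesis unfolding w by (simp add: z_def)
  next
    case False
    have "z \<noteq> 1"
    proof
      assume "z = 1"
      then have "cos (2 * pi * (real a - real b) / real R) = 1" by (simp add: z_def complex_eq_iff)
      then obtain m :: int where "2 * pi * (real a - real b) / real R = of_int m * 2 * pi"
        using cos_one_2pi_int by auto
      then have "(real a - real b) * (2 * pi) = (of_int m * real R) * (2 * pi)"
        using R by (simp add: field_simps)
      then have "real a - real b = of_int m * real R" by (subst (asm) mult_cancel_right) simp
      then have m: "int a - int b = m * int R"
        by (metis of_int_diff of_int_eq_iff of_int_mult of_int_of_nat_eq)
      with False have "m \<noteq> 0" by auto
      then have "\<bar>m\<bar> \<ge> 1" by linarith
      then have "\<bar>m * int R\<bar> \<ge> int R" by (simp add: abs_mult mult_le_cancel_right1)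
      with ab m show False by linarith
    qed
    moreover have "z ^ R = 1"
    proof -
      have "z ^ R = cis (2 * pi * (real a - real b))" using R by (simp add: z_def DeMoivre)
      also have "\<dots> = cis (2 * pi * real_of_int (int a - int b))" by simp
      also have "\<dots> = 1" by (rule cis_multiple_2pi) simp
      finally show ?thesis .
    qed
    ultimately have "(\<Sum>s<R. z ^ s) = 0" by (simp add: geometric_sum)
    then show ?thesis using False by (simp add: w)
  qed
qed

text \<open>The Fejer coefficient: the number of pairs of indices below M with a prescribed
  difference.\<close>

lemma card_shifted_pairs:
  assumes "j \<le> n + M" "n \<le> j + M"
  shows "card {(l, l'). l < M \<and> l' < M \<and> j + l' = n + l} = M - (if j \<le> n then n - j else j - n)"
proof (cases "j \<le> n")
  case True
  have "bij_betw (\<lambda>l. (l, l + (n - j))) {..<M - (n - j)} {(l, l'). l < M \<and> l' < M \<and> j + l' = n + l}"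
    by (rule bij_betwI[where g = fst]) (use True in auto)
  then show ?thesis using True by (simp add: bij_betw_same_card[symmetric])
next
  case False
  have "bij_betw (\<lambda>l. (l + (j - n), l)) {..<M - (j - n)} {(l, l'). l < M \<and> l' < M \<and> j + l' = n + l}"
    by (rule bij_betwI[where g = snd]) (use False in auto)
  then show ?thesis using False by (simp add: bij_betw_same_card[symmetric])
qed

text \<open>Convolution with the Fejer kernel, sampled at R-th roots of unity, multiplies the
  frequency j - n by M - |j - n|. All occurring frequencies are smaller than R in modulus, so the
  sampling causes no aliasing.\<close>

lemma fejer_reproduction:
  fixes u :: complex and M n R :: nat
  assumes u: "norm u = 1" and R: "R = 2 * n + M + 1" and M: "M > n" and j: "j \<le> 2 * n"
  defines "w \<equiv> \<lambda>s::nat. cis (2 * pi * real s / real R)"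
  shows "(\<Sum>s<R. w s ^ j * cnj (w s) ^ n * of_real ((norm (\<Sum>l<M. (u * cnj (w s)) ^ l))\<^sup>2)) =
    of_nat R * of_nat (M - (if j \<le> n then n - j else j - n)) * (u ^ j * cnj u ^ n)"
proof -
  have uu: "u * cnj u = 1" using u by (metis complex_norm_square of_real_1 one_power2)
  have uk: "u ^ l * cnj u ^ l' = u ^ j * cnj u ^ n" if "j + l' = n + l" for l l'
  proof -
    have "u ^ l * cnj u ^ l' = u ^ l * cnj u ^ l' * (u * cnj u) ^ n" by (simp add: uu)
    also have "\<dots> = u ^ (n + l) * cnj u ^ (l' + n)" by (simp add: power_add power_mult_distrib mult_ac)
    also have "\<dots> = (u * cnj u) ^ l' * (u ^ j * cnj u ^ n)"
      by (simp add: that[symmetric] power_add power_mult_distrib mult_ac)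
    finally show ?thesis by (simp add: uu)
  qed
  have "w s ^ j * cnj (w s) ^ n * of_real ((norm (\<Sum>l<M. (u * cnj (w s)) ^ l))\<^sup>2) =
      (\<Sum>l<M. \<Sum>l'<M. u ^ l * cnj u ^ l' * (w s ^ (j + l') * cnj (w s) ^ (n + l)))" for s
    unfolding complex_norm_square
    by (subst sum.swap) (simp add: sum_product sum_distrib_left power_mult_distrib power_add mult_ac)
  then have "(\<Sum>s<R. w s ^ j * cnj (w s) ^ n * of_real ((norm (\<Sum>l<M. (u * cnj (w s)) ^ l))\<^sup>2)) =
      (\<Sum>s<R. \<Sum>l<M. \<Sum>l'<M. u ^ l * cnj u ^ l' * (w s ^ (j + l') * cnj (w s) ^ (n + l)))"
    by simp
  also have "\<dots> = (\<Sum>l<M. \<Sum>s<R. \<Sum>l'<M. u ^ l * cnj u ^ l' * (w s ^ (j + l') * cnj (w s) ^ (n + l)))"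
    by (rule sum.swap)
  also have "\<dots> = (\<Sum>l<M. \<Sum>l'<M. \<Sum>s<R. u ^ l * cnj u ^ l' * (w s ^ (j + l') * cnj (w s) ^ (n + l)))"
    by (intro sum.cong refl sum.swap)
  also have "\<dots> = (\<Sum>l<M. \<Sum>l'<M. u ^ l * cnj u ^ l' * (\<Sum>s<R. w s ^ (j + l') * cnj (w s) ^ (n + l)))"
    by (simp add: sum_distrib_left)
  also have "\<dots> = (\<Sum>l<M. \<Sum>l'<M. if j + l' = n + l then of_nat R * (u ^ j * cnj u ^ n) else 0)"
  proof (intro sum.cong refl)
    fix l l' assume "l \<in> {..<M}" "l' \<in> {..<M}"
    then have "(\<Sum>s<R. w s ^ (j + l') * cnj (w s) ^ (n + l)) = (if j + l' = n + l then of_nat R else 0)"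
      unfolding w_def by (intro sum_root_of_unity_powers) (use R j in auto)
    then show "u ^ l * cnj u ^ l' * (\<Sum>s<R. w s ^ (j + l') * cnj (w s) ^ (n + l)) =
        (if j + l' = n + l then of_nat R * (u ^ j * cnj u ^ n) else 0)"
      using uk[of l' l] by simp
  qed
  also have "\<dots> = (\<Sum>(l, l') \<in> {..<M} \<times> {..<M}. if j + l' = n + l then of_nat R * (u ^ j * cnj u ^ n) else 0)"
    by (simp add: sum.cartesian_product)
  also have "\<dots> = (\<Sum>(l, l') \<in> {(l, l'). l < M \<and> l' < M \<and> j + l' = n + l}. of_nat R * (u ^ j * cnj u ^ n))"
    by (rule sum.mono_neutral_cong_right) (auto split: if_splits)
  also have "\<dots> = of_nat (card {(l, l'). l < M \<and> l' < M \<and> j + l' = n + l}) * (of_nat R * (u ^ j * cnj u ^ n))"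
    by (simp add: case_prod_beta)
  also have "\<dots> = of_nat R * of_nat (M - (if j \<le> n then n - j else j - n)) * (u ^ j * cnj u ^ n)"
    using M j by (subst card_shifted_pairs) auto
  finally show ?thesis .
qed

text \<open>
  The Fejer kernel represents \<open>p\<close> as a convex combination, with squares as weights, of the values
  on roots of unity of a slight perturbation of \<open>p\<close>, which are nonnegative polynomials in \<open>x\<close>.
\<close>

lemma strictly_positive_imp_sos:
  assumes lp: "laurent (2 * d) (\<lambda>x u. of_real (p x u))" and c: "c > 0"
    and pos: "\<And>x u. norm u = 1 \<Longrightarrow> c * (1 + x\<^sup>2) ^ d \<le> p x u"
  shows "sos p"
proof -
  obtain E0 n0 where E0: "degree E0 \<le> 2 * d"
    "\<And>x u. norm u = 1 \<Longrightarrow> of_real (p x u) = eval2 E0 (of_real x) u / u ^ n0"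
    using lp unfolding laurent_def by auto
  \<comment> \<open>Large enough to rewrite p with the symmetric range of frequencies j - n, where j
    runs up to 2n.\<close>
  define J where "J = n0 + (\<Sum>i\<le>2 * d. degree (coeff E0 i))"
  define n where "n = J"
  define E where "E = smult (monom 1 (n - n0)) E0"
  have dE: "degree (coeff E i) \<le> 2 * n" for i
  proof (cases "i \<le> 2 * d")
    case True
    have "degree (coeff E0 i) \<le> (\<Sum>i\<le>2 * d. degree (coeff E0 i))"
      by (rule member_le_sum) (use True in auto)
    then have "degree (coeff E0 i) \<le> n" by (simp add: n_def J_def)
    then show ?thesis
      using degree_mult_le[of "monom 1 (n - n0)" "coeff E0 i"] degree_monom_le[of "1::complex" "n - n0"]
      by (simp add: E_def)
  next
    case False
    then show ?thesis using E0(1) by (simp add: E_def coeff_eq_0)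
  qed
  have degE: "degree E \<le> 2 * d" using E0(1) degree_smult_le[of "monom 1 (n - n0)" E0] by (simp add: E_def)
  define F where "F j = map_poly (\<lambda>q. coeff q j) E" for j
  have cF: "coeff (F j) i = coeff (coeff E i) j" for i j by (simp add: F_def coeff_map_poly)
  have dF: "degree (F j) \<le> 2 * d" for j
    by (rule degree_le) (use degE in \<open>auto simp: cF coeff_eq_0\<close>)
  have p_eq: "of_real (p x u) = (\<Sum>j\<le>2 * n. poly (F j) (of_real x) * (u ^ j * cnj u ^ n))" if u: "norm u = 1" for x u
  proof -
    have u0: "u \<noteq> 0" using u by auto
    have uu: "u * cnj u = 1" using u by (metis complex_norm_square of_real_1 one_power2)
    have "n0 \<le> n" by (simp add: n_def J_def)
    then have "eval2 E (of_real x) u * u ^ n0 = eval2 E0 (of_real x) u * u ^ n"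
      by (simp add: E_def poly_monom power_add[symmetric])
    then have "of_real (p x u) = eval2 E (of_real x) u / u ^ n"
    proof -
      assume *: "eval2 E (of_real x) u * u ^ n0 = eval2 E0 (of_real x) u * u ^ n"
      have "of_real (p x u) * u ^ n0 = eval2 E0 (of_real x) u" using E0(2)[OF u, of x] u0 by simp
      then have "of_real (p x u) * u ^ n * u ^ n0 = eval2 E (of_real x) u * u ^ n0"
        unfolding * by (simp add: mult_ac)
      then show ?thesis using u0 by (simp add: eq_divide_eq)
    qed
    also have "\<dots> = eval2 E (of_real x) u * cnj u ^ n"
    proof -
      have "u ^ n * cnj u ^ n = 1" by (metis uu power_mult_distrib power_one)
      then show ?thesis using u0 by (simp add: field_simps)
    qed
    also have "eval2 E (of_real x) u = (\<Sum>i\<le>2 * d. \<Sum>j\<le>2 * n. coeff (coeff E i) j * u ^ j * of_real x ^ i)"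
      unfolding eval2_altdef'[OF degE] by (simp add: poly_altdef'[OF dE] sum_distrib_right)
    also have "\<dots> = (\<Sum>j\<le>2 * n. poly (F j) (of_real x) * u ^ j)"
      by (subst sum.swap) (simp add: poly_altdef'[OF dF] cF sum_distrib_right sum_distrib_left mult_ac)
    finally show ?thesis by (simp add: sum_distrib_right mult.assoc)
  qed
  have "\<exists>C>0. \<forall>x::real. norm (poly (F j) (of_real x)) \<le> C * (1 + x\<^sup>2) ^ d" for j
    using poly_growth_bound[OF dF] by metis
  then obtain C where C: "\<And>j. C j > 0" "\<And>j x. norm (poly (F j) (of_real x)) \<le> C j * (1 + x\<^sup>2) ^ d"
    by metis
  define CC where "CC = (\<Sum>j\<le>2 * n. C j)"
  have CC: "CC \<ge> 0" unfolding CC_def by (intro sum_nonneg) (use C(1) less_imp_le in blast)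
  \<comment> \<open>With kernel length M > n + M0, undoing the damping changes p by at most c (1 +
    x^2)^d, which its positivity absorbs.\<close>
  obtain M0 :: nat where M0: "real M0 > real n * CC / c" using reals_Archimedean2 by blast
  define M where "M = n + M0 + 1"
  have M: "M > n" by (simp add: M_def)
  define R where "R = 2 * n + M + 1"
  define w where "w s = cis (2 * pi * real s / real R)" for s :: nat
  define \<mu> where "\<mu> j = M - (if j \<le> n then n - j else j - n)" for j
  have \<mu>: "M - n \<le> \<mu> j" "\<mu> j \<le> M" "\<mu> j > 0" if "j \<le> 2 * n" for j
    using that M by (auto simp: \<mu>_def)
  \<comment> \<open>The value at the sample point w_s of p with each frequency j divided by its
    Fejer factor; averaging against the kernel then returns p itself.\<close>
  define G where "G s = (\<Sum>j\<le>2 * n. smult (w s ^ j * cnj (w s) ^ n / of_nat (\<mu> j)) (F j))" for s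
  define q where "q s x = Re (poly (G s) (of_real x))" for s x
  have w1: "norm (w s) = 1" for s by (simp add: w_def)
  have q_nonneg: "0 \<le> q s x" for s x
  proof -
    have "poly (G s) (of_real x) * of_nat M - of_real (p x (w s)) =
        (\<Sum>j\<le>2 * n. poly (F j) (of_real x) * (w s ^ j * cnj (w s) ^ n) * of_real ((real M - real (\<mu> j)) / real (\<mu> j)))"
      unfolding p_eq[OF w1] G_def poly_sum sum_distrib_right sum_subtractf[symmetric]
    proof (intro sum.cong refl)
      fix j assume "j \<in> {..2 * n}"
      then have "\<mu> j > 0" using \<mu> by auto
      then show "poly (smult (w s ^ j * cnj (w s) ^ n / of_nat (\<mu> j)) (F j)) (of_real x) * of_nat M -
          poly (F j) (of_real x) * (w s ^ j * cnj (w s) ^ n) =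
          poly (F j) (of_real x) * (w s ^ j * cnj (w s) ^ n) * of_real ((real M - real (\<mu> j)) / real (\<mu> j))"
        by (simp add: field_simps)
    qed
    also have "norm \<dots> \<le> (\<Sum>j\<le>2 * n. C j * (1 + x\<^sup>2) ^ d * (real n / real (M - n)))"
    proof (rule order.trans[OF norm_sum], rule sum_mono)
      fix j assume "j \<in> {..2 * n}"
      then have j: "j \<le> 2 * n" by simp
      have "norm (poly (F j) (of_real x) * (w s ^ j * cnj (w s) ^ n) * of_real ((real M - real (\<mu> j)) / real (\<mu> j))) =
          norm (poly (F j) (of_real x)) * ((real M - real (\<mu> j)) / real (\<mu> j))"
        using \<mu>[OF j] by (simp add: norm_mult norm_power norm_divide w1 del: of_real_divide of_real_diff)
      also have "\<dots> \<le> (C j * (1 + x\<^sup>2) ^ d) * (real n / real (M - n))"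
      proof (intro mult_mono C(2) frac_le)
        show "real M - real (\<mu> j) \<le> real n" using \<mu>[OF j] by linarith
        show "real (M - n) \<le> real (\<mu> j)" using \<mu>[OF j] by linarith
        show "0 < real (M - n)" using M by simp
        show "0 \<le> C j * (1 + x\<^sup>2) ^ d" using C(1)[of j] by simp
        show "0 \<le> (real M - real (\<mu> j)) / real (\<mu> j)" using \<mu>[OF j] by simp
      qed simp
      finally show "norm (poly (F j) (of_real x) * (w s ^ j * cnj (w s) ^ n) * of_real ((real M - real (\<mu> j)) / real (\<mu> j)))
          \<le> C j * (1 + x\<^sup>2) ^ d * (real n / real (M - n))" .
    qed
    also have "\<dots> = (real n * CC / real (M - n)) * (1 + x\<^sup>2) ^ d"
      by (simp add: CC_def sum_distrib_left sum_distrib_right sum_divide_distrib mult_ac)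
    also have "\<dots> \<le> c * (1 + x\<^sup>2) ^ d"
    proof (intro mult_right_mono)
      have "real n * CC < c * real M0" using M0 c by (simp add: field_simps)
      then have "real n * CC \<le> c * real (M - n)" using c by (simp add: M_def algebra_simps)
      then show "real n * CC / real (M - n) \<le> c" using M by (simp add: divide_le_eq)
    qed simp
    also have "\<dots> \<le> p x (w s)" by (rule pos[OF w1])
    finally have "norm (poly (G s) (of_real x) * of_nat M - of_real (p x (w s))) \<le> p x (w s)" .
    then have "\<bar>Re (poly (G s) (of_real x) * of_nat M - of_real (p x (w s)))\<bar> \<le> p x (w s)"
      using abs_Re_le_cmod order.trans by blast
    then have "\<bar>q s x * real M - p x (w s)\<bar> \<le> p x (w s)" by (simp add: q_def)
    then have "0 \<le> q s x * real M" by linarith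
    then show ?thesis using M by (simp add: zero_le_mult_iff)
  qed
  have q_sos: "sos (\<lambda>x u. q s x)" for s
  proof -
    define H where "H = smult (1 / 2) (G s + map_poly cnj (G s))"
    have "poly H (of_real x) = of_real (q s x)" for x :: real
    proof -
      have "poly (map_poly cnj (G s)) (of_real x) = cnj (poly (G s) (of_real x))"
        using cnj.poly_map_hom[of "G s" "of_real x"] by simp
      then show ?thesis by (simp add: H_def q_def complex_add_cnj)
    qed
    note H = this
    then have "map_poly cnj H = H" by (intro real_valued_imp_cnj_invariant) simp
    then obtain f where f: "H = f * map_poly cnj f"
      using nonneg_real_poly_norm_square[of H] q_nonneg by (auto simp: H)
    have "(norm (poly f (of_real x)))\<^sup>2 = q s x" for x :: real
    proof -
      have "poly (map_poly cnj f) (of_real x) = cnj (poly f (of_real x))"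
        using cnj.poly_map_hom[of f "of_real x"] by simp
      then have "of_real (q s x) = complex_of_real ((norm (poly f (of_real x)))\<^sup>2)"
        unfolding H[symmetric] f complex_norm_square by simp
      then show ?thesis by (metis of_real_eq_iff)
    qed
    moreover have "laurent (degree f) (\<lambda>x u. poly f (of_real x))"
    proof -
      have "eval2 (map_poly (\<lambda>c. [:c:]) f) x u = poly f x" for x u
        by (induction f) (simp_all add: eval2_def map_poly_pCons)
      then show ?thesis using laurent_eval2[of "map_poly (\<lambda>c. [:c:]) f" "degree f"]
        by (simp add: degree_map_poly)
    qed
    ultimately show ?thesis using sos_norm_square by fastforce
  qed
  have k_laurent: "laurent 0 (\<lambda>x u. \<Sum>l<M. (u * cnj (w s)) ^ l)" for s
  proof (rule laurent_sum)
    fix l show "laurent 0 (\<lambda>x u. (u * cnj (w s)) ^ l)"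
      using laurent_poly[of "monom (cnj (w s) ^ l) l"] by (simp add: poly_monom power_mult_distrib mult.commute)
  qed
  have "sos (\<lambda>x u. \<Sum>s<R. 1 / real R * ((norm (\<Sum>l<M. (u * cnj (w s)) ^ l))\<^sup>2 * q s x))"
    by (intro sos_sum sos_cmult sos_mult_norm_square[OF k_laurent] q_sos) simp
  then show ?thesis
  proof (rule sos_cong)
    fix x and u :: complex assume u: "norm u = 1"
    have "(\<Sum>s<R. poly (G s) (of_real x) * of_real ((norm (\<Sum>l<M. (u * cnj (w s)) ^ l))\<^sup>2)) =
        (\<Sum>j\<le>2 * n. poly (F j) (of_real x) / of_nat (\<mu> j) *
          (\<Sum>s<R. w s ^ j * cnj (w s) ^ n * of_real ((norm (\<Sum>l<M. (u * cnj (w s)) ^ l))\<^sup>2)))"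
      unfolding G_def poly_sum sum_distrib_right sum_distrib_left
      by (subst sum.swap) (simp add: mult_ac)
    also have "\<dots> = (\<Sum>j\<le>2 * n. of_nat R * (poly (F j) (of_real x) * (u ^ j * cnj u ^ n)))"
    proof (intro sum.cong refl)
      fix j assume "j \<in> {..2 * n}"
      then have j: "j \<le> 2 * n" by simp
      have "(\<Sum>s<R. w s ^ j * cnj (w s) ^ n * of_real ((norm (\<Sum>l<M. (u * cnj (w s)) ^ l))\<^sup>2)) =
          of_nat R * of_nat (\<mu> j) * (u ^ j * cnj u ^ n)"
        unfolding w_def \<mu>_def by (rule fejer_reproduction[OF u R_def M j])
      then show "poly (F j) (of_real x) / of_nat (\<mu> j) *
          (\<Sum>s<R. w s ^ j * cnj (w s) ^ n * of_real ((norm (\<Sum>l<M. (u * cnj (w s)) ^ l))\<^sup>2)) =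
          of_nat R * (poly (F j) (of_real x) * (u ^ j * cnj u ^ n))"
        using \<mu>(3)[OF j] by simp
    qed
    also have "\<dots> = of_nat R * of_real (p x u)" by (simp add: p_eq[OF u] sum_distrib_left)
    finally have "Re (\<Sum>s<R. poly (G s) (of_real x) * of_real ((norm (\<Sum>l<M. (u * cnj (w s)) ^ l))\<^sup>2)) =
        Re (of_nat R * of_real (p x u))" by simp
    then have "(\<Sum>s<R. q s x * (norm (\<Sum>l<M. (u * cnj (w s)) ^ l))\<^sup>2) = real R * p x u"
      by (simp add: q_def)
    then show "(\<Sum>s<R. 1 / real R * ((norm (\<Sum>l<M. (u * cnj (w s)) ^ l))\<^sup>2 * q s x)) = p x u"
      by (simp add: sum_divide_distrib[symmetric] mult.commute R_def)
  qed
qed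


subsection \<open>Lower bounds away from finitely many points of the circle\<close>

lemma prime_dvd_smult_degree:
  fixes \<pi> F :: "complex poly poly"
  assumes "prime_elem \<pi>" "degree \<pi> > 0" "\<pi> dvd smult a F" "a \<noteq> 0"
  shows "\<pi> dvd F"
proof -
  have "\<pi> dvd [:a:] * F" using assms(3) by simp
  then have "\<pi> dvd [:a:] \<or> \<pi> dvd F" using assms(1) prime_elem_dvd_multD by blast
  moreover have "\<not> \<pi> dvd [:a:]"
    using dvd_imp_degree_le[of \<pi> "[:a:]"] assms(2,4) by auto
  ultimately show ?thesis by blast
qed

lemma exists_prime_factor_degree:
  fixes D :: "complex poly poly"
  assumes "degree D > 0"
  shows "\<exists>\<pi>. prime_elem \<pi> \<and> degree \<pi> > 0 \<and> \<pi> dvd D"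
proof -
  have "D \<noteq> 0" using assms by auto
  then show ?thesis using assms
  proof (induction D rule: prime_divisors_induct)
    case (factor p x)
    show ?case
    proof (cases "degree p > 0")
      case True
      then show ?thesis using factor.hyps by (intro exI[of _ p]) auto
    next
      case False
      then have "degree x > 0" using factor.prems by (simp add: degree_mult_eq)
      then obtain \<pi> where "prime_elem \<pi>" "degree \<pi> > 0" "\<pi> dvd x" using factor by auto
      then show ?thesis by (intro exI[of _ \<pi>]) auto
    qed
  next
    case (unit x)
    then show ?case by (auto simp: is_unit_poly_iff)
  qed auto
qed

text \<open>Take a nonzero element D of least x-degree in the ideal of F and G. By pseudo-division D
  divides a multiple, by a polynomial in u, of every element. A prime factor of D involving x hence
  divides F and G; if there is none, D is free of x.\<close>

lemma bezout_or_common_factor: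
  fixes F G :: "complex poly poly"
  assumes "F \<noteq> 0"
  shows "(\<exists>\<pi>. prime_elem \<pi> \<and> degree \<pi> > 0 \<and> \<pi> dvd F \<and> \<pi> dvd G) \<or>
    (\<exists>A B r. r \<noteq> 0 \<and> A * F + B * G = [:r:])"
proof -
  define I where "I = {A * F + B * G | A B. True}"
  have closed: "smult a x - y * q \<in> I" if "x \<in> I" "y \<in> I" for a x y q
  proof -
    from that obtain A B A' B' where "x = A * F + B * G" "y = A' * F + B' * G" unfolding I_def by blast
    then have "smult a x - y * q = (smult a A - A' * q) * F + (smult a B - B' * q) * G"
      by (simp add: algebra_simps smult_add_right)
    then show ?thesis unfolding I_def by blast
  qed
  have FG: "F \<in> I" "G \<in> I" unfolding I_def
    by (auto intro: exI[of _ 1] exI[of _ 0])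
  define Pr where "Pr D \<longleftrightarrow> D \<in> I \<and> D \<noteq> 0" for D
  have "Pr F" using FG assms by (simp add: Pr_def)
  then obtain D where D: "Pr D" "\<And>E. Pr E \<Longrightarrow> degree D \<le> degree E"
    using ex_has_least_nat[of Pr F degree] by blast
  have dvd: "\<exists>a. a \<noteq> 0 \<and> D dvd smult a H" if "H \<in> I" for H
  proof -
    obtain a q where aq: "a \<noteq> 0" "smult a H = D * q + pseudo_mod H D"
      "pseudo_mod H D = 0 \<or> degree (pseudo_mod H D) < degree D"
      using pseudo_mod[of D H] D(1) by (auto simp: Pr_def)
    have "pseudo_mod H D = smult a H - D * q" using aq(2) by simp
    then have "pseudo_mod H D \<in> I" using closed that D(1) by (simp add: Pr_def)
    then have "pseudo_mod H D = 0" using aq(3) D(2)[of "pseudo_mod H D"] unfolding Pr_def by linarith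
    then show ?thesis using aq by auto
  qed
  show ?thesis
  proof (cases "degree D > 0")
    case True
    then obtain \<pi> where \<pi>: "prime_elem \<pi>" "degree \<pi> > 0" "\<pi> dvd D"
      using exists_prime_factor_degree by blast
    have "\<pi> dvd H" if "H \<in> I" for H
      using dvd[OF that] prime_dvd_smult_degree[OF \<pi>(1,2)] \<pi>(3) dvd_trans by metis
    then show ?thesis using \<pi> FG by blast
  next
    case False
    then obtain r where "D = [:r:]" by (auto elim: degree_eq_zeroE)
    moreover obtain A B where "D = A * F + B * G" using D(1) by (auto simp: Pr_def I_def)
    ultimately show ?thesis using D(1) unfolding Pr_def by (metis pCons_0_0)
  qed
qed

text \<open>Each chord of the unit circle is divided by the diameter 2, so the product lies between
  0 and 1 there and higher powers are smaller.\<close>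

definition chord :: "complex set \<Rightarrow> complex \<Rightarrow> real" where
  "chord U u = (\<Prod>a\<in>U. norm (u - a) / 2)"

lemma chord_bounds:
  assumes "U \<subseteq> {z. norm z = 1}" "norm u = 1"
  shows "0 \<le> chord U u" "chord U u \<le> 1"
proof -
  have "norm (u - a) / 2 \<le> 1" if "a \<in> U" for a
    using norm_triangle_ineq4[of u a] assms that by auto
  then show "0 \<le> chord U u" "chord U u \<le> 1"
    unfolding chord_def by (auto intro!: prod_nonneg prod_le_1)
qed

text \<open>Peel off one root at a time. A root on the circle joins \<open>U\<close> and raises the
  exponent; a root off the circle stays at positive distance and only costs a constant.\<close>

lemma poly_lower_bound_circle:
  fixes q :: "complex poly"
  assumes "q \<noteq> 0"
  shows "\<exists>U m c. finite U \<and> U \<subseteq> {z. norm z = 1} \<and> c > 0 \<and>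
    (\<forall>u. norm u = 1 \<longrightarrow> c * chord U u ^ m \<le> norm (poly q u))"
  using assms
proof (induction "degree q" arbitrary: q)
  case 0
  then obtain a where a: "q = [:a:]" by (metis degree_eq_zeroE)
  then show ?case using 0
    by (intro exI[of _ "{}"] exI[of _ 0] exI[of _ "norm a"]) auto
next
  case (Suc n)
  then obtain z where "poly q z = 0" using alg_closed_imp_poly_has_root[of q] by auto
  then obtain r where r: "q = [:- z, 1:] * r" by (metis poly_eq_0_iff_dvd dvdE)
  then have r0: "r \<noteq> 0" using Suc.prems by auto
  have "degree q = degree [:- z, 1:] + degree r" unfolding r by (rule degree_mult_eq) (use r0 in auto)
  then have "n = degree r" using Suc.hyps(2) by simp
  from Suc.hyps(1)[OF this r0] obtain U m c where
    U: "finite U" "U \<subseteq> {z. norm z = 1}" "c > 0" "\<And>u. norm u = 1 \<Longrightarrow> c * chord U u ^ m \<le> norm (poly r u)"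
    by blast
  have q: "norm (poly q u) = norm (u - z) * norm (poly r u)" for u
    unfolding r by (simp add: norm_mult flip: left_diff_distrib)
  show ?case
  proof (cases "norm z = 1")
    case True
    define V where "V = insert z U"
    have V: "finite V" "V \<subseteq> {z. norm z = 1}" using U True by (auto simp: V_def)
    have "2 * c * chord V u ^ Suc m \<le> norm (poly q u)" if u: "norm u = 1" for u
    proof -
      have "norm (u - z) / 2 \<le> 1" using norm_triangle_ineq4[of u z] u True by auto
      have le1: "chord (V - {z}) u \<le> 1" "chord (V - {z}) u \<ge> 0"
        using chord_bounds[of "V - {z}" u] V u by auto
      have split: "chord V u = norm (u - z) / 2 * chord (V - {z}) u"
        unfolding chord_def using V by (intro prod.remove) (auto simp: V_def)
      then have a: "chord V u \<le> norm (u - z) / 2" using le1 by (simp add: mult_left_le)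
      have b: "chord V u \<le> chord U u"
      proof (cases "z \<in> U")
        case False
        then have "V - {z} = U" by (auto simp: V_def)
        then show ?thesis using split chord_bounds(1)[OF U(2) u] \<open>norm (u - z) / 2 \<le> 1\<close>
          using mult_right_mono[of "norm (u - z) / 2" 1 "chord U u"] by simp
      qed (simp add: V_def insert_absorb)
      have nn: "0 \<le> chord V u" using chord_bounds[OF V(2) u] by simp
      have "2 * c * chord V u ^ Suc m = (2 * chord V u) * (c * chord V u ^ m)" by simp
      also have "\<dots> \<le> norm (u - z) * (c * chord U u ^ m)"
        using a b nn U(3) by (intro mult_mono mult_left_mono power_mono) auto
      also have "\<dots> \<le> norm (u - z) * norm (poly r u)" using U(4)[OF u] by (intro mult_left_mono) auto
      finally show ?thesis by (simp add: q)
    qed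
    then show ?thesis using V U(3) by (intro exI[of _ V] exI[of _ "Suc m"] exI[of _ "2 * c"]) auto
  next
    case False
    define c' where "c' = \<bar>1 - norm z\<bar>"
    have "c' > 0" using False by (simp add: c'_def)
    have "c' * c * chord U u ^ m \<le> norm (poly q u)" if u: "norm u = 1" for u
    proof -
      have "c' \<le> norm (u - z)" unfolding c'_def using norm_triangle_ineq3[of u z] u by simp
      then have "c' * (c * chord U u ^ m) \<le> norm (u - z) * norm (poly r u)"
        using U(4)[OF u] \<open>c' > 0\<close> chord_bounds[OF U(2) u] U(3) by (intro mult_mono) auto
      then show ?thesis by (simp add: q mult.assoc)
    qed
    then show ?thesis using U \<open>c' > 0\<close> by (intro exI[of _ U] exI[of _ m] exI[of _ "c' * c"]) auto
  qed
qed


text \<open>For fixed u this makes real calculus in x available, with the x-derivative of F as the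
  derivative.\<close>

lemma real_specialization:
  assumes eq: "\<And>x. of_real (p x u) = eval2 F (of_real x) u / u ^ n"
  shows "\<exists>r :: real poly. (\<forall>x. poly r x = p x u) \<and>
    (\<forall>x. of_real (poly (pderiv r) x) = eval2 (pderiv F) (of_real x) u / u ^ n)"
proof -
  define P where "P = smult (1 / u ^ n) (map_poly (\<lambda>c. poly c u) F)"
  have P: "poly P (of_real x) = of_real (p x u)" for x
    by (simp add: P_def eq eval2_conv_poly)
  have "map_poly cnj P = P" by (rule real_valued_imp_cnj_invariant) (simp add: P)
  then have real: "of_real (Re (coeff P i)) = coeff P i" for i
    by (metis cnj.coeff_map_hom complex_is_Real_iff of_real_Re Reals_cnj_iff)
  define r where "r = map_poly Re P"
  have r_P: "map_poly of_real r = P"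
    by (rule poly_eqI) (simp add: r_def coeff_map_poly real)
  have ev: "poly (map_poly of_real s) (of_real x) = complex_of_real (poly s x)" for s x
    by (induction s) (simp_all add: map_poly_pCons)
  have "complex_of_real (poly r x) = of_real (p x u)" for x using ev[of r x] by (simp add: r_P P)
  moreover have "of_real (poly (pderiv r) x) = eval2 (pderiv F) (of_real x) u / u ^ n" for x
  proof -
    have "map_poly of_real (pderiv r) = pderiv P"
      unfolding r_P[symmetric] by (rule poly_eqI) (simp add: coeff_map_poly coeff_pderiv)
    moreover have "pderiv P = smult (1 / u ^ n) (map_poly (\<lambda>c. poly c u) (pderiv F))"
      by (rule poly_eqI) (simp add: P_def coeff_map_poly coeff_pderiv pderiv_smult poly_of_nat
        flip: of_nat_Suc)
    ultimately show ?thesis using ev[of "pderiv r" x] by (simp add: eval2_conv_poly)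
  qed
  ultimately show ?thesis by (intro exI[of _ r]) (metis of_real_eq_iff)
qed

lemma infinite_unit_circle: "infinite {u :: complex. norm u = 1}"
proof
  assume "finite {u :: complex. norm u = 1}"
  then have "finite (Re ` {u. norm u = 1})" by (rule finite_imageI)
  moreover have "{0..1} \<subseteq> Re ` {u. norm u = 1}"
  proof
    fix t :: real assume t: "t \<in> {0..1}"
    then have "t\<^sup>2 \<le> 1" by (simp add: power_le_one)
    then have "norm (Complex t (sqrt (1 - t\<^sup>2))) = 1" by (simp add: complex_norm)
    then show "t \<in> Re ` {u. norm u = 1}" by (intro image_eqI[of _ _ "Complex t (sqrt (1 - t\<^sup>2))"]) auto
  qed
  ultimately have "finite {0..1 :: real}" by (rule finite_subset[rotated])
  then show False using infinite_Icc[of 0 "1::real"] by simp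
qed

text \<open>For |x| beyond a radius X(u) the leading term dominates. Inside, a minimum at the
  boundary is covered by that estimate, and at an interior minimum A F = r bounds |F| by |r| / |A|.
  X(u) is inversely proportional to the leading coefficient at u, so all losses are powers of r(u)
  and that coefficient, which vanish at finitely many u.\<close>

theorem separable_lower_bound:
  assumes lp: "\<And>x u. norm u = 1 \<Longrightarrow> of_real (p x u) = eval2 F (of_real x) u / u ^ n"
    and nonneg: "\<And>x u. norm u = 1 \<Longrightarrow> 0 \<le> p x u"
    and bez: "A * F + B * pderiv F = [:r:]" "r \<noteq> 0" and F0: "F \<noteq> 0"
  shows "\<exists>d U m c. degree F = 2 * d \<and> finite U \<and> U \<subseteq> {z. norm z = 1} \<and> c > 0 \<and>
    (\<forall>x u. norm u = 1 \<longrightarrow> c * chord U u ^ m * (1 + x\<^sup>2) ^ d \<le> p x u)"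
proof -
  define D where "D = degree F"
  define a where "a = lead_coeff F"
  have a0: "a \<noteq> 0" using F0 by (simp add: a_def)
  have p_norm: "p x u = norm (eval2 F (of_real x) u)" if u: "norm u = 1" for x u
  proof -
    have "norm (complex_of_real (p x u)) = norm (eval2 F (of_real x) u)"
      unfolding lp[OF u] using u by (simp add: norm_divide norm_power)
    then show ?thesis using nonneg[OF u, of x] by simp
  qed
  have "\<exists>C>0. \<forall>u. norm u \<le> 1 \<longrightarrow> norm (poly (coeff F i) u) \<le> C" for i
    using poly_bounded_on_ball[of 1 "coeff F i"] by metis
  then obtain C where C: "\<And>i. C i > 0" "\<And>i u. norm u \<le> 1 \<Longrightarrow> norm (poly (coeff F i) u) \<le> C i"
    by metis
  define C1 where "C1 = (\<Sum>i\<le>D. C i)"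
  have C1: "C1 > 0" unfolding C1_def using C(1) by (intro sum_pos) auto
  define \<alpha> where "\<alpha> u = norm (poly a u)" for u
  have \<alpha>_le: "\<alpha> u \<le> C1" if "norm u = 1" for u
  proof -
    have "\<alpha> u \<le> C D" using C(2)[of u D] that by (simp add: \<alpha>_def a_def D_def)
    also have "\<dots> \<le> C1" unfolding C1_def by (rule member_le_sum) (use C(1) less_imp_le in auto)
    finally show ?thesis .
  qed
  have tail: "\<bar>x\<bar> * norm (eval2 F (of_real x) u - poly a u * of_real x ^ D) \<le> C1 * \<bar>x\<bar> ^ D"
    if u: "norm u = 1" and x: "\<bar>x\<bar> \<ge> 1" for x u
  proof -
    have "{..D} = insert D {..<D}" by auto
    then have "eval2 F (of_real x) u - poly a u * of_real x ^ D = (\<Sum>i<D. poly (coeff F i) u * of_real x ^ i)"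
      by (simp add: eval2_altdef D_def[symmetric] a_def)
    also have "norm \<dots> \<le> (\<Sum>i<D. C i * \<bar>x\<bar> ^ (D - 1))"
    proof (rule order.trans[OF norm_sum], rule sum_mono)
      fix i assume "i \<in> {..<D}"
      then have "\<bar>x\<bar> ^ i \<le> \<bar>x\<bar> ^ (D - 1)" using x by (intro power_increasing) auto
      then show "norm (poly (coeff F i) u * of_real x ^ i) \<le> C i * \<bar>x\<bar> ^ (D - 1)"
        using C(2)[of u i] u C(1)[of i] by (simp add: norm_mult norm_power mult_mono)
    qed
    finally have "\<bar>x\<bar> * norm (eval2 F (of_real x) u - poly a u * of_real x ^ D) \<le>
        \<bar>x\<bar> * (\<Sum>i<D. C i * \<bar>x\<bar> ^ (D - 1))" by (intro mult_left_mono) auto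
    also have "\<dots> = (\<Sum>i<D. C i * \<bar>x\<bar> ^ D)"
    proof (cases "D = 0")
      case False
      then have "\<bar>x\<bar> * \<bar>x\<bar> ^ (D - 1) = \<bar>x\<bar> ^ D" by (cases D) auto
      then show ?thesis by (simp add: sum_distrib_right[symmetric] mult.left_commute)
    qed simp
    also have "\<dots> \<le> C1 * \<bar>x\<bar> ^ D"
      unfolding C1_def sum_distrib_right
      by (rule sum_mono2) (auto intro!: mult_nonneg_nonneg less_imp_le[OF C(1)])
    finally show ?thesis .
  qed
  have outer: "\<alpha> u / 2 * \<bar>x\<bar> ^ D \<le> p x u"
    if u: "norm u = 1" and \<alpha>0: "\<alpha> u > 0" and x: "\<bar>x\<bar> \<ge> 2 * C1 / \<alpha> u" for x u
  proof -
    have "2 * C1 / \<alpha> u \<ge> 1" using \<alpha>_le[OF u] \<alpha>0 C1 by (simp add: le_divide_eq)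
    then have x1: "\<bar>x\<bar> \<ge> 1" using x by linarith
    have "C1 * 2 \<le> \<alpha> u * \<bar>x\<bar>" using x \<alpha>0 by (simp add: divide_le_eq mult.commute)
    then have "2 * C1 * \<bar>x\<bar> ^ D \<le> \<alpha> u * \<bar>x\<bar> * \<bar>x\<bar> ^ D" by (intro mult_right_mono) auto
    moreover have "\<bar>x\<bar> * (\<alpha> u * \<bar>x\<bar> ^ D) \<le> \<bar>x\<bar> * (p x u + norm (eval2 F (of_real x) u - poly a u * of_real x ^ D))"
    proof (intro mult_left_mono)
      have "norm (poly a u * of_real x ^ D) \<le> norm (eval2 F (of_real x) u) + norm (eval2 F (of_real x) u - poly a u * of_real x ^ D)"
        using norm_triangle_ineq4[of "eval2 F (of_real x) u" "eval2 F (of_real x) u - poly a u * of_real x ^ D"] by simp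
      then show "\<alpha> u * \<bar>x\<bar> ^ D \<le> p x u + norm (eval2 F (of_real x) u - poly a u * of_real x ^ D)"
        by (simp add: p_norm[OF u] \<alpha>_def norm_mult norm_power)
    qed simp
    ultimately have "\<bar>x\<bar> * (\<alpha> u * \<bar>x\<bar> ^ D) \<le> \<bar>x\<bar> * p x u + (\<bar>x\<bar> * (\<alpha> u * \<bar>x\<bar> ^ D)) / 2"
      using tail[OF u x1] by (simp add: distrib_left mult_ac)
    then have "\<bar>x\<bar> * (\<alpha> u / 2 * \<bar>x\<bar> ^ D) \<le> \<bar>x\<bar> * p x u" by (simp add: algebra_simps)
    then show ?thesis by (rule mult_left_le_imp_le) (use x1 in linarith)
  qed
  \<comment> \<open>For odd D the leading terms cancel in F(x) + F(-x), although p(x) and p(-x) each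
    exceed half the leading term for large x.\<close>
  have "even D"
  proof (rule ccontr)
    assume odd: "odd D"
    from infinite_unit_circle obtain u where u: "norm u = 1" "poly a u \<noteq> 0"
      using finite_subset[OF _ poly_roots_finite[OF a0], of "{u. norm u = 1}"] by blast
    then have \<alpha>0: "\<alpha> u > 0" by (simp add: \<alpha>_def)
    define x where "x = 2 * C1 / \<alpha> u + 2 * C1 / \<alpha> u"
    have x1: "2 * C1 / \<alpha> u \<ge> 1" using \<alpha>_le[OF u(1)] \<alpha>0 C1 by (simp add: le_divide_eq)
    have "x \<ge> 2 * C1 / \<alpha> u" using x1 unfolding x_def by linarith
    then have x: "x \<ge> 1" "\<bar>x\<bar> \<ge> 2 * C1 / \<alpha> u" "x > 0" using x1 by linarith+
    define e1 where "e1 = eval2 F (of_real x) u - poly a u * of_real x ^ D"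
    define e2 where "e2 = eval2 F (of_real (- x)) u - poly a u * of_real (- x) ^ D"
    have "eval2 F (of_real x) u + eval2 F (of_real (- x)) u = e1 + e2"
      using odd by (simp add: e1_def e2_def power_minus_odd)
    then have "complex_of_real (p x u + p (- x) u) = (e1 + e2) / u ^ n"
      using lp[OF u(1), of x] lp[OF u(1), of "- x"] by (simp add: add_divide_distrib[symmetric])
    then have "norm (complex_of_real (p x u + p (- x) u)) = norm (e1 + e2)"
      using u by (simp add: norm_divide norm_power del: of_real_add)
    then have "\<bar>p x u + p (- x) u\<bar> = norm (e1 + e2)" by (metis norm_of_real)
    then have "p x u + p (- x) u \<le> norm e1 + norm e2" using norm_triangle_ineq[of e1 e2] by linarith
    then have "x * (p x u + p (- x) u) \<le> x * norm e1 + x * norm e2"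
      using x by (simp add: distrib_left[symmetric])
    also have "\<dots> \<le> 2 * C1 * x ^ D"
      using tail[OF u(1), of x] tail[OF u(1), of "- x"] x unfolding e1_def e2_def by simp
    finally have 1: "x * (p x u + p (- x) u) \<le> 2 * C1 * x ^ D" .
    have "\<alpha> u / 2 * x ^ D + \<alpha> u / 2 * x ^ D \<le> p x u + p (- x) u"
      using outer[OF u(1) \<alpha>0, of x] outer[OF u(1) \<alpha>0, of "- x"] x by simp
    then have "x * (\<alpha> u * x ^ D) \<le> x * (p x u + p (- x) u)" using x by (intro mult_left_mono) auto
    with 1 have "(x * \<alpha> u) * x ^ D \<le> (2 * C1) * x ^ D" by (simp add: mult_ac)
    then have "x * \<alpha> u \<le> 2 * C1" using x by (simp add: mult_le_cancel_right)
    moreover have "x * \<alpha> u = 4 * C1" using \<alpha>0 by (simp add: x_def)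
    ultimately show False using C1 by simp
  qed
  then obtain d where d: "D = 2 * d" by (elim evenE)
  define k where "k = degree A"
  have "laurent (2 * k) (\<lambda>x u. eval2 A (of_real x) u)" by (rule laurent_eval2) (simp add: k_def)
  then obtain C2 where C2: "C2 > 0" "\<And>x u. norm u = 1 \<Longrightarrow> norm (eval2 A (of_real x) u) \<le> C2 * (1 + x\<^sup>2) ^ k"
    using laurent_bound by blast
  define \<rho> where "\<rho> u = norm (poly r u)" for u
  obtain C4 where C4: "C4 > 0" "\<And>u. norm u \<le> 1 \<Longrightarrow> \<rho> u \<le> C4"
    using poly_bounded_on_ball[of 1 r] unfolding \<rho>_def by auto
  define C3 where "C3 = 5 * C1\<^sup>2"
  have C3: "C3 > 0" using C1 by (simp add: C3_def)
  \<comment> \<open>c1 collects the losses at an interior minimum, c2 those in the region where the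
    leading term dominates.\<close>
  define c1 where "c1 = 1 / (C2 * C3 ^ (k + d) * C1)"
  define c2 where "c2 = 1 / (2 ^ Suc d * C3 ^ d * C1 ^ (2 * k) * C4)"
  define c where "c = min c1 c2"
  have c: "c > 0" "c \<le> c1" "c \<le> c2" using C1 C2 C3 C4 by (auto simp: c_def c1_def c2_def)
  \<comment> \<open>The power 2(k + d) of the leading coefficient compensates (1 + X^2)^(k + d); the
    remaining one pays for the factor in front of |x|^D.\<close>
  define N where "N = 2 * (k + d) + 1"
  have main: "c * (\<rho> u * \<alpha> u ^ N) * (1 + x\<^sup>2) ^ d \<le> p x u" if u: "norm u = 1" for x u
  proof (cases "\<rho> u = 0 \<or> \<alpha> u = 0")
    case True
    then show ?thesis using nonneg[OF u, of x] by (auto simp: N_def)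
  next
    case False
    then have pos: "\<rho> u > 0" "\<alpha> u > 0" by (auto simp: \<rho>_def \<alpha>_def)
    define X where "X = 2 * C1 / \<alpha> u"
    have X1: "X \<ge> 1" using \<alpha>_le[OF u] pos C1 by (simp add: X_def le_divide_eq)
    have X2: "\<alpha> u ^ 2 * (1 + X\<^sup>2) \<le> C3"
    proof -
      have "\<alpha> u ^ 2 \<le> C1 ^ 2" using \<alpha>_le[OF u] pos by (intro power_mono) auto
      moreover have "\<alpha> u ^ 2 * X\<^sup>2 = 4 * C1\<^sup>2" using pos by (simp add: X_def power_divide power_mult_distrib)
      ultimately show ?thesis by (simp add: C3_def distrib_left)
    qed
    have X2': "\<alpha> u ^ (2 * i) * (1 + X\<^sup>2) ^ i \<le> C3 ^ i" for i
      using power_mono[OF X2, of i] by (simp add: power_mult power_mult_distrib)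
    have c2_bound: "c * (\<rho> u * \<alpha> u ^ N) * (1 + X\<^sup>2) ^ d \<le> \<alpha> u / 2 ^ Suc d"
    proof -
      have "c * (\<rho> u * \<alpha> u ^ N) * (1 + X\<^sup>2) ^ d \<le> c2 * (\<rho> u * \<alpha> u ^ N) * (1 + X\<^sup>2) ^ d"
        using c pos by (intro mult_right_mono) auto
      also have "\<dots> = c2 * \<rho> u * \<alpha> u ^ (2 * k) * (\<alpha> u ^ (2 * d) * (1 + X\<^sup>2) ^ d) * \<alpha> u"
        by (simp add: N_def power_add distrib_left)
      also have "\<dots> \<le> c2 * C4 * C1 ^ (2 * k) * C3 ^ d * \<alpha> u"
        using X2'[of d] C4(2)[of u] u \<alpha>_le[OF u] pos c C1 C3 C4
        by (intro mult_mono mult_right_mono power_mono mult_nonneg_nonneg) auto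
      also have "\<dots> = \<alpha> u / 2 ^ Suc d" using C1 C3 C4 by (simp add: c2_def)
      finally show ?thesis .
    qed
    have far: "c * (\<rho> u * \<alpha> u ^ N) * (1 + x\<^sup>2) ^ d \<le> p x u" if x: "\<bar>x\<bar> \<ge> X" for x
    proof -
      have "c * (\<rho> u * \<alpha> u ^ N) \<le> c * (\<rho> u * \<alpha> u ^ N) * (1 + X\<^sup>2) ^ d"
        using mult_left_mono[OF one_le_power[of "1 + X\<^sup>2" d], of "c * (\<rho> u * \<alpha> u ^ N)"] c pos by simp
      also note c2_bound
      finally have "c * (\<rho> u * \<alpha> u ^ N) * (1 + x\<^sup>2) ^ d \<le> \<alpha> u / 2 ^ Suc d * (1 + x\<^sup>2) ^ d"
        by (intro mult_right_mono) auto
      also have "\<dots> \<le> \<alpha> u / 2 ^ Suc d * (2 ^ d * \<bar>x\<bar> ^ D)"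
      proof (intro mult_left_mono)
        have "1 \<le> \<bar>x\<bar>" using x X1 by linarith
        then have "1\<^sup>2 \<le> \<bar>x\<bar>\<^sup>2" by (intro power_mono) auto
        then have "1 \<le> x\<^sup>2" by simp
        then have "(1 + x\<^sup>2) ^ d \<le> (2 * x\<^sup>2) ^ d" by (intro power_mono) auto
        then show "(1 + x\<^sup>2) ^ d \<le> 2 ^ d * \<bar>x\<bar> ^ D" by (simp add: d power_mult power_mult_distrib)
      qed (use pos in auto)
      also have "\<dots> = \<alpha> u / 2 * \<bar>x\<bar> ^ D" by simp
      also have "\<dots> \<le> p x u" using outer[OF u pos(2), of x] x by (simp add: X_def)
      finally show ?thesis .
    qed
    show ?thesis
    proof (cases "\<bar>x\<bar> \<ge> X")
      case False
      obtain R :: "real poly" where R: "\<And>x. poly R x = p x u"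
        "\<And>x. of_real (poly (pderiv R) x) = eval2 (pderiv F) (of_real x) u / u ^ n"
        using real_specialization[of p u F n] lp[OF u] by blast
      have "\<exists>x0\<in>{- X..X}. \<forall>y\<in>{- X..X}. poly R x0 \<le> poly R y"
        by (rule continuous_attains_inf) (use X1 in \<open>auto intro!: continuous_at_imp_continuous_on\<close>)
      then obtain x0 where x0': "x0 \<in> {- X..X}" "\<forall>y\<in>{- X..X}. p x0 u \<le> p y u"
        unfolding R by blast
      have x0: "\<bar>x0\<bar> \<le> X" "\<And>y. \<bar>y\<bar> \<le> X \<Longrightarrow> p x0 u \<le> p y u"
        using x0' by (simp_all add: abs_le_iff)
      have x_le: "(1 + x\<^sup>2) ^ d \<le> (1 + X\<^sup>2) ^ d"
      proof (rule power_mono)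
        have "\<bar>x\<bar>\<^sup>2 \<le> X\<^sup>2" using False by (intro power_mono) auto
        then show "1 + x\<^sup>2 \<le> 1 + X\<^sup>2" by simp
      qed simp
      have "c * (\<rho> u * \<alpha> u ^ N) * (1 + X\<^sup>2) ^ d \<le> p x0 u"
      proof (cases "\<bar>x0\<bar> = X")
        case True
        then show ?thesis using far[of x0] by (metis order_refl power2_abs)
      next
        case False
        \<comment> \<open>An interior minimum is critical, so only the term with A remains of the
          Bezout identity.\<close>
        have "poly (pderiv R) x0 = 0"
        proof (rule DERIV_local_min[of "poly R" _ x0 "X - \<bar>x0\<bar>"])
          show "(poly R has_real_derivative poly (pderiv R) x0) (at x0)" by (rule poly_DERIV)
          show "X - \<bar>x0\<bar> > 0" using False x0(1) by simp
          show "\<forall>y. \<bar>x0 - y\<bar> < X - \<bar>x0\<bar> \<longrightarrow> poly R x0 \<le> poly R y"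
            unfolding R by (intro allI impI x0(2)) linarith
        qed
        then have "eval2 (pderiv F) (of_real x0) u = 0"
          using R(2)[of x0] u by (auto simp: power_eq_0_iff)
        then have "poly r u = eval2 A (of_real x0) u * eval2 F (of_real x0) u"
          using arg_cong[OF bez(1), of "\<lambda>G. eval2 G (of_real x0) u"] by simp
        then have "\<rho> u = norm (eval2 A (of_real x0) u) * p x0 u"
          by (simp add: \<rho>_def norm_mult p_norm[OF u])
        also have "\<dots> \<le> C2 * (1 + X\<^sup>2) ^ k * p x0 u"
        proof (intro mult_right_mono nonneg u)
          have "\<bar>x0\<bar>\<^sup>2 \<le> X\<^sup>2" using x0(1) by (intro power_mono) auto
          then have "C2 * (1 + x0\<^sup>2) ^ k \<le> C2 * (1 + X\<^sup>2) ^ k"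
            using C2(1) by (intro mult_left_mono power_mono) auto
          then show "norm (eval2 A (of_real x0) u) \<le> C2 * (1 + X\<^sup>2) ^ k"
            using C2(2)[OF u, of x0] by linarith
        qed
        finally have rho: "\<rho> u \<le> C2 * (1 + X\<^sup>2) ^ k * p x0 u" .
        have "c * (\<rho> u * \<alpha> u ^ N) * (1 + X\<^sup>2) ^ d \<le> c1 * (\<rho> u * \<alpha> u ^ N) * (1 + X\<^sup>2) ^ d"
          using c pos by (intro mult_right_mono) auto
        also have "\<dots> \<le> c1 * ((C2 * (1 + X\<^sup>2) ^ k * p x0 u) * \<alpha> u ^ N) * (1 + X\<^sup>2) ^ d"
          using c pos rho by (intro mult_right_mono mult_left_mono) auto
        also have "\<dots> = c1 * C2 * p x0 u * (\<alpha> u ^ (2 * (k + d)) * (1 + X\<^sup>2) ^ (k + d)) * \<alpha> u"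
          by (simp add: N_def power_add)
        also have "\<dots> \<le> c1 * C2 * p x0 u * C3 ^ (k + d) * C1"
          using X2'[of "k + d"] \<alpha>_le[OF u] pos c C2 C3 nonneg[OF u, of x0]
          by (intro mult_mono mult_left_mono mult_nonneg_nonneg) auto
        also have "\<dots> = p x0 u" using C1 C2 C3 by (simp add: c1_def)
        finally show ?thesis .
      qed
      moreover have "c * (\<rho> u * \<alpha> u ^ N) * (1 + x\<^sup>2) ^ d \<le> c * (\<rho> u * \<alpha> u ^ N) * (1 + X\<^sup>2) ^ d"
        using x_le c pos by (intro mult_left_mono) auto
      moreover have "p x0 u \<le> p x u" using x0(2)[of x] False by simp
      ultimately show ?thesis by linarith
    qed (rule far)
  qed
  obtain U m c' where U: "finite U" "U \<subseteq> {z. norm z = 1}" "c' > 0"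
    "\<And>u. norm u = 1 \<Longrightarrow> c' * chord U u ^ m \<le> norm (poly (r * a ^ N) u)"
    using poly_lower_bound_circle[of "r * a ^ N"] bez(2) a0 by auto
  have "(c * c') * chord U u ^ m * (1 + x\<^sup>2) ^ d \<le> p x u" if u: "norm u = 1" for x u
  proof -
    have "c * (c' * chord U u ^ m) * (1 + x\<^sup>2) ^ d \<le> c * (\<rho> u * \<alpha> u ^ N) * (1 + x\<^sup>2) ^ d"
      using U(4)[OF u] c by (intro mult_right_mono mult_left_mono)
        (auto simp: \<rho>_def \<alpha>_def norm_mult norm_power poly_power)
    then show ?thesis using main[OF u, of x] by (simp add: mult.assoc)
  qed
  then show ?thesis using d U c unfolding D_def
    by (intro exI[of _ d] exI[of _ U] exI[of _ m] exI[of _ "c * c'"]) auto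
qed


lemma poly_eq_0_on_infinite:
  fixes q :: "complex poly"
  assumes "infinite X" "\<And>x. x \<in> X \<Longrightarrow> poly q x = 0"
  shows "q = 0"
  using assms poly_roots_finite[of q] by (metis (mono_tags, lifting) finite_subset mem_Collect_eq subsetI)

lemma eval2_eq_0_on_infinite:
  assumes "infinite X" "infinite T" "\<And>x t. x \<in> X \<Longrightarrow> t \<in> T \<Longrightarrow> eval2 G x t = 0"
  shows "G = 0"
proof (rule poly_eqI)
  fix i
  have "coeff G i = 0"
  proof (rule poly_eq_0_on_infinite[OF assms(2)])
    fix t assume t: "t \<in> T"
    have "map_poly (\<lambda>c. poly c t) G = 0"
      by (rule poly_eq_0_on_infinite[OF assms(1)]) (use assms(3) t in \<open>simp add: eval2_conv_poly\<close>)
    then have "coeff (map_poly (\<lambda>c. poly c t) G) i = 0" by simp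
    then show "poly (coeff G i) t = 0" by (simp add: coeff_map_poly)
  qed
  then show "coeff G i = coeff 0 i" by simp
qed

lemma infinite_range_complex_of_real: "infinite (range complex_of_real)"
proof
  assume "finite (range complex_of_real)"
  then have "finite (UNIV :: real set)" by (rule finite_imageD) (simp add: inj_on_def)
  then show False using infinite_UNIV_char_0 by blast
qed

lemma eval2_real_imp_cnj2:
  assumes "\<And>x t :: real. eval2 P (of_real x) (of_real t) \<in> \<real>"
  shows "cnj2 P = P"
proof -
  have "cnj2 P - P = 0"
    by (rule eval2_eq_0_on_infinite[OF infinite_range_complex_of_real infinite_range_complex_of_real])
      (use assms in \<open>auto simp: eval2_cnj2_real Reals_cnj_iff\<close>)
  then show ?thesis by simp
qed

subsection \<open>Approximation near a point of the circle\<close>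

text \<open>A rational parameter of the circle near a, with t = 0 at a. It makes u, and so p,
  rational in a real variable.\<close>

definition cayley :: "complex \<Rightarrow> real \<Rightarrow> complex" where
  "cayley a t = a * (1 + \<i> * of_real t) / (1 - \<i> * of_real t)"

lemma cayley_nonzero: "1 - \<i> * of_real t \<noteq> 0" "1 + \<i> * of_real t \<noteq> 0"
  by (auto simp: complex_eq_iff)

lemma cayley_norm_factor: "(1 + \<i> * of_real t) * (1 - \<i> * of_real t) = 1 + (of_real t)\<^sup>2"
  by (simp add: algebra_simps power2_eq_square)

lemma norm_cayley_factor: "(norm (1 - \<i> * of_real t))\<^sup>2 = 1 + t\<^sup>2" "(norm (1 + \<i> * of_real t))\<^sup>2 = 1 + t\<^sup>2"
  by (simp_all add: cmod_power2)

lemma norm_cayley: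
  assumes "norm a = 1" shows "norm (cayley a t) = 1"
proof -
  have "norm (1 - \<i> * of_real t) = norm (1 + \<i> * of_real t)"
    using norm_cayley_factor[of t] by (metis norm_ge_zero power2_eq_iff_nonneg)
  then show ?thesis using assms cayley_nonzero[of t] by (simp add: cayley_def norm_mult norm_divide)
qed

lemma cayley_dist:
  assumes "norm a = 1" "\<bar>t\<bar> \<le> 1"
  shows "\<bar>t\<bar> \<le> norm (cayley a t - a)" "norm (cayley a t - a) \<le> 2 * \<bar>t\<bar>"
proof -
  have "cayley a t - a = a * (2 * \<i> * of_real t) / (1 - \<i> * of_real t)"
    using cayley_nonzero[of t] by (simp add: cayley_def field_simps)
  then have n: "norm (cayley a t - a) = 2 * \<bar>t\<bar> / norm (1 - \<i> * of_real t)"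
    using assms by (simp add: norm_divide norm_mult)
  have "1 \<le> (norm (1 - \<i> * of_real t))\<^sup>2" by (simp add: norm_cayley_factor)
  then have 1: "1 \<le> norm (1 - \<i> * of_real t)" using power2_le_imp_le[of 1 "norm (1 - \<i> * of_real t)"] by simp
  have "t\<^sup>2 \<le> 1" using assms(2) by (simp add: abs_square_le_1)
  then have "(norm (1 - \<i> * of_real t))\<^sup>2 \<le> 2\<^sup>2" by (simp add: norm_cayley_factor)
  then have 2: "norm (1 - \<i> * of_real t) \<le> 2" by (rule power2_le_imp_le) simp
  show "\<bar>t\<bar> \<le> norm (cayley a t - a)"
  proof -
    have "\<bar>t\<bar> * norm (1 - \<i> * of_real t) \<le> \<bar>t\<bar> * 2" using 2 by (intro mult_left_mono) auto
    then show ?thesis unfolding n using 1 by (simp add: le_divide_eq mult.commute)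
  qed
  show "norm (cayley a t - a) \<le> 2 * \<bar>t\<bar>"
  proof -
    have "2 * \<bar>t\<bar> * 1 \<le> 2 * \<bar>t\<bar> * norm (1 - \<i> * of_real t)" using 1 by (intro mult_left_mono) auto
    then show ?thesis unfolding n using 1 by (simp add: divide_le_eq)
  qed
qed

lemma cayley_surj:
  assumes "norm a = 1" "norm u = 1" "norm (u - a) < 1"
  shows "\<exists>t. \<bar>t\<bar> \<le> 1 \<and> u = cayley a t"
proof -
  define v where "v = u / a"
  have a0: "a \<noteq> 0" using assms by auto
  have nv: "norm v = 1" using assms by (simp add: v_def norm_divide)
  have "norm (v - 1) = norm (u - a)" using a0 assms(1) by (simp add: v_def divide_simps norm_divide)
  then have "\<bar>Re (v - 1)\<bar> < 1" using abs_Re_le_cmod[of "v - 1"] assms(3) by linarith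
  then have re: "Re v > 0" by simp
  define t where "t = Im v / (1 + Re v)"
  have "\<bar>Im v\<bar> \<le> 1" using abs_Im_le_cmod[of v] nv by simp
  then have "\<bar>t\<bar> \<le> 1" using re by (simp add: t_def abs_divide divide_le_eq)
  moreover have "v * (1 - \<i> * of_real t) = 1 + \<i> * of_real t"
  proof -
    have sq: "(Re v)\<^sup>2 + (Im v)\<^sup>2 = 1" using nv by (metis cmod_power2 one_power2)
    have "Im v * t = (Im v)\<^sup>2 / (1 + Re v)" by (simp add: t_def power2_eq_square)
    also have "(Im v)\<^sup>2 = (1 - Re v) * (1 + Re v)" using sq by (simp add: algebra_simps power2_eq_square)
    finally have 1: "Im v * t = 1 - Re v" using re by simp
    have "t * (1 + Re v) = Im v" using re by (simp add: t_def)
    then have 2: "Im v - Re v * t = t" by (simp add: algebra_simps)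
    show ?thesis using 1 2 by (simp add: complex_eq_iff)
  qed
  then have "u = cayley a t"
    using cayley_nonzero[of t] a0 by (simp add: cayley_def v_def field_simps)
  ultimately show ?thesis by blast
qed

text \<open>The denominators are powers of 1 + i t and 1 - i t, whose product is 1 + t^2. For large
  k the factor (1 + t^2)^k clears them.\<close>

lemma cayley_transform:
  assumes a: "norm a = 1" and lp: "laurent m g"
  shows "\<exists>k0. \<forall>k\<ge>k0. \<exists>P. degree P \<le> m \<and>
    (\<forall>x t. eval2 P (of_real x) (of_real t) = (1 + (of_real t)\<^sup>2) ^ k * g x (cayley a t))"
proof -
  obtain E n where E: "degree E \<le> m" "\<And>x u. norm u = 1 \<Longrightarrow> g x u = eval2 E (of_real x) u / u ^ n"
    using lp unfolding laurent_def by auto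
  define J where "J = (\<Sum>i\<le>m. degree (coeff E i))"
  have J: "degree (coeff E i) \<le> J" if "i \<le> m" for i
    unfolding J_def by (rule member_le_sum) (use that in auto)
  have a0: "a \<noteq> 0" using a by auto
  show ?thesis
  proof (intro exI[of _ "J + n"] allI impI)
    fix k assume k: "k \<ge> J + n"
    define q where "q i = (\<Sum>j\<le>J. smult (coeff (coeff E i) j * a ^ j / a ^ n)
      ([:1, \<i>:] ^ (k + j - n) * [:1, - \<i>:] ^ (k + n - j)))" for i
    define P where "P = (\<Sum>i\<le>m. monom (q i) i)"
    show "\<exists>P. degree P \<le> m \<and>
      (\<forall>x t. eval2 P (of_real x) (of_real t) = (1 + (of_real t)\<^sup>2) ^ k * g x (cayley a t))"
    proof (intro exI[of _ P] conjI allI)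
      show "degree P \<le> m" unfolding P_def by (intro degree_sum_le) (auto intro: order.trans[OF degree_monom_le])
      fix x t :: real
      define \<alpha> where "\<alpha> = 1 + \<i> * of_real t"
      define \<gamma> where "\<gamma> = 1 - \<i> * of_real t"
      have nz: "\<alpha> \<noteq> 0" "\<gamma> \<noteq> 0" using cayley_nonzero[of t] by (auto simp: \<alpha>_def \<gamma>_def)
      define u where "u = cayley a t"
      have u: "u = a * \<alpha> / \<gamma>" by (simp add: u_def cayley_def \<alpha>_def \<gamma>_def)
      have monomial: "a ^ j / a ^ n * (\<alpha> ^ (k + j - n) * \<gamma> ^ (k + n - j)) = (\<alpha> * \<gamma>) ^ k * (u ^ j / u ^ n)"
        if "j \<le> J" for j
      proof -
        have "\<alpha> ^ (k + j - n) * \<alpha> ^ n = \<alpha> ^ k * \<alpha> ^ j" using k by (simp flip: power_add)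
        then have 1: "\<alpha> ^ (k + j - n) = \<alpha> ^ k * \<alpha> ^ j / \<alpha> ^ n" using nz by (simp add: eq_divide_eq)
        have "\<gamma> ^ (k + n - j) * \<gamma> ^ j = \<gamma> ^ k * \<gamma> ^ n" using k that by (simp flip: power_add)
        then have 2: "\<gamma> ^ (k + n - j) = \<gamma> ^ k * \<gamma> ^ n / \<gamma> ^ j" using nz by (simp add: eq_divide_eq)
        show ?thesis unfolding 1 2 u using nz a0 by (simp add: power_divide power_mult_distrib field_simps)
      qed
      have "poly (q i) (of_real t) = (\<alpha> * \<gamma>) ^ k * (poly (coeff E i) u / u ^ n)" if "i \<le> m" for i
      proof -
        have "poly (q i) (of_real t) = (\<Sum>j\<le>J. coeff (coeff E i) j * (a ^ j / a ^ n * (\<alpha> ^ (k + j - n) * \<gamma> ^ (k + n - j))))"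
          by (simp add: q_def poly_sum poly_power \<alpha>_def \<gamma>_def mult.commute[of "of_real t"] mult.assoc)
        also have "\<dots> = (\<Sum>j\<le>J. coeff (coeff E i) j * ((\<alpha> * \<gamma>) ^ k * (u ^ j / u ^ n)))"
          by (intro sum.cong refl) (simp only: monomial atMost_iff)
        also have "\<dots> = (\<alpha> * \<gamma>) ^ k * (poly (coeff E i) u / u ^ n)"
          by (simp add: poly_altdef'[OF J[OF that]] sum_distrib_left sum_divide_distrib mult_ac)
        finally show ?thesis .
      qed
      then have "eval2 P (of_real x) (of_real t) = (\<alpha> * \<gamma>) ^ k * (eval2 E (of_real x) u / u ^ n)"
        by (simp add: P_def eval2_sum eval2_altdef'[OF E(1)] sum_distrib_left sum_divide_distrib mult_ac)
      also have "\<dots> = (1 + (of_real t)\<^sup>2) ^ k * g x (cayley a t)"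
        using E(2)[OF norm_cayley[OF a], of x t] by (simp add: \<alpha>_def \<gamma>_def cayley_norm_factor u_def)
      finally show "eval2 P (of_real x) (of_real t) = (1 + (of_real t)\<^sup>2) ^ k * g x (cayley a t)" .
    qed
  qed
qed

text \<open>With u the Cayley image, t / (1 - i t) = (u - a) / (2 i a) and 1 / (1 - i t) = (u + a) /
  (2 a). So dividing by (1 - i t)^k makes every monomial in t of degree at most k a polynomial in
  u.\<close>

lemma cayley_transform_back:
  assumes a: "norm a = 1" and f: "\<And>i. degree (coeff f i) \<le> k"
  shows "\<exists>F. degree F \<le> degree f \<and>
    (\<forall>x t. eval2 F (of_real x) (cayley a t) = eval2 f (of_real x) (of_real t) / (1 - \<i> * of_real t) ^ k)"
proof -
  have a0: "a \<noteq> 0" using a by auto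
  define q where "q i = (\<Sum>j\<le>k. smult (coeff (coeff f i) j)
    ([:- 1 / (2 * \<i>), 1 / (2 * \<i> * a):] ^ j * [:1 / 2, 1 / (2 * a):] ^ (k - j)))" for i
  define F where "F = (\<Sum>i\<le>degree f. monom (q i) i)"
  show ?thesis
  proof (intro exI[of _ F] conjI allI)
    show "degree F \<le> degree f" unfolding F_def by (intro degree_sum_le) (auto intro: order.trans[OF degree_monom_le])
    fix x t :: real
    define \<gamma> where "\<gamma> = 1 - \<i> * of_real t"
    have nz: "\<gamma> \<noteq> 0" using cayley_nonzero[of t] by (auto simp: \<gamma>_def)
    define u where "u = cayley a t"
    have u\<gamma>: "u * \<gamma> = a * (1 + \<i> * of_real t)" using nz by (simp add: u_def cayley_def \<gamma>_def)
    have 1: "poly [:- 1 / (2 * \<i>), 1 / (2 * \<i> * a):] u = of_real t / \<gamma>"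
    proof -
      have "(u - a) * \<gamma> = 2 * \<i> * a * of_real t" using u\<gamma> by (simp add: algebra_simps \<gamma>_def)
      then have "u - a = 2 * \<i> * a * of_real t / \<gamma>" using nz by (simp add: eq_divide_eq)
      moreover have "poly [:- 1 / (2 * \<i>), 1 / (2 * \<i> * a):] u = (u - a) / (2 * \<i> * a)"
        using a0 by (simp add: field_simps)
      ultimately show ?thesis using a0 by simp
    qed
    have 2: "poly [:1 / 2, 1 / (2 * a):] u = 1 / \<gamma>"
    proof -
      have "(u + a) * \<gamma> = 2 * a" using u\<gamma> by (simp add: algebra_simps \<gamma>_def)
      then have "u + a = 2 * a / \<gamma>" using nz by (simp add: eq_divide_eq)
      moreover have "poly [:1 / 2, 1 / (2 * a):] u = (u + a) / (2 * a)"
        using a0 by (simp add: field_simps)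
      ultimately show ?thesis using a0 by simp
    qed
    have "poly (q i) u = poly (coeff f i) (of_real t) / \<gamma> ^ k" for i
    proof -
      have "poly (q i) u = (\<Sum>j\<le>k. coeff (coeff f i) j * ((of_real t / \<gamma>) ^ j * (1 / \<gamma>) ^ (k - j)))"
        unfolding q_def poly_sum poly_smult poly_mult poly_power 1 2 ..
      also have "\<dots> = (\<Sum>j\<le>k. coeff (coeff f i) j * of_real t ^ j / \<gamma> ^ k)"
      proof (intro sum.cong refl)
        fix j assume "j \<in> {..k}"
        then have "\<gamma> ^ k = \<gamma> ^ j * \<gamma> ^ (k - j)" by (simp flip: power_add)
        then show "coeff (coeff f i) j * ((of_real t / \<gamma>) ^ j * (1 / \<gamma>) ^ (k - j)) = coeff (coeff f i) j * of_real t ^ j / \<gamma> ^ k"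
          by (simp add: power_divide)
      qed
      finally show ?thesis by (simp add: poly_altdef'[OF f] sum_divide_distrib)
    qed
    then show "eval2 F (of_real x) (cayley a t) = eval2 f (of_real x) (of_real t) / (1 - \<i> * of_real t) ^ k"
      by (simp add: F_def eval2_sum eval2_altdef[of f] sum_divide_distrib u_def \<gamma>_def mult_ac)
  qed
qed

text \<open>Approximate (1 + t^2)^k p by a squared modulus in the Cayley parameter and transform
  back. Since |1 - i t|^2 = 1 + t^2, the factor disappears exactly.\<close>

theorem local_norm_approximation:
  assumes a: "norm a = 1" and lp: "laurent (2 * d) (\<lambda>x u. of_real (p x u))"
    and c: "c > 0" "\<delta> > 0"
    and pos: "\<And>x u. norm u = 1 \<Longrightarrow> norm (u - a) < \<delta> \<Longrightarrow> c * norm (u - a) ^ m \<le> p x u"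
  shows "\<exists>F. degree F \<le> d \<and> (\<forall>x. \<exists>C>0. \<forall>u. norm u = 1 \<longrightarrow> norm (u - a) < 1 \<longrightarrow>
    \<bar>p x u - (norm (eval2 F (of_real x) u))\<^sup>2\<bar> \<le> C * norm (u - a) ^ N)"
proof -
  \<comment> \<open>The truncated factor has t-degree up to N, and the transform back needs k to be
    at least that degree.\<close>
  obtain k where k: "k \<ge> N" "\<exists>P. degree P \<le> 2 * d \<and>
    (\<forall>x t. eval2 P (of_real x) (of_real t) = (1 + (of_real t)\<^sup>2) ^ k * of_real (p x (cayley a t)))"
    using cayley_transform[OF a lp] by (meson le_cases order.trans)
  then obtain P where P: "degree P \<le> 2 * d"
    "\<And>x t. eval2 P (of_real x) (of_real t) = of_real ((1 + t\<^sup>2) ^ k * p x (cayley a t))"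
    by auto
  have "\<exists>f. 2 * degree f \<le> degree P \<and> (\<forall>i. degree (coeff f i) \<le> N) \<and>
    (\<forall>x. monom 1 N dvd poly (P - f * cnj2 f) [:x:])"
  \<comment> \<open>The Cayley map at most doubles distances for |t| up to 1, hence the radius
    \<delta> / 2.\<close>
  proof (rule positive_imp_norm_truncated[of P c "min 1 (\<delta> / 2)" m N])
    show "cnj2 P = P" by (rule eval2_real_imp_cnj2) (simp only: P Reals_of_real)
    fix x t :: real assume t: "\<bar>t\<bar> < min 1 (\<delta> / 2)"
    note dist = cayley_dist[OF a, of t]
    have "c * \<bar>t\<bar> ^ m \<le> c * norm (cayley a t - a) ^ m"
      using dist t c by (intro mult_left_mono power_mono) auto
    also have "\<dots> \<le> p x (cayley a t)"
      by (rule pos[OF norm_cayley[OF a]]) (use dist t in auto)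
    also have "\<dots> \<le> (1 + t\<^sup>2) ^ k * p x (cayley a t)"
    proof -
      have "0 \<le> c * norm (cayley a t - a) ^ m" using c by simp
      also note \<open>c * norm (cayley a t - a) ^ m \<le> p x (cayley a t)\<close>
      finally show ?thesis using mult_right_mono[OF one_le_power[of "1 + t\<^sup>2" k]] by simp
    qed
    finally show "c * \<bar>t\<bar> ^ m \<le> Re (eval2 P (of_real x) (of_real t))" by (simp only: P Re_complex_of_real)
  qed (use c in auto)
  then obtain f where f: "2 * degree f \<le> degree P" "\<And>i. degree (coeff f i) \<le> N"
    "\<And>x. monom 1 N dvd poly (P - f * cnj2 f) [:x:]" by blast
  obtain F where F: "degree F \<le> degree f"
    "\<And>x t. eval2 F (of_real x) (cayley a t) = eval2 f (of_real x) (of_real t) / (1 - \<i> * of_real t) ^ k"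
    using cayley_transform_back[OF a, of f k] f(2) k(1) order.trans by blast
  show ?thesis
  proof (intro exI[of _ F] conjI allI)
    show "degree F \<le> d" using F(1) f(1) P(1) by linarith
    fix x :: real
    obtain h where h: "poly (P - f * cnj2 f) [:of_real x:] = monom 1 N * h" using f(3)[of "of_real x"] by (elim dvdE)
    obtain C where C: "C > 0" "\<And>t. norm t \<le> 1 \<Longrightarrow> norm (poly h t) \<le> C"
      using poly_bounded_on_ball[of 1 h] by auto
    have "\<bar>p x u - (norm (eval2 F (of_real x) u))\<^sup>2\<bar> \<le> C * norm (u - a) ^ N"
      if u: "norm u = 1" "norm (u - a) < 1" for u
    proof -
      obtain t where t: "\<bar>t\<bar> \<le> 1" "u = cayley a t" using cayley_surj[OF a u] by blast
      define s where "s = (1 + t\<^sup>2) ^ k"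
      have s: "s \<ge> 1" by (simp add: s_def one_le_power)
      have "(norm (eval2 F (of_real x) u))\<^sup>2 = (norm (eval2 f (of_real x) (of_real t)))\<^sup>2 / s"
        unfolding t(2) F(2) s_def norm_cayley_factor(1)[symmetric]
        by (simp add: norm_divide norm_power power_divide power_mult[symmetric] mult.commute)
      then have "of_real (s * (p x u - (norm (eval2 F (of_real x) u))\<^sup>2)) =
          eval2 (P - f * cnj2 f) (of_real x) (of_real t)"
        using s by (simp add: P t(2) eval2_cnj2_real s_def[symmetric] right_diff_distrib
          flip: complex_norm_square)
      also have "\<dots> = of_real t ^ N * poly h (of_real t)" unfolding eval2_def h by (simp add: poly_monom)
      finally have "norm (complex_of_real (s * (p x u - (norm (eval2 F (of_real x) u))\<^sup>2))) = \<bar>t\<bar> ^ N * norm (poly h (of_real t))"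
        by (simp add: norm_mult norm_power)
      then have "s * \<bar>p x u - (norm (eval2 F (of_real x) u))\<^sup>2\<bar> = \<bar>t\<bar> ^ N * norm (poly h (of_real t))"
        using s by (simp only: norm_of_real abs_mult)
      also have "\<dots> \<le> norm (u - a) ^ N * C"
        using C cayley_dist[OF a t(1)] t by (intro mult_mono power_mono) auto
      finally have "s * \<bar>p x u - (norm (eval2 F (of_real x) u))\<^sup>2\<bar> \<le> C * norm (u - a) ^ N" by (simp add: mult.commute)
      moreover have "\<bar>p x u - (norm (eval2 F (of_real x) u))\<^sup>2\<bar> \<le> s * \<bar>p x u - (norm (eval2 F (of_real x) u))\<^sup>2\<bar>"
        using mult_right_mono[OF s, of "\<bar>p x u - (norm (eval2 F (of_real x) u))\<^sup>2\<bar>"] by simp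
      ultimately show ?thesis by (rule order.trans[rotated])
    qed
    then show "\<exists>C>0. \<forall>u. norm u = 1 \<longrightarrow> norm (u - a) < 1 \<longrightarrow>
      \<bar>p x u - (norm (eval2 F (of_real x) u))\<^sup>2\<bar> \<le> C * norm (u - a) ^ N" using C(1) by blast
  qed
qed


subsection \<open>Gluing the local approximations\<close>

lemma coprime_linear_powers:
  assumes "a \<noteq> b"
  shows "coprime ([:- a, 1:] ^ m) ([:- b, 1 :: complex:] ^ n)"
proof -
  have "coprime [:- a, 1:] [:- b, 1 :: complex:]"
  proof (rule coprimeI)
    fix c assume "c dvd [:- a, 1:]" "c dvd [:- b, 1 :: complex:]"
    then have "c dvd [:- a, 1:] - [:- b, 1:]" by (rule dvd_diff)
    then have "c dvd [:b - a:]" by simp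
    moreover have "is_unit [:b - a:]" using assms by (simp add: is_unit_const_poly_iff dvd_field_iff)
    ultimately show "is_unit c" by (rule dvd_unit_imp_unit)
  qed
  then show ?thesis by simp
qed

lemma coprime_prod_linear_powers:
  assumes "finite U" "b \<notin> U"
  shows "coprime (\<Prod>a\<in>U. [:- a, 1:] ^ m) ([:- b, 1 :: complex:] ^ n)"
  by (rule prod_coprime_left, rule coprime_linear_powers) (use assms in auto)

lemma poly_poly_chinese_remainder:
  fixes f :: "complex \<Rightarrow> complex poly poly"
  assumes "finite U" "\<And>a. a \<in> U \<Longrightarrow> degree (f a) \<le> d"
  shows "\<exists>F. degree F \<le> d \<and> (\<forall>a\<in>U. [:[:- a, 1:] ^ N:] dvd F - f a)"
  using assms
proof (induction U rule: finite_induct)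
  case empty
  show ?case by (intro exI[of _ 0]) simp
next
  case (insert b U)
  then obtain F where F: "degree F \<le> d" "\<And>a. a \<in> U \<Longrightarrow> [:[:- a, 1:] ^ N:] dvd F - f a" by auto
  define H where "H = (\<Prod>a\<in>U. [:- a, 1 :: complex:] ^ N)"
  define L where "L = [:- b, 1 :: complex:] ^ N"
  have "coprime H L" unfolding H_def L_def
    using insert.hyps by (rule coprime_prod_linear_powers)
  then obtain r s where rs: "r * H + s * L = 1"
    using bezout_coefficients_fst_snd[of H L] by (metis coprime_imp_gcd_eq_1)
  \<comment> \<open>r H is 0 modulo the powers handled so far and 1 modulo the new one.\<close>
  define F' where "F' = F + smult (r * H) (f b - F)"
  have "degree F' \<le> d" unfolding F'_def
    using F(1) insert.prems by (intro degree_add_le order.trans[OF degree_smult_le] degree_diff_le) auto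
  moreover have "[:[:- a, 1:] ^ N:] dvd F' - f a" if "a \<in> insert b U" for a
  proof (cases "a = b")
    case True
    have "F' - f b = smult (1 - r * H) (F - f b)"
      by (simp add: F'_def smult_diff_left smult_diff_right algebra_simps)
    also have "1 - r * H = s * L" using rs by (simp add: algebra_simps)
    finally have "F' - f b = [:L:] * smult s (F - f b)" by (simp add: mult.commute)
    then show ?thesis using True unfolding L_def by (metis dvd_triv_left)
  next
    case False
    then have a: "a \<in> U" using that by simp
    have "[:- a, 1:] ^ N dvd r * H" unfolding H_def using a insert.hyps by (intro dvd_mult dvd_prodI) auto
    then obtain q where "r * H = [:- a, 1:] ^ N * q" by (elim dvdE)
    then have "F' - f a = (F - f a) + [:[:- a, 1:] ^ N:] * smult q (f b - F)"
      by (simp add: F'_def mult.commute)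
    then show ?thesis using F(2)[OF a] by (metis dvd_add dvd_triv_left)
  qed
  ultimately show ?case by blast
qed

text \<open>Continuity along an arc of the circle ending at a; the bound is available only on the
  circle.\<close>

lemma unit_circle_vanishing:
  fixes a :: complex
  assumes a: "norm a = 1" and C: "C > 0" "\<delta> > 0"
    and bound: "\<And>u. norm u = 1 \<Longrightarrow> u \<noteq> a \<Longrightarrow> norm (u - a) < \<delta> \<Longrightarrow> norm (poly q u) \<le> C * norm (u - a)"
  shows "poly q a = 0"
proof -
  define \<gamma> where "\<gamma> s = a * cis s" for s :: real
  have cis: "cis s = of_real (cos s) + \<i> * of_real (sin s)" for s by (simp add: complex_eq_iff)
  have \<gamma>: "isCont \<gamma> 0" unfolding \<gamma>_def cis by (intro continuous_intros)
  have \<gamma>0: "\<gamma> 0 = a" by (simp add: \<gamma>_def)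
  have \<gamma>lim: "(\<gamma> \<longlongrightarrow> a) (at_right 0)"
    using \<gamma> \<gamma>0 unfolding isCont_def by (metis tendsto_mono at_le subset_UNIV)
  have "(poly q \<longlongrightarrow> poly q a) (nhds a)"
  proof -
    have "isCont (poly q) a" by (rule poly_isCont)
    then show ?thesis by (simp add: isCont_def tendsto_at_iff_tendsto_nhds)
  qed
  then have qlim: "((\<lambda>s. poly q (\<gamma> s)) \<longlongrightarrow> poly q a) (at_right 0)"
    using \<gamma>lim by (rule filterlim_compose)
  have dlim: "((\<lambda>s. norm (\<gamma> s - a)) \<longlongrightarrow> 0) (at_right 0)"
    using tendsto_norm_zero[OF LIM_zero[OF \<gamma>lim]] .
  have near: "\<forall>\<^sub>F s in at_right 0. norm (\<gamma> s - a) < \<delta>"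
    using order_tendstoD(2)[OF dlim] C(2) by blast
  have ne: "\<forall>\<^sub>F s in at_right 0. \<gamma> s \<noteq> a"
    unfolding eventually_at_right_field
  proof (intro exI[of _ pi] conjI allI impI)
    fix s :: real assume s: "0 < s" "s < pi"
    then have "sin s > 0" by (rule sin_gt_zero)
    then have "cis s \<noteq> 1" by (auto simp: complex_eq_iff)
    then show "\<gamma> s \<noteq> a" using a by (auto simp: \<gamma>_def)
  qed simp
  have "((\<lambda>s. poly q (\<gamma> s)) \<longlongrightarrow> 0) (at_right 0)"
  proof (rule tendsto_0_le[OF dlim])
    show "\<forall>\<^sub>F s in at_right 0. norm (poly q (\<gamma> s)) \<le> norm (norm (\<gamma> s - a)) * C"
      using near ne
    proof eventually_elim
      case (elim s)
      then have "norm (poly q (\<gamma> s)) \<le> C * norm (\<gamma> s - a)"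
        by (intro bound) (simp_all add: \<gamma>_def norm_mult a)
      then show ?case by (simp add: mult.commute)
    qed
  qed
  then show ?thesis using tendsto_unique[OF _ qlim] by auto
qed

text \<open>Factors u - a are split off one at a time: while fewer than N are removed, the quotient
  still tends to 0 at a for every real x, so all its coefficients vanish there.\<close>

lemma bound_imp_dvd:
  assumes a: "norm a = 1"
    and bound: "\<And>x. \<exists>C>0. \<exists>\<delta>>0. \<forall>u. norm u = 1 \<longrightarrow> norm (u - a) < \<delta> \<longrightarrow>
      norm (eval2 E (of_real x) u) \<le> C * norm (u - a) ^ N"
  shows "[:[:- a, 1:] ^ N:] dvd E"
proof -
  have "n \<le> N \<Longrightarrow> [:[:- a, 1:] ^ n:] dvd E" for n
  proof (induction n)
    case (Suc n)
    then obtain E' where E': "E = [:[:- a, 1:] ^ n:] * E'" by (auto elim: dvdE)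
    have ev: "eval2 E x u = (u - a) ^ n * eval2 E' x u" for x u
      unfolding E' by (simp only: eval2_simps poly_power) (simp add: algebra_simps)
    have zero: "eval2 E' (of_real x) a = 0" for x :: real
    proof -
      obtain C \<delta> where C: "C > 0" "\<delta> > 0"
        "\<And>u. norm u = 1 \<Longrightarrow> norm (u - a) < \<delta> \<Longrightarrow> norm (eval2 E (of_real x) u) \<le> C * norm (u - a) ^ N"
        using bound[of x] by blast
      have "poly (poly E' [:of_real x:]) a = 0"
      proof (rule unit_circle_vanishing[OF a C(1), of "min \<delta> 1"])
        fix u assume u: "norm u = 1" "u \<noteq> a" "norm (u - a) < min \<delta> 1"
        have "norm (u - a) ^ n * norm (eval2 E' (of_real x) u) \<le> C * norm (u - a) ^ N"
          using C(3)[OF u(1)] u(3) by (simp add: ev norm_mult norm_power)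
        also have "\<dots> \<le> C * norm (u - a) ^ Suc n"
          using Suc.prems u(3) C(1) by (intro mult_left_mono power_decreasing) auto
        also have "\<dots> = norm (u - a) ^ n * (C * norm (u - a))" by simp
        finally show "norm (poly (poly E' [:of_real x:]) u) \<le> C * norm (u - a)"
          using u(2) by (simp add: eval2_def mult_le_cancel_left)
      qed (use C in simp)
      then show ?thesis by (simp add: eval2_def)
    qed
    have "map_poly (\<lambda>c. poly c a) E' = 0"
      by (rule poly_eq_0_on_infinite[OF infinite_range_complex_of_real])
        (use zero in \<open>auto simp: eval2_conv_poly\<close>)
    then have "poly (coeff E' i) a = 0" for i
      by (metis coeff_map_poly coeff_0 poly_0)
    then have "[:[:- a, 1:]:] dvd E'" by (simp add: const_poly_dvd_iff poly_eq_0_iff_dvd)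
    then have "[:[:- a, 1:] ^ n:] * [:[:- a, 1:]:] dvd E" unfolding E' by (rule mult_dvd_mono[OF dvd_refl])
    then show ?case by (simp add: mult.commute)
  qed (simp flip: one_pCons)
  then show ?thesis by blast
qed

lemma prod_linear_powers_dvd:
  fixes E :: "complex poly poly"
  assumes "finite U" "\<And>a. a \<in> U \<Longrightarrow> [:[:- a, 1:] ^ N:] dvd E"
  shows "[:\<Prod>a\<in>U. [:- a, 1:] ^ N:] dvd E"
  unfolding const_poly_dvd_iff
proof
  fix i
  show "(\<Prod>a\<in>U. [:- a, 1:] ^ N) dvd coeff E i"
    using assms
  proof (induction U rule: finite_induct)
    case (insert b U)
    have "[:- b, 1:] ^ N * (\<Prod>a\<in>U. [:- a, 1:] ^ N) dvd coeff E i"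
    proof (rule divides_mult)
      show "[:- b, 1:] ^ N dvd coeff E i"
        using insert.prems[of b] by (simp add: const_poly_dvd_iff)
      show "(\<Prod>a\<in>U. [:- a, 1:] ^ N) dvd coeff E i" using insert by blast
      show "coprime ([:- b, 1:] ^ N) (\<Prod>a\<in>U. [:- a, 1:] ^ N)"
        using coprime_prod_linear_powers[OF insert.hyps(1,2), of N N] by (simp add: coprime_commute)
    qed
    then show ?case using insert.hyps by simp
  qed simp
qed

lemma chord_lower_bound_near:
  assumes U: "finite U" "a \<in> U"
  shows "\<exists>c>0. \<exists>\<delta>>0. \<forall>u. norm (u - a) < \<delta> \<longrightarrow> c * norm (u - a) \<le> chord U u"
proof -
  define q where "q = (\<Prod>b\<in>U - {a}. [:- b / 2, 1 / 2:])"
  have q: "chord U u = norm (u - a) / 2 * norm (poly q u)" for u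
  proof -
    have "chord U u = norm (u - a) / 2 * (\<Prod>b\<in>U - {a}. norm (u - b) / 2)"
      unfolding chord_def by (rule prod.remove) (use U in auto)
    also have "(\<Prod>b\<in>U - {a}. norm (u - b) / 2) = (\<Prod>b\<in>U - {a}. norm (poly [:- b / 2, 1 / 2:] u))"
    proof (intro prod.cong refl)
      fix b
      have "poly [:- b / 2, 1 / 2:] u = (u - b) / 2" by (simp add: field_simps)
      then show "norm (u - b) / 2 = norm (poly [:- b / 2, 1 / 2:] u)" by (simp only: norm_divide) simp
    qed
    finally show ?thesis by (simp add: q_def poly_prod prod_norm)
  qed
  have qa: "poly q a \<noteq> 0"
    using U by (auto simp: q_def poly_prod field_simps)
  have "poly q \<midarrow>a\<rightarrow> poly q a" using isCont_def poly_isCont by blast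
  then obtain \<delta> where \<delta>: "\<delta> > 0"
    "\<And>u. u \<noteq> a \<Longrightarrow> norm (u - a) < \<delta> \<Longrightarrow> norm (poly q u - poly q a) < norm (poly q a) / 2"
    using LIM_D[of "poly q" "poly q a" a "norm (poly q a) / 2"] qa by auto
  have "norm (poly q a) / 4 * norm (u - a) \<le> chord U u" if u: "norm (u - a) < \<delta>" for u
  proof -
    have "norm (poly q a) / 2 \<le> norm (poly q u)"
    proof (cases "u = a")
      case False
      then show ?thesis using \<delta>(2)[OF False u] norm_triangle_ineq2[of "poly q a" "poly q u"]
        by (simp add: norm_minus_commute)
    qed simp
    then have "norm (u - a) / 2 * (norm (poly q a) / 2) \<le> norm (u - a) / 2 * norm (poly q u)"
      by (intro mult_left_mono) auto
    then show "norm (poly q a) / 4 * norm (u - a) \<le> chord U u" by (simp add: q mult.commute)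
  qed
  moreover have "norm (poly q a) / 4 > 0" using qa by simp
  ultimately show ?thesis using \<delta>(1) by blast
qed

lemma diff_norm_squares_bound:
  fixes z w :: complex
  shows "\<bar>(norm z)\<^sup>2 - (norm w)\<^sup>2\<bar> \<le> norm (z - w) * (norm z + norm w)"
proof -
  have "(norm z)\<^sup>2 - (norm w)\<^sup>2 = (norm z - norm w) * (norm z + norm w)"
    by (simp add: power2_eq_square algebra_simps)
  moreover have "\<bar>norm z + norm w\<bar> = norm z + norm w" by simp
  ultimately show ?thesis
    using mult_right_mono[OF norm_triangle_ineq3[of z w], of "norm z + norm w"] by (simp only: abs_mult)
qed

text \<open>F is congruent to each local f modulo (u - a)^N, so the replacement alters the squared
  modulus only to order N. The error is a Laurent polynomial of order N at each a, hence divisible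
  by the product.\<close>

lemma simultaneous_norm_approximation:
  assumes U: "finite U" "U \<subseteq> {z. norm z = 1}"
    and lp: "laurent (2 * d) (\<lambda>x u. of_real (p x u))" and c: "c > 0"
    and pos: "\<And>x u. norm u = 1 \<Longrightarrow> c * chord U u ^ m \<le> p x u"
  shows "\<exists>F E n. degree F \<le> d \<and> degree E \<le> 2 * d \<and> (\<forall>x u. norm u = 1 \<longrightarrow>
    of_real (p x u - (norm (eval2 F (of_real x) u))\<^sup>2) = (\<Prod>a\<in>U. (u - a) ^ N) * eval2 E (of_real x) u / u ^ n)"
proof -
  have "\<exists>F. degree F \<le> d \<and> (\<forall>x. \<exists>C>0. \<forall>u. norm u = 1 \<longrightarrow> norm (u - a) < 1 \<longrightarrow>
    \<bar>p x u - (norm (eval2 F (of_real x) u))\<^sup>2\<bar> \<le> C * norm (u - a) ^ N)" if a: "a \<in> U" for a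
  proof -
    obtain c' \<delta> where c': "c' > 0" "\<delta> > 0" "\<And>u. norm (u - a) < \<delta> \<Longrightarrow> c' * norm (u - a) \<le> chord U u"
      using chord_lower_bound_near[OF U(1) a] by blast
    show ?thesis
    proof (rule local_norm_approximation[OF _ lp, of a "c * c' ^ m" \<delta> m N])
      fix x u assume u: "norm u = 1" "norm (u - a) < \<delta>"
      have "(c' * norm (u - a)) ^ m \<le> chord U u ^ m"
        using c'(3)[OF u(2)] c'(1) by (intro power_mono) auto
      then have "c * (c' * norm (u - a)) ^ m \<le> c * chord U u ^ m" using c by (intro mult_left_mono) auto
      then show "c * c' ^ m * norm (u - a) ^ m \<le> p x u"
        using pos[OF u(1), of x] by (simp add: power_mult_distrib mult.assoc)
    qed (use U a c c' in auto)
  qed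
  then obtain f where f: "\<And>a. a \<in> U \<Longrightarrow> degree (f a) \<le> d"
    "\<And>a x. a \<in> U \<Longrightarrow> \<exists>C>0. \<forall>u. norm u = 1 \<longrightarrow> norm (u - a) < 1 \<longrightarrow>
      \<bar>p x u - (norm (eval2 (f a) (of_real x) u))\<^sup>2\<bar> \<le> C * norm (u - a) ^ N"
    by metis
  obtain F where F: "degree F \<le> d" "\<And>a. a \<in> U \<Longrightarrow> [:[:- a, 1:] ^ N:] dvd F - f a"
    using poly_poly_chinese_remainder[OF U(1), of f d N] f(1) by blast
  have "laurent (2 * d) (\<lambda>x u. of_real ((norm (eval2 F (of_real x) u))\<^sup>2))"
    by (intro laurent_norm_square laurent_eval2 F)
  then have "laurent (2 * d) (\<lambda>x u. of_real (p x u - (norm (eval2 F (of_real x) u))\<^sup>2))"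
    unfolding of_real_diff by (intro laurent_diff lp)
  then obtain E n where E: "degree E \<le> 2 * d" "\<And>x u. norm u = 1 \<Longrightarrow>
      of_real (p x u - (norm (eval2 F (of_real x) u))\<^sup>2) = eval2 E (of_real x) u / u ^ n"
    unfolding laurent_def by auto
  have "[:[:- a, 1:] ^ N:] dvd E" if a: "a \<in> U" for a
  proof (rule bound_imp_dvd)
    show "norm a = 1" using U a by auto
    fix x :: real
    obtain C where C: "C > 0" "\<And>u. norm u = 1 \<Longrightarrow> norm (u - a) < 1 \<Longrightarrow>
      \<bar>p x u - (norm (eval2 (f a) (of_real x) u))\<^sup>2\<bar> \<le> C * norm (u - a) ^ N"
      using f(2)[OF a, of x] by blast
    obtain G where G: "F - f a = [:[:- a, 1:] ^ N:] * G" using F(2)[OF a] by (elim dvdE)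
    have FG: "eval2 F y u - eval2 (f a) y u = (u - a) ^ N * eval2 G y u" for y u
    proof -
      have "eval2 (F - f a) y u = (u - a) ^ N * eval2 G y u"
        unfolding G by (simp only: eval2_simps poly_power) (simp add: algebra_simps)
      then show ?thesis by simp
    qed
    obtain B1 where B1: "B1 > 0" "\<And>u. norm u \<le> 1 \<Longrightarrow> norm (poly (poly F [:of_real x:]) u) \<le> B1"
      using poly_bounded_on_ball by metis
    obtain B2 where B2: "B2 > 0" "\<And>u. norm u \<le> 1 \<Longrightarrow> norm (poly (poly (f a) [:of_real x:]) u) \<le> B2"
      using poly_bounded_on_ball by metis
    obtain B3 where B3: "B3 > 0" "\<And>u. norm u \<le> 1 \<Longrightarrow> norm (poly (poly G [:of_real x:]) u) \<le> B3"
      using poly_bounded_on_ball by metis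
    show "\<exists>C>0. \<exists>\<delta>>0. \<forall>u. norm u = 1 \<longrightarrow> norm (u - a) < \<delta> \<longrightarrow>
      norm (eval2 E (of_real x) u) \<le> C * norm (u - a) ^ N"
    proof (rule exI[of _ "C + B3 * (B1 + B2)"], intro conjI exI[of _ 1] allI impI)
      fix u assume u: "norm u = 1" "norm (u - a) < 1"
      have "norm (eval2 E (of_real x) u) = norm (complex_of_real (p x u - (norm (eval2 F (of_real x) u))\<^sup>2))"
        using u by (simp add: E(2) norm_divide norm_power del: of_real_diff)
      also have "\<dots> = \<bar>p x u - (norm (eval2 F (of_real x) u))\<^sup>2\<bar>" by (rule norm_of_real)
      also have "\<dots> \<le> \<bar>p x u - (norm (eval2 (f a) (of_real x) u))\<^sup>2\<bar> +
          \<bar>(norm (eval2 F (of_real x) u))\<^sup>2 - (norm (eval2 (f a) (of_real x) u))\<^sup>2\<bar>" by linarith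
      also have "\<bar>(norm (eval2 F (of_real x) u))\<^sup>2 - (norm (eval2 (f a) (of_real x) u))\<^sup>2\<bar> \<le>
          (norm (u - a) ^ N * B3) * (B1 + B2)"
      proof (rule order.trans[OF diff_norm_squares_bound])
        have "norm (eval2 F (of_real x) u) \<le> B1" "norm (eval2 (f a) (of_real x) u) \<le> B2"
          "norm (eval2 G (of_real x) u) \<le> B3"
          using B1 B2 B3 u by (simp_all add: eval2_def)
        then show "norm (eval2 F (of_real x) u - eval2 (f a) (of_real x) u) *
            (norm (eval2 F (of_real x) u) + norm (eval2 (f a) (of_real x) u)) \<le> (norm (u - a) ^ N * B3) * (B1 + B2)"
          unfolding FG norm_mult norm_power using B1 B2 B3
          by (intro mult_mono mult_left_mono add_mono mult_nonneg_nonneg add_nonneg_nonneg) auto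
      qed
      also have "\<bar>p x u - (norm (eval2 (f a) (of_real x) u))\<^sup>2\<bar> \<le> C * norm (u - a) ^ N" by (rule C(2)[OF u])
      finally show "norm (eval2 E (of_real x) u) \<le> (C + B3 * (B1 + B2)) * norm (u - a) ^ N"
        by (simp add: algebra_simps)
    qed (use C(1) B1(1) B2(1) B3(1) in \<open>auto intro!: add_pos_pos mult_pos_pos\<close>)
  qed
  then obtain E' where E': "E = [:\<Prod>a\<in>U. [:- a, 1:] ^ N:] * E'"
    using prod_linear_powers_dvd[OF U(1)] by (meson dvdE)
  have P0: "(\<Prod>a\<in>U. [:- a, 1 :: complex:] ^ N) \<noteq> 0" using U by simp
  have ev: "eval2 E x u = (\<Prod>a\<in>U. (u - a) ^ N) * eval2 E' x u" for x u
    unfolding E' by (simp only: eval2_simps poly_prod poly_power) (simp add: algebra_simps)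
  have "degree E' \<le> 2 * d"
    using E(1) P0 unfolding E' by simp
  then show ?thesis using F(1) E(2) unfolding ev by blast
qed


section \<open>Sums of squares from a lower bound that degenerates over finitely many points\<close>

text \<open>(k + 1)(1 - b)^k is at most the geometric sum of the powers up to k, and b times that
  sum is 1 - (1 - b)^(k+1).\<close>

lemma geometric_bound:
  fixes b :: real
  assumes "0 \<le> b" "b \<le> 1"
  shows "(1 - b) ^ k * b \<le> 1 / (real k + 1)"
proof -
  have "(real k + 1) * ((1 - b) ^ k * b) = b * (\<Sum>i<Suc k. (1 - b) ^ k)" by simp
  also have "\<dots> \<le> b * (\<Sum>i<Suc k. (1 - b) ^ i)"
    using assms by (intro mult_left_mono sum_mono power_decreasing) auto
  also have "\<dots> = 1 - (1 - b) ^ Suc k"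
    using one_diff_power_eq[of "1 - b" "Suc k"] by simp
  also have "\<dots> \<le> 1" using assms by simp
  finally show ?thesis by (simp add: le_divide_eq mult.commute)
qed

text \<open>Write p = (1 - \<phi>) p + \<phi> p with \<phi> = (1 - b)^k concentrated near U. The
  first term is b \<psi> p; in the second, p is replaced by |f|^2 + b e + (c/2) b w. Hence p = b q +
  \<phi> |f|^2 with q = \<psi> p + \<phi> (c/2 w + e). As |e| is O(b w) and \<phi> b is at most 1 /
  (k + 1), q is at least c/4 w for large k.\<close>

lemma sos_of_lower_bound:
  assumes U: "finite U" "U \<subseteq> {z. norm z = 1}"
    and lp: "laurent (2 * d) (\<lambda>x u. of_real (p x u))" and c: "c > 0"
    and pos: "\<And>x u. norm u = 1 \<Longrightarrow> c * chord U u ^ m * (1 + x\<^sup>2) ^ d \<le> p x u"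
  shows "sos p"
proof -
  define h where "h u = (\<Prod>a\<in>U. (u - a) / 2) ^ Suc m" for u :: complex
  define b where "b u = (chord U u ^ Suc m)\<^sup>2" for u
  have nh: "norm (h u) = chord U u ^ Suc m" for u
    by (simp only: h_def chord_def norm_power prod_norm[symmetric] norm_divide) simp
  have b_h: "b u = (norm (h u))\<^sup>2" for u by (simp add: b_def nh)
  have b01: "0 \<le> b u" "b u \<le> 1" "b u \<le> chord U u ^ m" if "norm u = 1" for u
  proof -
    note ch = chord_bounds[OF U(2) that]
    show "0 \<le> b u" by (simp add: b_def)
    have "b u = chord U u ^ (2 * Suc m)" by (simp only: b_def power_mult[symmetric] mult.commute)
    moreover have "chord U u ^ (2 * Suc m) \<le> chord U u ^ m" using ch by (intro power_decreasing) auto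
    moreover have "chord U u ^ (2 * Suc m) \<le> 1" using ch by (intro power_le_one)
    ultimately show "b u \<le> 1" "b u \<le> chord U u ^ m" by simp_all
  qed
  define w where "w x = (1 + x\<^sup>2) ^ d" for x :: real
  have w1: "w x \<ge> 1" for x by (simp add: w_def one_le_power)
  have posb: "c * b u * w x \<le> p x u" if "norm u = 1" for x u
  proof -
    have "c * b u * w x \<le> c * chord U u ^ m * w x"
      using b01[OF that] c w1[of x] by (intro mult_right_mono mult_left_mono) auto
    then show ?thesis using pos[OF that, of x] by (simp add: w_def)
  qed
  have h_laurent: "laurent 0 (\<lambda>x u. h u)"
  proof -
    have "poly ((\<Prod>a\<in>U. [:- a / 2, 1 / 2:]) ^ Suc m) u = h u" for u
      by (simp only: poly_power poly_prod h_def) (simp add: field_simps)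
    then show ?thesis using laurent_poly[of "(\<Prod>a\<in>U. [:- a / 2, 1 / 2:]) ^ Suc m"] by simp
  qed
  have b_laurent: "laurent 0 (\<lambda>x u. of_real (b u))"
    using laurent_norm_square[OF h_laurent] by (simp add: b_h)
  have w_laurent: "laurent (2 * d) (\<lambda>x u. of_real (w x))"
  proof -
    have "laurent 2 (\<lambda>x u. 1 + of_real x ^ 2)"
      by (intro laurent_add laurent_mono[OF laurent_const]) (use laurent_power[OF laurent_x, of 2] in simp_all)
    from laurent_power[OF this, of d] show ?thesis by (simp add: w_def)
  qed
  \<comment> \<open>Half of the guaranteed positivity is kept back; it returns as the term c/2 w in
    \<open>q\<close>.\<close>
  define pt where "pt x u = p x u - c / 2 * b u * w x" for x u
  have pt_laurent: "laurent (2 * d) (\<lambda>x u. of_real (pt x u))"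
    unfolding pt_def of_real_diff of_real_mult
    using laurent_mult[OF laurent_cmult[OF b_laurent] w_laurent, of "of_real (c / 2)"]
    by (intro laurent_diff lp) simp
  \<comment> \<open>The order 4(m + 1) is twice that of b, so that after division by b the error is
    still O(b).\<close>
  have "\<exists>F E n. degree F \<le> d \<and> degree E \<le> 2 * d \<and> (\<forall>x u. norm u = 1 \<longrightarrow>
    of_real (pt x u - (norm (eval2 F (of_real x) u))\<^sup>2) = (\<Prod>a\<in>U. (u - a) ^ (4 * Suc m)) * eval2 E (of_real x) u / u ^ n)"
  proof (rule simultaneous_norm_approximation[OF U pt_laurent, of "c / 2" "2 * Suc m"])
    fix x and u :: complex assume u: "norm u = 1"
    have bu: "chord U u ^ (2 * Suc m) = b u" by (simp only: b_def power_mult[symmetric] mult.commute)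
    have "c / 2 * b u * 1 \<le> c / 2 * b u * w x" using c b01[OF u] w1[of x] by (intro mult_left_mono) auto
    then show "c / 2 * chord U u ^ (2 * Suc m) \<le> pt x u"
      using posb[OF u, of x] unfolding bu pt_def by (simp add: field_simps)
  qed (use c in simp)
  then obtain F E n where F: "degree F \<le> d" and E: "degree E \<le> 2 * d" and FE: "\<And>x u. norm u = 1 \<Longrightarrow>
    of_real (pt x u - (norm (eval2 F (of_real x) u))\<^sup>2) = (\<Prod>a\<in>U. (u - a) ^ (4 * Suc m)) * eval2 E (of_real x) u / u ^ n"
    by blast
  define f where "f x u = eval2 F (of_real x) u" for x :: real and u
  define K where "K = (2 :: complex) ^ (2 * Suc m * card U)"
  \<comment> \<open>On the circle (u - a)^2 = - u a |u - a|^2, so this is the error pt - |f|^2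
    divided by b, written without a denominator that vanishes on U. K undoes the halves in
    \<open>chord\<close>.\<close>
  define e where "e x u = K * (\<Prod>a\<in>U. (- u * a) ^ Suc m * (u - a) ^ (2 * Suc m)) * eval2 E (of_real x) u / u ^ n"
    for x :: real and u
  have f_laurent: "laurent d f" unfolding f_def by (rule laurent_eval2[OF F])
  have e_laurent: "laurent (2 * d) e"
  proof -
    have "laurent 0 (\<lambda>x u. poly (smult K (\<Prod>a\<in>U. [:0, - a:] ^ Suc m * [:- a, 1:] ^ (2 * Suc m))) u)"
      by (rule laurent_poly)
    moreover have "laurent (2 * d) (\<lambda>x u. eval2 E (of_real x) u / u ^ n)"
      unfolding laurent_def using E by blast
    ultimately have "laurent (0 + 2 * d) (\<lambda>x u. poly (smult K (\<Prod>a\<in>U. [:0, - a:] ^ Suc m * [:- a, 1:] ^ (2 * Suc m))) u *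
        (eval2 E (of_real x) u / u ^ n))" by (rule laurent_mult)
    note prod = this
    have "poly (smult K (\<Prod>a\<in>U. [:0, - a:] ^ Suc m * [:- a, 1:] ^ (2 * Suc m))) u =
        K * (\<Prod>a\<in>U. (- u * a) ^ Suc m * (u - a) ^ (2 * Suc m))" for u
      by (simp only: poly_smult poly_prod poly_mult poly_power) simp
    note eval = this
    have "laurent (0 + 2 * d) e"
      by (rule laurent_cong[OF prod]) (simp only: e_def eval times_divide_eq_right)
    then show ?thesis by simp
  qed
  have be: "of_real (b u) * e x u = of_real (pt x u - (norm (f x u))\<^sup>2)" if u: "norm u = 1" for x u
  proof -
    have sq: "of_real ((norm (u - a))\<^sup>2) * (- u * a) = (u - a) ^ 2" if a: "a \<in> U" for a
    proof -
      have "norm a = 1" using U a by auto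
      then have "u * cnj u = 1" "a * cnj a = 1" using u by (metis complex_norm_square of_real_1 one_power2)+
      then have "u * a * cnj (u - a) = a - u" by (simp add: algebra_simps)
      then show ?thesis unfolding complex_norm_square
        by (simp add: power2_eq_square mult_ac)
    qed
    have four: "(4 :: complex) = 2\<^sup>2" by simp
    have K: "K = (\<Prod>a\<in>U. 4 ^ Suc m)"
      unfolding four by (simp only: K_def prod_constant power_mult[symmetric] mult.assoc)
    have "complex_of_real (b u) = (\<Prod>a\<in>U. (of_real ((norm (u - a))\<^sup>2) / 4) ^ Suc m)"
    proof -
      have "b u = (\<Prod>a\<in>U. ((norm (u - a))\<^sup>2 / 4) ^ Suc m)"
        by (simp only: b_def chord_def prod_power_distrib power_mult[symmetric] mult.commute[of "Suc m" 2])
          (simp only: power_mult power_divide, simp)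
      then show ?thesis by simp
    qed
    then have "of_real (b u) * (K * (\<Prod>a\<in>U. (- u * a) ^ Suc m * (u - a) ^ (2 * Suc m))) =
        (\<Prod>a\<in>U. (of_real ((norm (u - a))\<^sup>2) / 4) ^ Suc m * (4 ^ Suc m * ((- u * a) ^ Suc m * (u - a) ^ (2 * Suc m))))"
      by (simp only: K prod.distrib)
    also have "\<dots> = (\<Prod>a\<in>U. (u - a) ^ (4 * Suc m))"
    proof (intro prod.cong refl)
      fix a assume a: "a \<in> U"
      have "(of_real ((norm (u - a))\<^sup>2) / 4) ^ Suc m * (4 ^ Suc m * ((- u * a) ^ Suc m * (u - a) ^ (2 * Suc m))) =
          (of_real ((norm (u - a))\<^sup>2) / 4 * 4 * (- u * a)) ^ Suc m * (u - a) ^ (2 * Suc m)"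
        by (simp only: power_mult_distrib mult.assoc)
      also have "of_real ((norm (u - a))\<^sup>2) / 4 * 4 * (- u * a) = (u - a) ^ 2" using sq[OF a] by simp
      also have "((u - a) ^ 2) ^ Suc m * (u - a) ^ (2 * Suc m) = (u - a) ^ (4 * Suc m)"
        unfolding power_mult[symmetric] power_add[symmetric] by (rule arg_cong[of _ _ "power (u - a)"]) simp
      finally show "(of_real ((norm (u - a))\<^sup>2) / 4) ^ Suc m * (4 ^ Suc m * ((- u * a) ^ Suc m * (u - a) ^ (2 * Suc m))) =
          (u - a) ^ (4 * Suc m)" .
    qed
    finally have "of_real (b u) * (K * (\<Prod>a\<in>U. (- u * a) ^ Suc m * (u - a) ^ (2 * Suc m))) = (\<Prod>a\<in>U. (u - a) ^ (4 * Suc m))" .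
    then have "of_real (b u) * e x u = (\<Prod>a\<in>U. (u - a) ^ (4 * Suc m)) * eval2 E (of_real x) u / u ^ n"
      by (simp only: e_def mult.assoc[symmetric] times_divide_eq_right)
    then show ?thesis using FE[OF u, of x] by (simp add: f_def)
  qed
  \<comment> \<open>Where b is nonzero, e is a quotient of real numbers; over U it vanishes by its
    explicit form.\<close>
  have e_real: "of_real (Re (e x u)) = e x u" if u: "norm u = 1" for x u
  proof (cases "b u = 0")
    case True
    then have "chord U u = 0" by (auto simp: b_def)
    then obtain a where "a \<in> U" "u = a" using U(1) by (auto simp: chord_def prod_zero_iff)
    then have "(\<Prod>a\<in>U. (- u * a) ^ Suc m * (u - a) ^ (2 * Suc m)) = 0" using U(1) by (auto intro!: prod_zero)
    then have "e x u = 0" by (simp add: e_def)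
    then show ?thesis by simp
  next
    case False
    then have "e x u = of_real ((pt x u - (norm (f x u))\<^sup>2) / b u)"
      using be[OF u, of x] by (simp add: field_simps)
    then show ?thesis by (metis Re_complex_of_real)
  qed
  obtain C where C: "C > 0" "\<And>x u. norm u = 1 \<Longrightarrow> norm (eval2 E (of_real x) u) \<le> C * w x"
    using laurent_bound[OF laurent_eval2[OF E]] unfolding w_def by metis
  define C' where "C' = norm K * norm K * C"
  have C': "C' > 0" using C by (simp add: C'_def K_def)
  have e_bound: "norm (e x u) \<le> C' * b u * w x" if u: "norm u = 1" for x u
  proof -
    have "norm (\<Prod>a\<in>U. (- u * a) ^ Suc m * (u - a) ^ (2 * Suc m)) = (\<Prod>a\<in>U. norm (u - a) ^ (2 * Suc m))"
      unfolding prod_norm[symmetric]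
    proof (intro prod.cong refl)
      fix a assume "a \<in> U"
      then have "norm a = 1" using U by auto
      then show "norm ((- u * a) ^ Suc m * (u - a) ^ (2 * Suc m)) = norm (u - a) ^ (2 * Suc m)"
        by (simp only: norm_mult norm_power norm_minus_cancel u) simp
    qed
    also have "\<dots> = (\<Prod>a\<in>U. (2 * (norm (u - a) / 2)) ^ (2 * Suc m))" by simp
    also have "\<dots> = norm K * b u"
    proof -
      have "(\<Prod>a\<in>U. (2 * (norm (u - a) / 2)) ^ (2 * Suc m)) = (2 ^ card U * chord U u) ^ (2 * Suc m)"
        unfolding chord_def by (simp only: prod_power_distrib[symmetric] prod.distrib prod_constant)
      also have "\<dots> = (2 ^ card U) ^ (2 * Suc m) * (chord U u ^ Suc m)\<^sup>2"
        by (simp only: power_mult_distrib power_mult[symmetric] mult.commute)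
      finally show ?thesis
        unfolding b_def K_def norm_power by (simp only: norm_numeral power_mult[symmetric] mult.commute[of "card U"])
    qed
    finally have "norm (e x u) = norm K * (norm K * b u) * norm (eval2 E (of_real x) u)"
      using u by (simp add: e_def norm_mult norm_divide norm_power)
    also have "\<dots> \<le> norm K * (norm K * b u) * (C * w x)"
      using C(2)[OF u] b01[OF u] by (intro mult_left_mono) auto
    finally show ?thesis by (simp add: C'_def mult_ac)
  qed
  obtain l :: nat where l: "real l > 4 * C' / c" using reals_Archimedean2 by blast
  \<comment> \<open>k is even so that (1 - b)^k |f|^2 is itself a squared modulus.\<close>
  define k where "k = 2 * l"
  define \<phi> where "\<phi> u = (1 - b u) ^ k" for u
  define \<psi> where "\<psi> u = (\<Sum>i<k. (1 - b u) ^ i)" for u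
  have b\<psi>: "b u * \<psi> u = 1 - \<phi> u" for u
    using one_diff_power_eq[of "1 - b u" k] by (simp add: \<phi>_def \<psi>_def)
  define q where "q x u = \<psi> u * p x u + \<phi> u * (c / 2 * w x + Re (e x u))" for x u
  have "laurent 0 (\<lambda>x u. of_real ((1 - b u) ^ i))" for i
    using laurent_power[OF laurent_diff[OF laurent_const[of 1] b_laurent], of i] by simp
  note pow_laurent = this
  have q_laurent: "laurent (2 * d) (\<lambda>x u. of_real (q x u))"
  proof -
    have 1: "laurent 0 (\<lambda>x u. of_real (\<psi> u))"
      unfolding \<psi>_def of_real_sum by (intro laurent_sum pow_laurent)
    have 2: "laurent 0 (\<lambda>x u. of_real (\<phi> u))" unfolding \<phi>_def by (rule pow_laurent)
    have 3: "laurent (2 * d) (\<lambda>x u. of_real (c / 2 * w x + Re (e x u)))"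
    proof (rule laurent_cong)
      show "laurent (2 * d) (\<lambda>x u. of_real (c / 2) * of_real (w x) + e x u)"
        by (intro laurent_add laurent_cmult w_laurent e_laurent)
    qed (simp add: e_real)
    show ?thesis unfolding q_def of_real_add[of "\<psi> _ * _"] of_real_mult
      using laurent_add[OF laurent_mult[OF 1 lp] laurent_mult[OF 2 3]] by simp
  qed
  have "sos q"
  proof (rule strictly_positive_imp_sos[OF q_laurent, of "c / 4"])
    show "c / 4 > 0" using c by simp
    fix x and u :: complex assume u: "norm u = 1"
    have \<psi>0: "\<psi> u \<ge> 0" "\<phi> u \<ge> 0" "\<phi> u \<le> 1" using b01[OF u] by (auto simp: \<psi>_def \<phi>_def intro!: sum_nonneg power_le_one)
    have "\<phi> u * b u \<le> 1 / (real k + 1)" unfolding \<phi>_def using b01[OF u] by (intro geometric_bound) auto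
    also have "\<dots> \<le> c / (4 * C')"
    proof -
      have "4 * C' < c * real l" using l c by (simp add: divide_less_eq mult.commute)
      also have "c * real l \<le> c * (real k + 1)" using c by (intro mult_left_mono) (auto simp: k_def)
      finally show ?thesis using C' c by (simp add: divide_le_eq le_divide_eq field_simps)
    qed
    finally have "C' * (\<phi> u * b u) \<le> C' * (c / (4 * C'))" using C' by (intro mult_left_mono) auto
    then have small: "C' * (\<phi> u * b u) \<le> c / 4" using C' by simp
    have "- (C' * b u * w x) \<le> Re (e x u)"
      using e_bound[OF u, of x] abs_Re_le_cmod[of "e x u"] by linarith
    then have "\<phi> u * (c / 2 * w x + - (C' * b u * w x)) \<le> \<phi> u * (c / 2 * w x + Re (e x u))"
      using \<psi>0 by (intro mult_left_mono) auto
    moreover have "\<psi> u * (c * b u * w x) \<le> \<psi> u * p x u"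
      using \<psi>0 posb[OF u, of x] by (intro mult_left_mono) auto
    ultimately have "\<psi> u * (c * b u * w x) + \<phi> u * (c / 2 * w x + - (C' * b u * w x)) \<le> q x u"
      unfolding q_def by linarith
    moreover have "\<psi> u * (c * b u * w x) + \<phi> u * (c / 2 * w x + - (C' * b u * w x)) =
        (c * (b u * \<psi> u) + c / 2 * \<phi> u - C' * (\<phi> u * b u)) * w x"
      by (simp add: algebra_simps)
    moreover have "c / 4 * w x \<le> (c * (b u * \<psi> u) + c / 2 * \<phi> u - C' * (\<phi> u * b u)) * w x"
    proof (rule mult_right_mono)
      have "c * \<phi> u \<le> c" using \<psi>0 c by simp
      then have "c / 2 \<le> c * (b u * \<psi> u) + c / 2 * \<phi> u"
        unfolding b\<psi> by (simp add: right_diff_distrib)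
      then show "c / 4 \<le> c * (b u * \<psi> u) + c / 2 * \<phi> u - C' * (\<phi> u * b u)" using small by linarith
    qed (use w1[of x] in linarith)
    ultimately show "c / 4 * (1 + x\<^sup>2) ^ d \<le> q x u" unfolding w_def by linarith
  qed
  then have "sos (\<lambda>x u. (norm (h u))\<^sup>2 * q x u)" by (rule sos_mult_norm_square[OF h_laurent])
  moreover have "sos (\<lambda>x u. (norm (of_real ((1 - b u) ^ l) * f x u))\<^sup>2)"
    by (rule sos_norm_square, rule laurent_mult[OF pow_laurent f_laurent])
  ultimately have "sos (\<lambda>x u. (norm (h u))\<^sup>2 * q x u + (norm (of_real ((1 - b u) ^ l) * f x u))\<^sup>2)"
    by (rule sos_add)
  then show ?thesis
  proof (rule sos_cong)
    fix x and u :: complex assume u: "norm u = 1"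
    have "complex_of_real (b u * Re (e x u)) = of_real (pt x u - (norm (f x u))\<^sup>2)"
      using be[OF u, of x] e_real[OF u, of x] by simp
    then have ptf: "b u * Re (e x u) = pt x u - (norm (f x u))\<^sup>2" by (metis of_real_eq_iff)
    have "(norm (of_real ((1 - b u) ^ l) * f x u))\<^sup>2 = \<phi> u * (norm (f x u))\<^sup>2"
      by (simp add: norm_mult power_mult_distrib \<phi>_def k_def power_mult[symmetric] mult.commute norm_power
        del: of_real_power)
    moreover have "(norm (h u))\<^sup>2 * q x u = (b u * \<psi> u) * p x u + \<phi> u * (c / 2 * b u * w x + b u * Re (e x u))"
      unfolding b_h[symmetric] q_def by (simp add: algebra_simps)
    ultimately show "(norm (h u))\<^sup>2 * q x u + (norm (of_real ((1 - b u) ^ l) * f x u))\<^sup>2 = p x u"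
      unfolding ptf b\<psi> pt_def by (simp add: algebra_simps)
  qed
qed


subsection \<open>Reduction to the separable case\<close>

lemma Re_poly_nonneg_finite_exceptions:
  assumes "finite S" "\<And>x :: real. x \<notin> S \<Longrightarrow> 0 \<le> Re (poly p (of_real x))"
  shows "0 \<le> Re (poly p (of_real a))"
proof (rule tendsto_lowerbound[OF tendsto_Re_poly])
  have "open (- (S - {a}))" using assms(1) by (intro open_Compl finite_imp_closed) auto
  then show "\<forall>\<^sub>F x in at a. 0 \<le> Re (poly p (of_real x))"
    unfolding eventually_at_topological
    by (intro exI[of _ "- (S - {a})"]) (use assms(2) in auto)
qed simp

lemma star_polynomial:
  "\<exists>F' l. degree F' \<le> degree F \<and>
    (\<forall>x u. norm u = 1 \<longrightarrow> cnj (eval2 F (of_real x) u) = eval2 F' (of_real x) u / u ^ l)"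
  using laurent_cnj[OF laurent_eval2[of F "degree F"]] unfolding laurent_def by simp

lemma eval2_eqI:
  assumes "\<And>x u. norm u = 1 \<Longrightarrow> eval2 F (of_real x) u = eval2 G (of_real x) u"
  shows "F = G"
proof -
  have "F - G = 0"
    by (rule eval2_eq_0_on_infinite[OF infinite_range_complex_of_real infinite_unit_circle])
      (use assms in auto)
  then show ?thesis by simp
qed

text \<open>If the specialisation at u vanished identically, the prime would be divisible by a
  linear polynomial in the circle variable, against its positive degree in x.\<close>

lemma prime_specialization_finite_zeros:
  fixes \<pi> :: "complex poly poly"
  assumes "prime_elem \<pi>" "degree \<pi> > 0"
  shows "finite {x :: real. eval2 \<pi> (of_real x) u = 0}"
proof -
  have "map_poly (\<lambda>c. poly c u) \<pi> \<noteq> 0"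
  proof
    assume "map_poly (\<lambda>c. poly c u) \<pi> = 0"
    then have "poly (coeff \<pi> i) u = 0" for i by (metis coeff_map_poly coeff_0 poly_0)
    then have "[:[:- u, 1:]:] dvd \<pi>" by (simp add: const_poly_dvd_iff poly_eq_0_iff_dvd)
    then obtain q where q: "\<pi> = [:[:- u, 1:]:] * q" by (elim dvdE)
    have "irreducible \<pi>" using assms(1) by (rule prime_elem_imp_irreducible)
    then have "is_unit [:[:- u, 1:]:] \<or> is_unit q" using q by (rule irreducibleD)
    moreover have "\<not> is_unit [:[:- u, 1:]:]" by (simp add: is_unit_const_poly_iff is_unit_poly_iff)
    moreover have "\<not> is_unit q"
    proof
      assume "is_unit q"
      then have "degree q = 0" by (auto simp: is_unit_poly_iff)
      then have "degree \<pi> = 0" using q by simp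
      then show False using assms(2) by simp
    qed
    ultimately show False by blast
  qed
  then have "finite {z. poly (map_poly (\<lambda>c. poly c u) \<pi>) z = 0}" by (rule poly_roots_finite)
  then have "finite (complex_of_real -` {z. poly (map_poly (\<lambda>c. poly c u) \<pi>) z = 0})"
    by (rule finite_vimageI) (simp add: inj_on_def)
  then show ?thesis by (simp add: eval2_conv_poly vimage_def)
qed

text \<open>By the product rule the prime divides K times its own derivative, which is nonzero of
  smaller degree; so it divides K.\<close>

lemma prime_square_dvd:
  fixes \<pi> F :: "complex poly poly"
  assumes "prime_elem \<pi>" "degree \<pi> > 0" "\<pi> dvd F" "\<pi> dvd pderiv F"
  shows "\<exists>K. F = \<pi> * \<pi> * K"
proof -
  obtain K where K: "F = \<pi> * K" using assms(3) by (elim dvdE)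
  have "\<pi> dvd \<pi> * pderiv K + K * pderiv \<pi>" using assms(4) unfolding K pderiv_mult .
  then have "\<pi> dvd K * pderiv \<pi>" by (metis dvd_add_times_triv_left_iff mult.commute)
  moreover have "\<not> \<pi> dvd pderiv \<pi>"
  proof
    assume "\<pi> dvd pderiv \<pi>"
    moreover have "pderiv \<pi> \<noteq> 0" using assms(2) by (simp add: pderiv_eq_0_iff)
    ultimately have "degree \<pi> \<le> degree (pderiv \<pi>)" by (rule dvd_imp_degree_le)
    then show False using assms(2) by (simp add: degree_pderiv)
  qed
  ultimately have "\<pi> dvd K" using assms(1) prime_elem_dvd_multD by blast
  then show ?thesis using K by (metis dvdE mult.assoc)
qed

text \<open>
  If \<open>\<pi>\<close> divides its conjugate, the quotient is unimodular on the circle, so \<open>\<pi>\<^sup>2\<close> and \<open>\<bar>\<pi>\<bar>\<^sup>2\<close>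
  differ by a unit. Otherwise primality forces \<open>\<pi>\<^sup>2\<close> and its conjugate to divide \<open>F\<close> jointly.
\<close>

lemma split_off_norm:
  assumes real: "\<And>x u. norm u = 1 \<Longrightarrow> eval2 F (of_real x) u / u ^ n \<in> \<real>"
    and F0: "F \<noteq> 0" and \<pi>: "prime_elem \<pi>" "degree \<pi> > 0" and K: "F = \<pi> * \<pi> * K"
  shows "\<exists>G k. degree G < degree F \<and> (\<forall>x u. norm u = 1 \<longrightarrow> eval2 F (of_real x) u / u ^ n =
    of_real ((norm (eval2 \<pi> (of_real x) u))\<^sup>2) * (eval2 G (of_real x) u / u ^ k))"
proof -
  have \<pi>0: "\<pi> \<noteq> 0" "K \<noteq> 0" using F0 K by auto
  have degF: "degree F = 2 * degree \<pi> + degree K" using \<pi>0 unfolding K by (simp add: degree_mult_eq)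
  obtain \<pi>' l where \<pi>': "degree \<pi>' \<le> degree \<pi>"
    "\<And>x u. norm u = 1 \<Longrightarrow> cnj (eval2 \<pi> (of_real x) u) = eval2 \<pi>' (of_real x) u / u ^ l"
    using star_polynomial by blast
  obtain K' l2 where K': "\<And>x u. norm u = 1 \<Longrightarrow> cnj (eval2 K (of_real x) u) = eval2 K' (of_real x) u / u ^ l2"
    using star_polynomial by blast
  show ?thesis
  proof (cases "\<pi> dvd \<pi>'")
    case True
    then obtain v where v: "\<pi>' = \<pi> * v" by (elim dvdE)
    have "\<pi>' \<noteq> 0"
    proof
      assume "\<pi>' = 0"
      have "\<pi> = 0"
      proof (rule eval2_eqI)
        fix x and u :: complex assume "norm u = 1"
        then have "cnj (eval2 \<pi> (of_real x) u) = 0" using \<pi>'(2)[of u x] \<open>\<pi>' = 0\<close> by simp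
        then show "eval2 \<pi> (of_real x) u = eval2 0 (of_real x) u" by simp
      qed
      then show False using \<pi>0 by simp
    qed
    then have "degree v = 0" using \<pi>'(1) v \<pi>0 by (auto simp: degree_mult_eq)
    then obtain v0 where v0: "v = [:v0:]" by (rule degree_eq_zeroE)
    obtain V l3 where V: "degree V \<le> 0"
      "\<And>x u. norm u = 1 \<Longrightarrow> cnj (eval2 [:v0:] (of_real x) u) = eval2 V (of_real x) u / u ^ l3"
      using star_polynomial[of "[:v0:]"] by auto
    define G where "G = smult (monom 1 l) (V * K)"
    have "degree G \<le> degree K"
      using degree_smult_le[of "monom 1 l" "V * K"] degree_mult_le[of V K] V(1) unfolding G_def by linarith
    then have "degree G < degree F" using degF \<pi>(2) by simp
    moreover have "eval2 F (of_real x) u / u ^ n =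
        of_real ((norm (eval2 \<pi> (of_real x) u))\<^sup>2) * (eval2 G (of_real x) u / u ^ (l3 + n))" if u: "norm u = 1" for x u
    proof (cases "eval2 \<pi> (of_real x) u = 0")
      case True
      then show ?thesis by (simp add: K)
    next
      case False
      have u0: "u \<noteq> 0" using u by auto
      let ?p = "eval2 \<pi> (of_real x) u"
      have c: "cnj ?p = ?p * poly v0 u / u ^ l" using \<pi>'(2)[OF u, of x] by (simp add: v v0)
      then have "norm (cnj ?p) = norm ?p * norm (poly v0 u)"
        using u by (simp add: norm_mult norm_divide norm_power)
      then have "norm (poly v0 u) = 1" using False by simp
      then have vv: "poly v0 u * cnj (poly v0 u) = 1" by (metis complex_norm_square of_real_1 one_power2)
      have "eval2 G (of_real x) u / u ^ (l3 + n) = u ^ l * cnj (poly v0 u) * eval2 K (of_real x) u / u ^ n"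
        using V(2)[OF u, of x] by (simp add: G_def poly_monom power_add)
      then have "of_real ((norm ?p)\<^sup>2) * (eval2 G (of_real x) u / u ^ (l3 + n)) =
          ?p * (?p * poly v0 u / u ^ l) * (u ^ l * cnj (poly v0 u) * eval2 K (of_real x) u / u ^ n)"
        unfolding complex_norm_square c by simp
      also have "\<dots> = ?p * ?p * (poly v0 u * cnj (poly v0 u)) * eval2 K (of_real x) u / u ^ n"
        using u0 by simp
      finally show ?thesis by (simp add: vv K)
    qed
    ultimately show ?thesis by blast
  next
    case False
    define s where "s = 2 * l + l2"
    \<comment> \<open>F / u^n is real on the circle, so conjugating F = \<pi> \<pi> K gives a second
      factorisation of F up to powers of u.\<close>
    have id: "smult (monom 1 s) F = smult (monom 1 (2 * n)) (\<pi>' * \<pi>' * K')"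
    proof (rule eval2_eqI)
      fix x and u :: complex assume u: "norm u = 1"
      then have u0: "u \<noteq> 0" by auto
      have uu: "cnj u = 1 / u"
        using u u0 by (metis complex_norm_square eq_divide_eq mult.commute of_real_1 one_power2)
      have "eval2 F (of_real x) u / u ^ n = cnj (eval2 F (of_real x) u / u ^ n)"
        using real[OF u, of x] by (simp add: Reals_cnj_iff)
      also have "\<dots> = (eval2 \<pi>' (of_real x) u / u ^ l) * (eval2 \<pi>' (of_real x) u / u ^ l) * (eval2 K' (of_real x) u / u ^ l2) * u ^ n"
        using \<pi>'(2)[OF u, of x] K'[OF u, of x] u0 by (simp add: K uu power_divide)
      also have "\<dots> = eval2 (\<pi>' * \<pi>' * K') (of_real x) u * u ^ n / u ^ s"
        by (simp add: s_def power_add mult_2 mult_2_right mult_ac)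
      finally have "eval2 F (of_real x) u * u ^ s = eval2 (\<pi>' * \<pi>' * K') (of_real x) u * (u ^ n * u ^ n)"
        using u0 by (simp only: divide_eq_eq eq_divide_eq) (simp add: divide_simps mult_ac)
      then show "eval2 (smult (monom 1 s) F) (of_real x) u = eval2 (smult (monom 1 (2 * n)) (\<pi>' * \<pi>' * K')) (of_real x) u"
        by (simp only: eval2_simps poly_monom mult_2 mult_2_right power_add mult_1 mult.commute)
    qed
    have split: "\<pi> dvd C" if "\<pi> dvd smult (monom 1 (2 * n)) (\<pi>' * \<pi>' * C)" for C
    proof -
      have "\<pi> dvd \<pi>' * \<pi>' * C"
        by (rule prime_dvd_smult_degree[OF \<pi> that]) (simp add: monom_eq_0_iff)
      then have "\<pi> dvd \<pi>' * \<pi>' \<or> \<pi> dvd C" using \<pi>(1) prime_elem_dvd_multD by blast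
      then show ?thesis using False \<pi>(1) prime_elem_dvd_multD by blast
    qed
    have "\<pi> dvd smult (monom 1 s) F" unfolding K by (intro dvd_smult) simp
    then have "\<pi> dvd K'" using split id by simp
    then obtain K2 where K2: "K' = \<pi> * K2" by (elim dvdE)
    have "\<pi> * smult (monom 1 s) (\<pi> * K) = \<pi> * smult (monom 1 (2 * n)) (\<pi>' * \<pi>' * K2)"
      using id unfolding K K2 by (simp add: mult_ac)
    then have id2: "smult (monom 1 s) (\<pi> * K) = smult (monom 1 (2 * n)) (\<pi>' * \<pi>' * K2)"
      using \<pi>0 by (metis mult_left_cancel)
    have "\<pi> dvd smult (monom 1 s) (\<pi> * K)" by (intro dvd_smult) simp
    then have "\<pi> dvd K2" using split id2 by simp
    then obtain K3 where K3: "K2 = \<pi> * K3" by (elim dvdE)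
    have id3: "smult (monom 1 s) F = smult (monom 1 (2 * n)) (\<pi>' * \<pi>' * (\<pi> * (\<pi> * K3)))"
      using id unfolding K2 K3 .
    have nz: "\<pi>' \<noteq> 0" "K3 \<noteq> 0"
      using id3 F0 by (auto simp: monom_eq_0_iff)
    have "degree F = degree (\<pi>' * \<pi>' * (\<pi> * (\<pi> * K3)))"
      using arg_cong[OF id3, of degree] by (simp add: monom_eq_0_iff del: mult_smult_left mult_smult_right)
    then have degF': "degree F = 2 * degree \<pi>' + 2 * degree \<pi> + degree K3"
      using nz \<pi>0 by (simp add: degree_mult_eq)
    define G where "G = smult (monom 1 (2 * n + l)) (\<pi> * \<pi>' * K3)"
    have "degree G < degree F"
      using nz \<pi>0 \<pi>(2) unfolding G_def degF' by (simp add: degree_mult_eq monom_eq_0_iff)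
    moreover have "eval2 F (of_real x) u / u ^ n =
        of_real ((norm (eval2 \<pi> (of_real x) u))\<^sup>2) * (eval2 G (of_real x) u / u ^ (s + n))" if u: "norm u = 1" for x u
    proof -
      have u0: "u \<noteq> 0" using u by auto
      let ?p = "eval2 \<pi> (of_real x) u" and ?p' = "eval2 \<pi>' (of_real x) u" and ?k = "eval2 K3 (of_real x) u"
      have "u ^ s * eval2 F (of_real x) u = u ^ (2 * n) * (?p' * ?p' * (?p * (?p * ?k)))"
        using arg_cong[OF id3, of "\<lambda>G. eval2 G (of_real x) u"] by (simp only: eval2_simps poly_monom mult_1)
      then have F: "eval2 F (of_real x) u = u ^ (2 * n) * (?p' * ?p' * (?p * (?p * ?k))) / u ^ s"
        using u0 by (simp add: eq_divide_eq mult.commute)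
      have G: "eval2 G (of_real x) u = u ^ (2 * n) * u ^ l * (?p * ?p' * ?k)"
        by (simp only: G_def eval2_simps poly_monom power_add mult_1)
      have sq: "of_real ((norm ?p)\<^sup>2) = ?p * (?p' / u ^ l)"
        unfolding complex_norm_square using \<pi>'(2)[OF u, of x] by simp
      show ?thesis unfolding sq F G using u0 by (simp add: power_add)
    qed
    ultimately show ?thesis by blast
  qed
qed

text \<open>Induction on the degree in x: either F and its x-derivative satisfy a Bezout identity
  and the lower bound applies, or a squared modulus splits off and the quotient has smaller
  degree.\<close>

theorem nonneg_laurent_imp_sos:
  assumes "laurent m (\<lambda>x u. of_real (p x u))" "\<And>x u. norm u = 1 \<Longrightarrow> 0 \<le> p x u"
  shows "sos p"
  using assms
proof (induction m arbitrary: p rule: less_induct)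
  case (less m)
  note nonneg = less.prems(2)
  obtain F n where F: "degree F \<le> m" "\<And>x u. norm u = 1 \<Longrightarrow> of_real (p x u) = eval2 F (of_real x) u / u ^ n"
    using less.prems(1) unfolding laurent_def by auto
  show ?case
  proof (cases "F = 0")
    case True
    then have "p x u = 0" if "norm u = 1" for x u using F(2)[OF that, of x] by simp
    then show ?thesis by (intro sos_cong[OF sos_0]) simp
  next
    case F0: False
    consider (bezout) A B r where "r \<noteq> 0" "A * F + B * pderiv F = [:r:]"
      | (factor) \<pi> where "prime_elem \<pi>" "degree \<pi> > 0" "\<pi> dvd F" "\<pi> dvd pderiv F"
      using bezout_or_common_factor[OF F0, of "pderiv F"] by blast
    then show ?thesis
    proof cases
      case bezout
      obtain d U k c where d: "degree F = 2 * d" "finite U" "U \<subseteq> {z. norm z = 1}" "c > 0"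
        "\<And>x u. norm u = 1 \<Longrightarrow> c * chord U u ^ k * (1 + x\<^sup>2) ^ d \<le> p x u"
        using separable_lower_bound[OF F(2) nonneg bezout(2,1) F0] by blast
      have "laurent (2 * d) (\<lambda>x u. of_real (p x u))"
        unfolding laurent_def using d(1) F(2) by (intro exI[of _ F] exI[of _ n]) auto
      then show ?thesis using sos_of_lower_bound d by blast
    next
      case factor
      obtain K where K: "F = \<pi> * \<pi> * K" using prime_square_dvd[OF factor] by blast
      have "eval2 F (of_real x) u / u ^ n \<in> \<real>" if "norm u = 1" for x u
        using F(2)[OF that, of x] by (metis Reals_of_real)
      then obtain G k where G: "degree G < degree F" "\<And>x u. norm u = 1 \<Longrightarrow> eval2 F (of_real x) u / u ^ n =
          of_real ((norm (eval2 \<pi> (of_real x) u))\<^sup>2) * (eval2 G (of_real x) u / u ^ k)"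
        using split_off_norm[OF _ F0 factor(1,2) K] by blast
      define q where "q x u = Re (eval2 G (of_real x) u / u ^ k)" for x :: real and u
      \<comment> \<open>The quotient is real and nonnegative wherever the prime does not vanish. For
        fixed u this omits only finitely many x, and continuity covers them.\<close>
      have q: "of_real (q x u) = eval2 G (of_real x) u / u ^ k" "0 \<le> q x u" if u: "norm u = 1" for x u
      proof -
        define S where "S = {x :: real. eval2 \<pi> (of_real x) u = 0}"
        have S: "finite S" unfolding S_def by (rule prime_specialization_finite_zeros[OF factor(1,2)])
        define R where "R = smult (1 / u ^ k) (map_poly (\<lambda>c. poly c u) G)"
        have R: "poly R (of_real x) = eval2 G (of_real x) u / u ^ k" for x
          by (simp add: R_def eval2_conv_poly)
        have off: "poly R (of_real x) = of_real (p x u / (norm (eval2 \<pi> (of_real x) u))\<^sup>2)" if "x \<notin> S" for x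
        proof -
          have "(norm (eval2 \<pi> (of_real x) u))\<^sup>2 \<noteq> 0" using that by (simp add: S_def)
          moreover have "of_real (p x u) = of_real ((norm (eval2 \<pi> (of_real x) u))\<^sup>2) * poly R (of_real x)"
            using F(2)[OF u, of x] G(2)[OF u, of x] by (simp add: R)
          ultimately show ?thesis by (simp add: field_simps)
        qed
        have "0 \<le> Re (poly R (of_real x))"
          by (rule Re_poly_nonneg_finite_exceptions[OF S]) (use nonneg[OF u] off in simp)
        then show "0 \<le> q x u" by (simp add: q_def R)
        have "0 \<le> Re (poly (smult \<i> R) (of_real x))"
          by (rule Re_poly_nonneg_finite_exceptions[OF S]) (use off in simp)
        moreover have "0 \<le> Re (poly (smult (- \<i>) R) (of_real x))"
          by (rule Re_poly_nonneg_finite_exceptions[OF S]) (use off in simp)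
        ultimately have "Im (poly R (of_real x)) = 0" by simp
        then show "of_real (q x u) = eval2 G (of_real x) u / u ^ k"
          by (simp add: q_def R complex_eq_iff)
      qed
      have "sos q"
      proof (rule less.IH)
        show "degree G < m" using G(1) F(1) by simp
        show "laurent (degree G) (\<lambda>x u. of_real (q x u))"
          unfolding laurent_def using q(1) by (intro exI[of _ G] exI[of _ k]) simp
      qed (rule q(2))
      then have "sos (\<lambda>x u. (norm (eval2 \<pi> (of_real x) u))\<^sup>2 * q x u)"
        by (rule sos_mult_norm_square[OF laurent_eval2[OF order.refl]])
      then show ?thesis
      proof (rule sos_cong)
        fix x and u :: complex assume u: "norm u = 1"
        have "complex_of_real ((norm (eval2 \<pi> (of_real x) u))\<^sup>2 * q x u) = of_real (p x u)"
          using F(2)[OF u, of x] G(2)[OF u, of x] q(1)[OF u, of x] by simp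
        then show "(norm (eval2 \<pi> (of_real x) u))\<^sup>2 * q x u = p x u" by (metis of_real_eq_iff)
      qed
    qed
  qed
qed


section \<open>Semigroup algebras\<close>

definition weighted_sum :: "('s \<Rightarrow> complex) \<Rightarrow> ('s::comm_monoid_add \<Rightarrow>\<^sub>0 complex) \<Rightarrow> complex" where
  "weighted_sum \<phi> f = (\<Sum>s\<in>Poly_Mapping.keys f. Poly_Mapping.lookup f s * \<phi> s)"

lemma weighted_sum_superset:
  assumes "finite K" "Poly_Mapping.keys f \<subseteq> K"
  shows "weighted_sum \<phi> f = (\<Sum>s\<in>K. Poly_Mapping.lookup f s * \<phi> s)"
  unfolding weighted_sum_def
  by (rule sum.mono_neutral_left) (use assms in \<open>auto simp: in_keys_iff\<close>)

lemma weighted_sum_0 [simp]: "weighted_sum \<phi> 0 = 0"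
  by (simp add: weighted_sum_def)

lemma weighted_sum_single [simp]: "weighted_sum \<phi> (Poly_Mapping.single s c) = c * \<phi> s"
  by (subst weighted_sum_superset[of "{s}"]) auto

lemma weighted_sum_add [simp]: "weighted_sum \<phi> (f + g) = weighted_sum \<phi> f + weighted_sum \<phi> g"
proof -
  let ?K = "Poly_Mapping.keys f \<union> Poly_Mapping.keys g"
  have "Poly_Mapping.keys (f + g) \<subseteq> ?K" by (rule keys_add)
  then show ?thesis
    by (simp add: weighted_sum_superset[of ?K] lookup_add distrib_right sum.distrib)
qed

lemma weighted_sum_uminus: "weighted_sum \<phi> (- f) = - weighted_sum \<phi> f"
  using weighted_sum_add[of \<phi> f "- f"] by (simp add: eq_neg_iff_add_eq_0 add.commute)

lemma weighted_sum_diff [simp]: "weighted_sum \<phi> (f - g) = weighted_sum \<phi> f - weighted_sum \<phi> g"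
  using weighted_sum_add[of \<phi> f "- g"] by (simp add: weighted_sum_uminus)

lemma weighted_sum_sum [simp]: "weighted_sum \<phi> (sum f I) = (\<Sum>i\<in>I. weighted_sum \<phi> (f i))"
  by (induction I rule: infinite_finite_induct) simp_all

lemma weighted_sum_mult:
  assumes fg: "f \<in> semigroup_algebra S" "g \<in> semigroup_algebra S"
    and \<phi>: "\<And>s t. s \<in> S \<Longrightarrow> t \<in> S \<Longrightarrow> \<phi> (s + t) = \<phi> s * \<phi> t"
  shows "weighted_sum \<phi> (f * g) = weighted_sum \<phi> f * weighted_sum \<phi> g"
proof -
  let ?f = "Poly_Mapping.lookup f" and ?g = "Poly_Mapping.lookup g"
  have "f * g = (\<Sum>s\<in>Poly_Mapping.keys f. Poly_Mapping.single s (?f s)) *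
      (\<Sum>t\<in>Poly_Mapping.keys g. Poly_Mapping.single t (?g t))"
    using semigroup_algebra_expansion[of f] semigroup_algebra_expansion[of g] by metis
  then have "f * g = (\<Sum>s\<in>Poly_Mapping.keys f. \<Sum>t\<in>Poly_Mapping.keys g.
      Poly_Mapping.single (s + t) (?f s * ?g t))"
    by (simp add: sum_product mult_single)
  then have "weighted_sum \<phi> (f * g) = (\<Sum>s\<in>Poly_Mapping.keys f. \<Sum>t\<in>Poly_Mapping.keys g.
      ?f s * ?g t * \<phi> (s + t))" by simp
  also have "\<dots> = (\<Sum>s\<in>Poly_Mapping.keys f. \<Sum>t\<in>Poly_Mapping.keys g. (?f s * \<phi> s) * (?g t * \<phi> t))"
    using fg by (intro sum.cong refl) (auto simp: semigroup_algebra_def \<phi> subset_iff)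
  finally show ?thesis by (simp add: weighted_sum_def sum_product)
qed

lemma weighted_sum_star:
  assumes "f \<in> semigroup_algebra S" "\<And>s. s \<in> S \<Longrightarrow> \<phi> (adj s) = cnj (\<phi> s)"
  shows "weighted_sum \<phi> (semigroup_algebra_star adj f) = cnj (weighted_sum \<phi> f)"
proof -
  have "weighted_sum \<phi> (semigroup_algebra_star adj f) =
      (\<Sum>s\<in>Poly_Mapping.keys f. cnj (Poly_Mapping.lookup f s) * \<phi> (adj s))"
    by (simp add: semigroup_algebra_star_def)
  also have "\<dots> = (\<Sum>s\<in>Poly_Mapping.keys f. cnj (Poly_Mapping.lookup f s * \<phi> s))"
    using assms by (intro sum.cong refl) (auto simp: semigroup_algebra_def subset_iff)
  finally show ?thesis by (simp add: weighted_sum_def)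
qed

context complex_star_algebra
begin

lemma sum_mem: "(\<And>i. i \<in> I \<Longrightarrow> f i \<in> A) \<Longrightarrow> sum f I \<in> A"
  by (induction I rule: infinite_finite_induct) (auto simp: zero_mem add_mem)

text \<open>A character takes star a * a to the squared modulus of its value at a.\<close>

lemma hermitian_square_sums_nonneg: "hermitian_square_sums A star \<subseteq> character_nonneg A scale star"
proof
  fix a assume "a \<in> hermitian_square_sums A star"
  then obtain n :: nat and f where a: "a = (\<Sum>j<n. star (f j) * f j)" and "\<forall>j<n. f j \<in> A"
    unfolding hermitian_square_sums_def by blast
  then have f: "f j \<in> A" if "j < n" for j using that by blast
  have sq: "star (f j) * f j \<in> A" if "j < n" for j using f[OF that] by (intro mult_mem star_mem)
  have "\<chi> a \<in> \<real>\<^sub>\<ge>\<^sub>0" if \<chi>: "\<chi> \<in> algebra_characters A scale star" for \<chi>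
  proof -
    have add: "\<chi> (x + y) = \<chi> x + \<chi> y" if "x \<in> A" "y \<in> A" for x y
      using \<chi> that by (simp add: algebra_characters_def)
    have "\<chi> 0 = 0" using add[OF zero_mem zero_mem] by simp
    then have "m \<le> n \<Longrightarrow> \<chi> (\<Sum>j<m. star (f j) * f j) = (\<Sum>j<m. \<chi> (star (f j) * f j))" for m
    proof (induction m)
      case (Suc m)
      have "(\<Sum>j<m. star (f j) * f j) \<in> A" using Suc.prems by (intro sum_mem sq) auto
      then show ?case using Suc by (simp add: add sq)
    qed simp
    moreover have "\<chi> (star (f j) * f j) = of_real ((norm (\<chi> (f j)))\<^sup>2)" if "j < n" for j
    proof -
      have "\<chi> (star (f j) * f j) = cnj (\<chi> (f j)) * \<chi> (f j)"
        using \<chi> f[OF that] star_mem[OF f[OF that]] by (simp add: algebra_characters_def)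
      then show ?thesis by (simp only: complex_norm_square mult.commute)
    qed
    ultimately have "\<chi> a = of_real (\<Sum>j<n. (norm (\<chi> (f j)))\<^sup>2)" by (simp add: a)
    moreover have "0 \<le> (\<Sum>j<n. (norm (\<chi> (f j)))\<^sup>2)" by (intro sum_nonneg) auto
    ultimately show ?thesis by (simp only: nonneg_Reals_of_real_iff)
  qed
  then show "a \<in> character_nonneg A scale star"
    unfolding character_nonneg_def using a sq by (auto intro!: sum_mem)
qed

end

text \<open>
  A graded \<open>*\<close>-semigroup embeds via \<open>\<iota>\<close> into \<open>\<nat> \<times> \<int>\<close>; the point \<open>(x, u)\<close> with \<open>x\<close> real and
  \<open>\<bar>u\<bar> = 1\<close> acts by the character \<open>s \<mapsto> x^k u^j\<close> where \<open>\<iota> s = (k, j)\<close>.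
\<close>

locale graded_star_semigroup = abelian_star_semigroup S adj
  for S :: "'s::comm_monoid_add set" and adj +
  fixes \<iota> :: "'s \<Rightarrow> nat \<times> int"
  assumes \<iota>_zero: "\<iota> 0 = 0"
    and \<iota>_add: "s \<in> S \<Longrightarrow> t \<in> S \<Longrightarrow> \<iota> (s + t) = \<iota> s + \<iota> t"
    and \<iota>_adj: "s \<in> S \<Longrightarrow> \<iota> (adj s) = (fst (\<iota> s), - snd (\<iota> s))"
    and \<iota>_inj: "inj_on \<iota> S"
begin

definition point :: "real \<Rightarrow> complex \<Rightarrow> 's \<Rightarrow> complex" where
  "point x u s = of_real x ^ fst (\<iota> s) * u powi snd (\<iota> s)"

lemma point_props:
  assumes u: "norm u = 1"
  shows "point x u 0 = 1"
    and "s \<in> S \<Longrightarrow> t \<in> S \<Longrightarrow> point x u (s + t) = point x u s * point x u t"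
    and "s \<in> S \<Longrightarrow> point x u (adj s) = cnj (point x u s)"
proof -
  have u0: "u \<noteq> 0" using u by auto
  have cu: "cnj u = inverse u"
    using u u0 by (metis complex_norm_square inverse_unique of_real_1 one_power2)
  show "point x u 0 = 1" by (simp add: point_def \<iota>_zero)
  show "s \<in> S \<Longrightarrow> t \<in> S \<Longrightarrow> point x u (s + t) = point x u s * point x u t"
    using u0 by (simp add: point_def \<iota>_add power_add power_int_add)
  show "s \<in> S \<Longrightarrow> point x u (adj s) = cnj (point x u s)"
    by (simp add: point_def \<iota>_adj cu power_int_minus power_int_inverse complex_cnj_power_int)
qed

lemma point_character:
  assumes "norm u = 1"
  shows "weighted_sum (point x u) \<in>
    algebra_characters (semigroup_algebra S) semigroup_algebra_scale (semigroup_algebra_star adj)"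
proof -
  note p = point_props(1)[OF assms, of x] point_props(2)[OF assms, where x = x] point_props(3)[OF assms, where x = x]
  have "weighted_sum (point x u) (semigroup_algebra_scale c f) = c * weighted_sum (point x u) f"
    if "f \<in> semigroup_algebra S" for c f
  proof -
    have "Poly_Mapping.single 0 c \<in> semigroup_algebra S" by (simp add: semigroup_algebra_def zero_mem)
    then show ?thesis
      using weighted_sum_mult[OF _ that p(2), of "Poly_Mapping.single 0 c"]
      by (simp add: semigroup_algebra_scale_eq p(1))
  qed
  moreover have "weighted_sum (point x u) 1 = 1"
    by (simp only: single_one[symmetric] weighted_sum_single p(1)) simp
  ultimately show ?thesis unfolding algebra_characters_def
    using weighted_sum_mult[OF _ _ p(2)] weighted_sum_star[where \<phi> = "point x u" and adj = adj, OF _ p(3)] by auto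
qed

text \<open>A shift by u^n clears negative exponents. Since \<open>\<iota>\<close> is injective on
  S, distinct basis elements give distinct monomials, so no cancellation can hide a nonzero
  f.\<close>

lemma point_polynomial:
  assumes f: "f \<in> semigroup_algebra S"
  shows "\<exists>E n. (\<forall>x u. norm u = 1 \<longrightarrow> weighted_sum (point x u) f = eval2 E (of_real x) u / u ^ n) \<and>
    (E = 0 \<longrightarrow> f = 0)"
proof -
  let ?K = "Poly_Mapping.keys f"
  have KS: "?K \<subseteq> S" using f by (simp add: semigroup_algebra_def)
  define n where "n = (\<Sum>s\<in>?K. nat \<bar>snd (\<iota> s)\<bar>)"
  have n: "0 \<le> snd (\<iota> s) + int n" if "s \<in> ?K" for s
  proof -
    have "nat \<bar>snd (\<iota> s)\<bar> \<le> n" unfolding n_def by (rule member_le_sum) (use that in auto)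
    then show ?thesis by linarith
  qed
  define E where "E = (\<Sum>s\<in>?K. monom (monom (Poly_Mapping.lookup f s) (nat (snd (\<iota> s) + int n))) (fst (\<iota> s)))"
  have "weighted_sum (point x u) f = eval2 E (of_real x) u / u ^ n" if u: "norm u = 1" for x u
  proof -
    have u0: "u \<noteq> 0" using u by auto
    have "u ^ nat (snd (\<iota> s) + int n) = u powi snd (\<iota> s) * u ^ n" if "s \<in> ?K" for s
    proof -
      have "u ^ nat (snd (\<iota> s) + int n) = u powi (snd (\<iota> s) + int n)"
        using n[OF that] by (simp add: power_int_def)
      then show ?thesis using u0 by (simp add: power_int_add)
    qed
    then have "eval2 E (of_real x) u = (\<Sum>s\<in>?K. Poly_Mapping.lookup f s * point x u s * u ^ n)"
      unfolding E_def eval2_sum by (intro sum.cong refl) (simp add: poly_monom point_def)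
    then show ?thesis using u0 by (simp add: weighted_sum_def sum_distrib_right[symmetric])
  qed
  moreover have "f = 0" if "E = 0"
  proof (rule poly_mapping_eqI)
    fix s
    show "Poly_Mapping.lookup f s = Poly_Mapping.lookup 0 s"
    proof (cases "s \<in> ?K")
      case True
      have "coeff (coeff E (fst (\<iota> s))) (nat (snd (\<iota> s) + int n)) =
          (\<Sum>t\<in>?K. if t = s then Poly_Mapping.lookup f t else 0)"
        unfolding E_def coeff_sum
      proof (intro sum.cong refl)
        fix t assume t: "t \<in> ?K"
        have "fst (\<iota> t) = fst (\<iota> s) \<and> nat (snd (\<iota> t) + int n) = nat (snd (\<iota> s) + int n) \<longleftrightarrow> t = s"
        proof
          assume *: "fst (\<iota> t) = fst (\<iota> s) \<and> nat (snd (\<iota> t) + int n) = nat (snd (\<iota> s) + int n)"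
          then have "snd (\<iota> t) = snd (\<iota> s)" using n[OF t] n[OF True] by (simp add: eq_nat_nat_iff)
          with * have "\<iota> t = \<iota> s" by (simp add: prod_eq_iff)
          then show "t = s" using \<iota>_inj t True KS by (meson inj_onD subsetD)
        qed simp
        then show "coeff (coeff (monom (monom (Poly_Mapping.lookup f t) (nat (snd (\<iota> t) + int n))) (fst (\<iota> t))) (fst (\<iota> s)))
            (nat (snd (\<iota> s) + int n)) = (if t = s then Poly_Mapping.lookup f t else 0)"
          by (auto simp: coeff_monom)
      qed
      also have "\<dots> = Poly_Mapping.lookup f s" using True by simp
      finally show ?thesis using that by simp
    qed (simp add: in_keys_iff)
  qed
  ultimately show ?thesis by blast
qed

lemma point_separates:
  assumes "f \<in> semigroup_algebra S" "\<And>x u. norm u = 1 \<Longrightarrow> weighted_sum (point x u) f = 0"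
  shows "f = 0"
proof -
  obtain E n where E: "\<And>x u. norm u = 1 \<Longrightarrow> weighted_sum (point x u) f = eval2 E (of_real x) u / u ^ n"
    "E = 0 \<Longrightarrow> f = 0"
    using point_polynomial[OF assms(1)] by blast
  have "E = 0"
  proof (rule eval2_eqI)
    fix x and u :: complex assume u: "norm u = 1"
    then have "u \<noteq> 0" by auto
    then show "eval2 E (of_real x) u = eval2 0 (of_real x) u" using E(1)[OF u, of x] assms(2)[OF u, of x] by simp
  qed
  then show ?thesis by (rule E(2))
qed

text \<open>Points separate the algebra, so an identity of values at all points is an identity of
  elements.\<close>

lemma mem_hermitian_square_sums:
  assumes f: "f \<in> semigroup_algebra S" and as: "set as \<subseteq> semigroup_algebra S"
    and eq: "\<And>x u. norm u = 1 \<Longrightarrow> weighted_sum (point x u) f = of_real (\<Sum>a\<leftarrow>as. (norm (weighted_sum (point x u) a))\<^sup>2)"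
  shows "f \<in> semigroup_hermitian_square_sums S adj"
proof -
  interpret A: complex_star_algebra "semigroup_algebra S" semigroup_algebra_scale "semigroup_algebra_star adj"
    by (rule complex_star_algebra_semigroup_algebra)
  let ?n = "length as"
  define g where "g = (\<Sum>j<?n. semigroup_algebra_star adj (as ! j) * as ! j)"
  have asj: "as ! j \<in> semigroup_algebra S" if "j < ?n" for j using as that by auto
  have g: "g \<in> semigroup_algebra S"
    unfolding g_def by (intro A.sum_mem A.mult_mem A.star_mem asj) auto
  have "f - g = 0"
  proof (rule point_separates)
    have "f - g = f + semigroup_algebra_scale (- 1) g"
      by (rule poly_mapping_eqI) (simp add: lookup_semigroup_algebra_scale lookup_add lookup_minus)
    then show "f - g \<in> semigroup_algebra S"
      using A.add_mem[OF f A.scale_mem[OF g, of "- 1"]] by metis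
    fix x and u :: complex assume u: "norm u = 1"
    note p = point_props(1)[OF u, of x] point_props(2)[OF u, where x = x] point_props(3)[OF u, where x = x]
    have "weighted_sum (point x u) (semigroup_algebra_star adj (as ! j) * as ! j) =
        of_real ((norm (weighted_sum (point x u) (as ! j)))\<^sup>2)" if "j < ?n" for j
    proof -
      have "weighted_sum (point x u) (semigroup_algebra_star adj (as ! j) * as ! j) =
          cnj (weighted_sum (point x u) (as ! j)) * weighted_sum (point x u) (as ! j)"
        by (simp only: weighted_sum_mult[OF A.star_mem[OF asj[OF that]] asj[OF that] p(2)]
          weighted_sum_star[where \<phi> = "point x u" and adj = adj, OF asj[OF that] p(3)])
      then show ?thesis by (simp only: complex_norm_square mult.commute)
    qed
    then have "weighted_sum (point x u) g = of_real (\<Sum>j<?n. (norm (weighted_sum (point x u) (as ! j)))\<^sup>2)"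
      by (simp add: g_def)
    also have "(\<Sum>j<?n. (norm (weighted_sum (point x u) (as ! j)))\<^sup>2) = (\<Sum>a\<leftarrow>as. (norm (weighted_sum (point x u) a))\<^sup>2)"
      by (simp add: sum_list_sum_nth atLeast0LessThan)
    finally show "weighted_sum (point x u) (f - g) = 0" by (simp add: eq[OF u])
  qed
  then have "f = g" by simp
  then show ?thesis
    unfolding semigroup_hermitian_square_sums_def hermitian_square_sums_def g_def using asj by blast
qed

lemma point_nonneg_imp_sos:
  assumes f: "f \<in> semigroup_algebra S" and nonneg: "\<And>x u. norm u = 1 \<Longrightarrow> weighted_sum (point x u) f \<in> \<real>\<^sub>\<ge>\<^sub>0"
  shows "\<exists>Qs. \<forall>x u. norm u = 1 \<longrightarrow>
    weighted_sum (point x u) f = of_real (\<Sum>Q\<leftarrow>Qs. (norm (eval2 Q (of_real x) u))\<^sup>2)"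
proof -
  define p where "p x u = Re (weighted_sum (point x u) f)" for x u
  have p: "weighted_sum (point x u) f = of_real (p x u)" "0 \<le> p x u" if "norm u = 1" for x u
    using nonneg[OF that, of x] by (auto simp: p_def complex_nonneg_Reals_iff complex_eq_iff)
  obtain E n where E: "\<And>x u. norm u = 1 \<Longrightarrow> weighted_sum (point x u) f = eval2 E (of_real x) u / u ^ n"
    using point_polynomial[OF f] by blast
  have "laurent (degree E) (\<lambda>x u. of_real (p x u))"
    unfolding laurent_def using E p(1) by (intro exI[of _ E] exI[of _ n]) auto
  then have "sos p" using p(2) by (rule nonneg_laurent_imp_sos)
  then obtain Qs where "\<And>x u. norm u = 1 \<Longrightarrow> p x u = (\<Sum>Q\<leftarrow>Qs. (norm (eval2 Q (of_real x) u))\<^sup>2)"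
    unfolding sos_def by blast
  then show ?thesis using p(1) by (intro exI[of _ Qs]) simp
qed

end

lemma eval2_double_sum:
  "eval2 Q x u = (\<Sum>i\<le>degree Q. \<Sum>j\<le>degree (coeff Q i). coeff (coeff Q i) j * (x ^ i * u ^ j))"
  by (simp add: eval2_altdef poly_altdef sum_distrib_right sum_distrib_left mult_ac)

section \<open>The three semigroups\<close>

interpretation nat_int: graded_star_semigroup UNIV neg_snd_adj id
  by (intro graded_star_semigroup.intro abelian_star_semigroup_nat_int, unfold_locales)
    (auto simp: neg_snd_adj_def)

text \<open>Every monomial x^i u^j comes from a basis element here, so the polynomials in the sum of
  squares lift directly.\<close>

theorem hermitian_square_sums_nat_int:
  "semigroup_hermitian_square_sums (UNIV :: (nat \<times> int) set) neg_snd_adj =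
    semigroup_character_nonneg UNIV neg_snd_adj"
proof
  show "semigroup_hermitian_square_sums (UNIV :: (nat \<times> int) set) neg_snd_adj
      \<subseteq> semigroup_character_nonneg UNIV neg_snd_adj"
    unfolding semigroup_hermitian_square_sums_def semigroup_character_nonneg_def
    by (intro complex_star_algebra.hermitian_square_sums_nonneg
      nat_int.complex_star_algebra_semigroup_algebra)
  show "semigroup_character_nonneg UNIV neg_snd_adj
      \<subseteq> semigroup_hermitian_square_sums (UNIV :: (nat \<times> int) set) neg_snd_adj"
  proof
    fix f :: "(nat \<times> int) \<Rightarrow>\<^sub>0 complex"
    assume f: "f \<in> semigroup_character_nonneg UNIV neg_snd_adj"
    have fS: "f \<in> semigroup_algebra UNIV" by (simp add: semigroup_algebra_def)
    have "\<exists>Qs. \<forall>x u. norm u = 1 \<longrightarrow> weighted_sum (nat_int.point x u) f =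
        of_real (\<Sum>Q\<leftarrow>Qs. (norm (eval2 Q (of_real x) u))\<^sup>2)"
      by (rule nat_int.point_nonneg_imp_sos[OF fS])
        (use f nat_int.point_character in \<open>auto simp: semigroup_character_nonneg_def character_nonneg_def\<close>)
    then obtain Qs where Qs: "\<And>x u. norm u = 1 \<Longrightarrow> weighted_sum (nat_int.point x u) f =
        of_real (\<Sum>Q\<leftarrow>Qs. (norm (eval2 Q (of_real x) u))\<^sup>2)" by blast
    define T where "T Q = (\<Sum>i\<le>degree Q. \<Sum>j\<le>degree (coeff Q i).
      Poly_Mapping.single (i, int j) (coeff (coeff Q i) j))" for Q :: "complex poly poly"
    have T: "weighted_sum (nat_int.point x u) (T Q) = eval2 Q (of_real x) u" for x u Q
      by (simp add: T_def nat_int.point_def eval2_double_sum)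
    show "f \<in> semigroup_hermitian_square_sums UNIV neg_snd_adj"
      by (rule nat_int.mem_hermitian_square_sums[OF fS, of "map T Qs"])
        (simp_all add: semigroup_algebra_def Qs T o_def)
  qed
qed

text \<open>Polar coordinates with z = x u and x of either sign: z^k cnj(z)^n = x^(k+n)
  u^(k-n).\<close>

definition N_plus_degree :: "int \<times> int \<Rightarrow> nat \<times> int" where
  "N_plus_degree s = (nat (fst s + snd s), fst s - snd s)"

interpretation N_plus: graded_star_semigroup N_plus swap_adj N_plus_degree
proof (intro graded_star_semigroup.intro abelian_star_semigroup_N_plus, unfold_locales)
  show "inj_on N_plus_degree N_plus"
    by (rule inj_onI) (auto simp: N_plus_degree_def N_plus_def eq_nat_nat_iff)
qed (auto simp: N_plus_degree_def N_plus_def swap_adj_def zero_prod_def nat_add_distrib[symmetric] algebra_simps)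

text \<open>
  The image of \<open>N_plus\<close> consists of the pairs of equal parity. The monomials of odd parity are moved
  into it by a multiplication with \<open>u\<close>; the mixed terms cancel under \<open>(x, u) \<mapsto> (- x, - u)\<close>.
\<close>

lemma N_plus_point_nonneg_imp_square_sum:
  assumes f: "f \<in> semigroup_algebra N_plus"
    and nonneg: "\<And>x u. norm u = 1 \<Longrightarrow> weighted_sum (N_plus.point x u) f \<in> \<real>\<^sub>\<ge>\<^sub>0"
  shows "f \<in> semigroup_hermitian_square_sums N_plus swap_adj"
proof -
  obtain Qs where Qs: "\<And>x u. norm u = 1 \<Longrightarrow> weighted_sum (N_plus.point x u) f =
      of_real (\<Sum>Q\<leftarrow>Qs. (norm (eval2 Q (of_real x) u))\<^sup>2)"
    using N_plus.point_nonneg_imp_sos[OF f nonneg] by blast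
  \<comment> \<open>The part of Q of parity r, multiplied by u^r and lifted: x^i u^(j+r) belongs to
    an element of \<open>N_plus\<close> because i + j + r is even.\<close>
  define e where "e r Q = (\<Sum>i\<le>degree Q. \<Sum>j\<le>degree (coeff Q i).
    if (i + j) mod 2 = r then Poly_Mapping.single ((int i + int (j + r)) div 2, (int i - int (j + r)) div 2) (coeff (coeff Q i) j) else 0)"
    for r :: nat and Q :: "complex poly poly"
  define q where "q r Q x u = (\<Sum>i\<le>degree Q. \<Sum>j\<le>degree (coeff Q i).
    if (i + j) mod 2 = r then coeff (coeff Q i) j * (of_real x ^ i * u ^ j) else 0)"
    for r :: nat and Q :: "complex poly poly" and x :: real and u :: complex
  have half: "(int i + int (j + r)) div 2 + (int i - int (j + r)) div 2 = int i"
    "(int i + int (j + r)) div 2 - (int i - int (j + r)) div 2 = int (j + r)"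
    if "(i + j) mod 2 = r" for i j r :: nat
  proof -
    have "even (int i + int (j + r))" using that by presburger
    moreover from this have "even (int i - int (j + r))" by presburger
    ultimately show "(int i + int (j + r)) div 2 + (int i - int (j + r)) div 2 = int i"
      "(int i + int (j + r)) div 2 - (int i - int (j + r)) div 2 = int (j + r)" by presburger+
  qed
  have e_mem: "e r Q \<in> semigroup_algebra N_plus" for r Q
  proof -
    interpret A: complex_star_algebra "semigroup_algebra N_plus" semigroup_algebra_scale "semigroup_algebra_star swap_adj"
      by (rule N_plus.complex_star_algebra_semigroup_algebra)
    show ?thesis unfolding e_def
    proof (intro A.sum_mem)
      fix i j
      show "(if (i + j) mod 2 = r then Poly_Mapping.single ((int i + int (j + r)) div 2, (int i - int (j + r)) div 2) (coeff (coeff Q i) j) else 0)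
          \<in> semigroup_algebra N_plus"
        using half(1)[of i j r] by (auto simp: semigroup_algebra_def N_plus_def)
    qed
  qed
  have e_eval: "weighted_sum (N_plus.point x u) (e r Q) = u ^ r * q r Q x u" for r Q x u
    unfolding e_def q_def weighted_sum_sum sum_distrib_left
    by (intro sum.cong refl)
      (auto simp: N_plus.point_def N_plus_degree_def half power_add simp del: of_nat_add)
  have q_sum: "eval2 Q (of_real x) u = q 0 Q x u + q 1 Q x u" for Q x u
    unfolding q_def eval2_double_sum sum.distrib[symmetric]
    by (intro sum.cong refl) (auto simp: mod2_eq_if)
  have q_diff: "eval2 Q (of_real (- x)) (- u) = q 0 Q x u - q 1 Q x u" for Q x u
    unfolding q_def eval2_double_sum sum_subtractf[symmetric]
  proof (intro sum.cong refl)
    fix i j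
    have "of_real (- x) ^ i * (- u) ^ j = (- 1) ^ (i + j) * (of_real x ^ i * u ^ j)"
      by (simp add: power_minus[of "of_real x"] power_minus[of u] power_add)
    then show "coeff (coeff Q i) j * (of_real (- x) ^ i * (- u) ^ j) =
      (if (i + j) mod 2 = 0 then coeff (coeff Q i) j * (of_real x ^ i * u ^ j) else 0) -
      (if (i + j) mod 2 = 1 then coeff (coeff Q i) j * (of_real x ^ i * u ^ j) else 0)"
      by (auto simp: mod2_eq_if simp del: of_real_minus)
  qed
  have parallelogram: "(norm (a + b))\<^sup>2 + (norm (a - b))\<^sup>2 = 2 * ((norm a)\<^sup>2 + (norm b)\<^sup>2)" for a b :: complex
    unfolding cmod_power2 by (simp add: power2_eq_square algebra_simps)
  have sym: "weighted_sum (N_plus.point (- x) (- u)) f = weighted_sum (N_plus.point x u) f" if "u \<noteq> 0" for x u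
    unfolding weighted_sum_def
  proof (intro sum.cong refl arg_cong2[of _ _ _ _ "(*)"])
    fix s assume "s \<in> Poly_Mapping.keys f"
    then have "s \<in> N_plus" using f by (auto simp: semigroup_algebra_def)
    then have s: "0 \<le> fst s + snd s" by (auto simp: N_plus_def)
    have "even (nat (fst s + snd s)) \<longleftrightarrow> even (fst s - snd s)"
      using s by (simp add: even_nat_iff)
    moreover have "(- u) powi (fst s - snd s) = (if even (fst s - snd s) then u powi (fst s - snd s) else - (u powi (fst s - snd s)))"
      by (simp add: power_int_minus_left)
    ultimately show "N_plus.point (- x) (- u) s = N_plus.point x u s"
      by (simp add: N_plus.point_def N_plus_degree_def)
  qed
  show ?thesis
  proof (rule N_plus.mem_hermitian_square_sums[OF f, of "map (e 0) Qs @ map (e 1) Qs"])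
    show "set (map (e 0) Qs @ map (e 1) Qs) \<subseteq> semigroup_algebra N_plus" using e_mem by auto
    fix x and u :: complex assume u: "norm u = 1"
    then have u0: "u \<noteq> 0" and u': "norm (- u) = 1" by auto
    \<comment> \<open>Averaging over (x, u) and (-x, -u), which give f the same value, removes the
      mixed terms by the parallelogram law.\<close>
    define w where "w = weighted_sum (N_plus.point x u) f"
    have "w + w = weighted_sum (N_plus.point x u) f + weighted_sum (N_plus.point (- x) (- u)) f"
      by (simp add: w_def sym[OF u0])
    also have "\<dots> = of_real (\<Sum>Q\<leftarrow>Qs. (norm (q 0 Q x u + q 1 Q x u))\<^sup>2 + (norm (q 0 Q x u - q 1 Q x u))\<^sup>2)"
      unfolding Qs[OF u] Qs[OF u'] q_sum[of _ x u] q_diff by (simp add: sum_list_addf)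
    also have "\<dots> = of_real (\<Sum>Q\<leftarrow>Qs. 2 * ((norm (q 0 Q x u))\<^sup>2 + (norm (q 1 Q x u))\<^sup>2))"
      by (simp only: parallelogram)
    also have "\<dots> = 2 * of_real (\<Sum>Q\<leftarrow>Qs. (norm (q 0 Q x u))\<^sup>2 + (norm (q 1 Q x u))\<^sup>2)"
      unfolding sum_list_const_mult by simp
    finally have "w = of_real (\<Sum>Q\<leftarrow>Qs. (norm (q 0 Q x u))\<^sup>2 + (norm (q 1 Q x u))\<^sup>2)" by simp
    then show "weighted_sum (N_plus.point x u) f =
        of_real (\<Sum>a\<leftarrow>map (e 0) Qs @ map (e 1) Qs. (norm (weighted_sum (N_plus.point x u) a))\<^sup>2)"
      using u by (simp add: w_def e_eval sum_list_addf o_def norm_mult)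
  qed
qed

theorem hermitian_square_sums_N_plus:
  "semigroup_hermitian_square_sums N_plus swap_adj = semigroup_character_nonneg N_plus swap_adj"
proof
  show "semigroup_hermitian_square_sums N_plus swap_adj \<subseteq> semigroup_character_nonneg N_plus swap_adj"
    unfolding semigroup_hermitian_square_sums_def semigroup_character_nonneg_def
    by (intro complex_star_algebra.hermitian_square_sums_nonneg
      N_plus.complex_star_algebra_semigroup_algebra)
  show "semigroup_character_nonneg N_plus swap_adj \<subseteq> semigroup_hermitian_square_sums N_plus swap_adj"
  proof
    fix f assume f: "f \<in> semigroup_character_nonneg N_plus swap_adj"
    then show "f \<in> semigroup_hermitian_square_sums N_plus swap_adj"
      by (intro N_plus_point_nonneg_imp_square_sum)
        (use N_plus.point_character in \<open>auto simp: semigroup_character_nonneg_def character_nonneg_def\<close>)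
  qed
qed

interpretation int_int: abelian_star_semigroup UNIV swap_adj
  by (rule abelian_star_semigroup_int_int)

text \<open>
  Multiplication by a high power of the hermitian square of the invertible generator \<open>(1, 0)\<close>
  moves \<open>f\<close> into the algebra of \<open>N_plus\<close>.
\<close>

theorem hermitian_square_sums_int_int:
  "semigroup_hermitian_square_sums (UNIV :: (int \<times> int) set) swap_adj =
    semigroup_character_nonneg UNIV swap_adj"
proof
  show "semigroup_hermitian_square_sums (UNIV :: (int \<times> int) set) swap_adj
      \<subseteq> semigroup_character_nonneg UNIV swap_adj"
    unfolding semigroup_hermitian_square_sums_def semigroup_character_nonneg_def
    by (intro complex_star_algebra.hermitian_square_sums_nonneg
      int_int.complex_star_algebra_semigroup_algebra)
  show "semigroup_character_nonneg UNIV swap_adj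
      \<subseteq> semigroup_hermitian_square_sums (UNIV :: (int \<times> int) set) swap_adj"
  proof
    fix f :: "(int \<times> int) \<Rightarrow>\<^sub>0 complex"
    assume f: "f \<in> semigroup_character_nonneg UNIV swap_adj"
    \<comment> \<open>The summand 1 makes all x-exponents of the shifted element strictly positive,
      so that it vanishes at x = 0.\<close>
    define N where "N = 1 + (\<Sum>s\<in>Poly_Mapping.keys f. \<bar>fst s + snd s\<bar>)"
    have N: "fst s + snd s + 2 * N > 0" if "s \<in> Poly_Mapping.keys f" for s
    proof -
      have "\<bar>fst s + snd s\<bar> \<le> (\<Sum>s\<in>Poly_Mapping.keys f. \<bar>fst s + snd s\<bar>)"
        by (rule member_le_sum) (use that in auto)
      then show ?thesis by (simp add: N_def)
    qed
    define g where "g = Poly_Mapping.single (N, N) 1 * f"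
    have g: "g = (\<Sum>s\<in>Poly_Mapping.keys f. Poly_Mapping.single ((N, N) + s) (Poly_Mapping.lookup f s))"
      unfolding g_def by (subst semigroup_algebra_expansion[of f]) (simp add: sum_distrib_left mult_single)
    have g_mem: "g \<in> semigroup_algebra N_plus"
    proof -
      have "(N, N) + s \<in> N_plus" if "s \<in> Poly_Mapping.keys f" for s
        using N[OF that] by (cases s) (auto simp: N_plus_def)
      then show ?thesis
        unfolding g semigroup_algebra_def
        by (intro CollectI order.trans[OF keys_sum]) (auto simp: subset_iff split: if_splits)
    qed
    \<comment> \<open>For nonzero x the point extends to a character on Z^2. At x = 0 it does not,
      and there g vanishes by the choice of N.\<close>
    have "weighted_sum (N_plus.point x u) g \<in> \<real>\<^sub>\<ge>\<^sub>0" if u: "norm u = 1" for x u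
    proof (cases "x = 0")
      case True
      have "weighted_sum (N_plus.point x u) g = 0"
        unfolding g weighted_sum_sum
      proof (rule sum.neutral, safe)
        fix s assume "s \<in> Poly_Mapping.keys f"
        then show "weighted_sum (N_plus.point x u) (Poly_Mapping.single ((N, N) + s) (Poly_Mapping.lookup f s)) = 0"
          using N[of s] True by (cases s) (simp add: N_plus.point_def N_plus_degree_def power_0_left)
      qed
      then show ?thesis by simp
    next
      case False
      have u0: "u \<noteq> 0" using u by auto
      have cu: "cnj u = inverse u"
        using u u0 by (metis complex_norm_square inverse_unique of_real_1 one_power2)
      define \<phi> where "\<phi> s = complex_of_real x powi (fst s + snd s) * u powi (fst s - snd s)" for s :: "int \<times> int"
      have \<phi>: "\<phi> 0 = 1" "\<phi> (s + t) = \<phi> s * \<phi> t" "\<phi> (swap_adj s) = cnj (\<phi> s)" for s t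
      proof -
        have "fst (s + t) + snd (s + t) = (fst s + snd s) + (fst t + snd t)"
          "fst (s + t) - snd (s + t) = (fst s - snd s) + (fst t - snd t)" by auto
        then show "\<phi> (s + t) = \<phi> s * \<phi> t"
          unfolding \<phi>_def using False u0 by (simp only: power_int_add) (simp add: power_int_add mult_ac)
        have "u powi (snd s - fst s) = inverse u powi (fst s - snd s)"
          using power_int_minus[of u "fst s - snd s"] by (simp add: power_int_inverse)
        then show "\<phi> (swap_adj s) = cnj (\<phi> s)"
          by (simp add: \<phi>_def swap_adj_def case_prod_beta complex_cnj_power_int cu add.commute)
      qed (simp add: \<phi>_def)
      have mem: "h \<in> semigroup_algebra UNIV" for h :: "(int \<times> int) \<Rightarrow>\<^sub>0 complex"
        by (simp add: semigroup_algebra_def)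
      have mult: "weighted_sum \<phi> (h * k) = weighted_sum \<phi> h * weighted_sum \<phi> k" for h k
        using weighted_sum_mult[OF mem mem \<phi>(2)] .
      have "weighted_sum \<phi> \<in> algebra_characters (semigroup_algebra UNIV) semigroup_algebra_scale
          (semigroup_algebra_star swap_adj)"
        unfolding algebra_characters_def
        using weighted_sum_star[where \<phi> = \<phi> and adj = swap_adj, OF mem \<phi>(3)]
        by (auto simp: mult semigroup_algebra_scale_eq \<phi>(1) simp flip: single_one)
      then have nonneg: "weighted_sum \<phi> f \<in> \<real>\<^sub>\<ge>\<^sub>0"
        using f by (simp add: semigroup_character_nonneg_def character_nonneg_def)
      have "weighted_sum (N_plus.point x u) g = weighted_sum \<phi> g"
      proof -
        have "N_plus.point x u s = \<phi> s" if "s \<in> Poly_Mapping.keys g" for s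
        proof -
          have "fst s + snd s \<ge> 0" using g_mem that by (auto simp: semigroup_algebra_def N_plus_def)
          then have "complex_of_real x powi (fst s + snd s) = of_real x ^ nat (fst s + snd s)"
            by (simp add: power_int_def)
          then show ?thesis by (simp only: N_plus.point_def N_plus_degree_def \<phi>_def fst_conv snd_conv)
        qed
        then show ?thesis unfolding weighted_sum_def by (intro sum.cong refl) simp
      qed
      also have "\<dots> = of_real (x powi (2 * N)) * weighted_sum \<phi> f"
      proof -
        have "\<phi> (N, N) = of_real (x powi (2 * N))"
          unfolding \<phi>_def mult_2 of_real_power_int by simp
        then show ?thesis unfolding g_def mult by simp
      qed
      also have "\<dots> \<in> \<real>\<^sub>\<ge>\<^sub>0"
      proof (rule nonneg_Reals_mult_I[OF _ nonneg])
        have "x powi (2 * N) = (x powi N)\<^sup>2"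
          unfolding mult_2 power2_eq_square by (rule power_int_add) (use False in simp)
        then show "complex_of_real (x powi (2 * N)) \<in> \<real>\<^sub>\<ge>\<^sub>0" by (simp only: nonneg_Reals_of_real_iff) simp
      qed
      finally show ?thesis .
    qed
    then have "g \<in> semigroup_hermitian_square_sums N_plus swap_adj"
      by (rule N_plus_point_nonneg_imp_square_sum[OF g_mem])
    then obtain n :: nat and a where a: "g = (\<Sum>j<n. semigroup_algebra_star swap_adj (a j) * a j)"
      unfolding semigroup_hermitian_square_sums_def hermitian_square_sums_def by blast
    \<comment> \<open>star z * z is the inverse of the basis element (N, N), so multiplying the
      squares by it recovers f as a sum of squares.\<close>
    define z where "z = (Poly_Mapping.single (- N, 0) 1 :: (int \<times> int) \<Rightarrow>\<^sub>0 complex)"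
    have star_z: "semigroup_algebra_star swap_adj z = Poly_Mapping.single (0, - N) 1"
      by (simp add: z_def semigroup_algebra_star_single swap_adj_def)
    have zz: "semigroup_algebra_star swap_adj z * z * Poly_Mapping.single (N, N) 1 = 1"
      unfolding star_z by (simp add: z_def mult_single zero_prod_def flip: single_one)
    have "f = semigroup_algebra_star swap_adj z * z * g"
      unfolding g_def by (simp only: mult.assoc[symmetric] zz mult_1)
    also have "\<dots> = (\<Sum>j<n. semigroup_algebra_star swap_adj (z * a j) * (z * a j))"
      unfolding a sum_distrib_left
    proof (intro sum.cong refl)
      fix j
      have "semigroup_algebra_star swap_adj (z * a j) = semigroup_algebra_star swap_adj (a j) * semigroup_algebra_star swap_adj z"
        by (rule int_int.semigroup_algebra_star_mult) (simp_all add: semigroup_algebra_def)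
      then show "semigroup_algebra_star swap_adj z * z * (semigroup_algebra_star swap_adj (a j) * a j) =
          semigroup_algebra_star swap_adj (z * a j) * (z * a j)" by (simp add: mult_ac)
    qed
    finally show "f \<in> semigroup_hermitian_square_sums UNIV swap_adj"
      unfolding semigroup_hermitian_square_sums_def hermitian_square_sums_def
      by (auto simp: semigroup_algebra_def)
  qed
qed

theorem theorem17:
  shows "semigroup_hermitian_square_sums (UNIV :: (int \<times> int) set) swap_adj =
           semigroup_character_nonneg (UNIV :: (int \<times> int) set) swap_adj \<and>
         semigroup_hermitian_square_sums (UNIV :: (nat \<times> int) set) neg_snd_adj =
           semigroup_character_nonneg (UNIV :: (nat \<times> int) set) neg_snd_adj \<and>
         semigroup_hermitian_square_sums N_plus swap_adj =
           semigroup_character_nonneg N_plus swap_adj"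
  using hermitian_square_sums_int_int hermitian_square_sums_nat_int hermitian_square_sums_N_plus
  by blast

end
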